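(* Let $(\mathcal{M},\mathsf{g})$ be a Riemannian manifold and let $f$ be a smooth function on $\mathcal{M}$. Suppose that for any critical point $x\in \mathcal{M}$ of $f$, there exists a neighbourhood $U$ of $x$ such that the Riemannian Hessian $\mathrm{Hess}_{\mathsf{g}} f (y)$ is positive semidefinite for all $y \in U$. Then there exists a connection $\nabla$ on $\mathcal{M}$ such that $f$ is g-convex with respect to $\nabla$.
   Context: A connection means a smooth torsion-free affine connection $\nabla$ ($\nabla_XY-\nabla_YX=[X,Y]$). The Hessian of $f$ with respect to $\nabla$ is $\mathrm{Hess}_\nabla f(X,Y)=X(Y(f))-(\nabla_XY)(f)$, and $\mathrm{Hess}_{\mathsf{g}} f$ is the Hessian with respect to the Levi-Civita connection of $\mathsf{g}$. The function $f$ is g-convex with respect to $\nabla$ if $f\circ\gamma:[0,1]\to\mathbb{R}$ is convex for every $\nabla$-geodesic $\gamma:[0,1]\to\mathcal{M}$; equivalently, $\mathrm{Hess}_\nabla f$ is positive semidefinite at every point. *)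

theory Defs
  imports "HOL-Analysis.Analysis"
begin

text \<open>
  Smooth manifolds without boundary, modelled on a Euclidean space \<open>'e\<close>. The underlying
  Hausdorff second-countable space is the type \<open>'a\<close> itself; the smooth structure is given by
  an atlas, which need not be maximal.
\<close>

section \<open>Smooth manifolds\<close>

text \<open>\<open>Ck_on k S f\<close> is meant for open \<open>S\<close>. As the domain is finite-dimensional, it is enough
  to iterate directional derivatives.\<close>

primrec Ck_on :: "nat \<Rightarrow> 'e::euclidean_space set \<Rightarrow> ('e \<Rightarrow> 'f::real_normed_vector) \<Rightarrow> bool" where
  "Ck_on 0 S f \<longleftrightarrow> continuous_on S f"
| "Ck_on (Suc k) S f \<longleftrightarrow>
     (\<forall>x\<in>S. f differentiable (at x)) \<and> (\<forall>v. Ck_on k S (\<lambda>x. frechet_derivative f (at x) v))"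

definition smooth_on :: "'e::euclidean_space set \<Rightarrow> ('e \<Rightarrow> 'f::real_normed_vector) \<Rightarrow> bool" where
  "smooth_on S f \<longleftrightarrow> (\<forall>k. Ck_on k S f)"

type_synonym ('a, 'e) chart = "'a set \<times> ('a \<Rightarrow> 'e)"

abbreviation dom_of :: "('a, 'e) chart \<Rightarrow> 'a set" where
  "dom_of c \<equiv> fst c"

abbreviation coord :: "('a, 'e) chart \<Rightarrow> 'a \<Rightarrow> 'e" where
  "coord c \<equiv> snd c"

definition img_of :: "('a, 'e) chart \<Rightarrow> 'e set" where
  "img_of c = coord c ` dom_of c"

definition param :: "('a, 'e) chart \<Rightarrow> 'e \<Rightarrow> 'a" where
  "param c = inv_into (dom_of c) (coord c)"

definition is_chart :: "('a::topological_space, 'e::euclidean_space) chart \<Rightarrow> bool" where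
  "is_chart c \<longleftrightarrow> open (dom_of c) \<and> open (img_of c) \<and>
     homeomorphism (dom_of c) (img_of c) (coord c) (param c)"

definition smooth_atlas ::
    "('a::{t2_space, second_countable_topology}, 'e::euclidean_space) chart set \<Rightarrow> bool" where
  "smooth_atlas A \<longleftrightarrow>
     (\<forall>c\<in>A. is_chart c) \<and>
     (\<Union>c\<in>A. dom_of c) = UNIV \<and>
     (\<forall>c\<in>A. \<forall>d\<in>A. smooth_on (coord c ` (dom_of c \<inter> dom_of d)) (coord d \<circ> param c))"

definition smooth_fun :: "('a, 'e::euclidean_space) chart set \<Rightarrow> ('a \<Rightarrow> real) \<Rightarrow> bool" where
  "smooth_fun A h \<longleftrightarrow> (\<forall>c\<in>A. smooth_on (img_of c) (h \<circ> param c))"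

section \<open>Tangent vectors and vector fields\<close>

text \<open>
  A tangent vector at \<open>p\<close> is the family of its components in all charts of the atlas around \<open>p\<close>,
  subject to the usual transformation rule. Irrelevant entries are fixed to be \<open>0\<close>, so that
  equality in \<open>tangent_space A p\<close> is equality of functions and the vector space operations
  are pointwise.
\<close>

type_synonym ('a, 'e) tangent = "('a, 'e) chart \<Rightarrow> 'e"

definition tangent_space ::
    "('a, 'e::euclidean_space) chart set \<Rightarrow> 'a \<Rightarrow> ('a, 'e) tangent set" where
  "tangent_space A p = {v.
     (\<forall>c\<in>A. \<forall>d\<in>A. p \<in> dom_of c \<inter> dom_of d \<longrightarrow>
        v d = frechet_derivative (coord d \<circ> param c) (at (coord c p)) (v c)) \<and>
     (\<forall>c. \<not> (c \<in> A \<and> p \<in> dom_of c) \<longrightarrow> v c = 0)}"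

type_synonym ('a, 'e) vfield = "'a \<Rightarrow> ('a, 'e) tangent"

definition vector_fields :: "('a, 'e::euclidean_space) chart set \<Rightarrow> ('a, 'e) vfield set" where
  "vector_fields A = {X.
     (\<forall>p. X p \<in> tangent_space A p) \<and>
     (\<forall>c\<in>A. smooth_on (img_of c) (\<lambda>x. X (param c x) c))}"

definition vf_add :: "('a, 'e::euclidean_space) vfield \<Rightarrow> ('a, 'e) vfield \<Rightarrow> ('a, 'e) vfield" where
  "vf_add X Y = (\<lambda>p c. X p c + Y p c)"

definition vf_scale :: "('a \<Rightarrow> real) \<Rightarrow> ('a, 'e::euclidean_space) vfield \<Rightarrow> ('a, 'e) vfield" where
  "vf_scale h X = (\<lambda>p c. h p *\<^sub>R X p c)"

text \<open>The derivative of a function along a tangent vector; by the transformation rule and the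
  chain rule, it does not depend on the chosen chart.\<close>

definition chart_at :: "('a, 'e) chart set \<Rightarrow> 'a \<Rightarrow> ('a, 'e) chart" where
  "chart_at A p = (SOME c. c \<in> A \<and> p \<in> dom_of c)"

definition tangent_deriv ::
    "('a, 'e::euclidean_space) chart set \<Rightarrow> 'a \<Rightarrow> ('a, 'e) tangent \<Rightarrow> ('a \<Rightarrow> real) \<Rightarrow> real" where
  "tangent_deriv A p v h =
     (let c = chart_at A p in frechet_derivative (h \<circ> param c) (at (coord c p)) (v c))"

definition vf_apply ::
    "('a, 'e::euclidean_space) chart set \<Rightarrow> ('a, 'e) vfield \<Rightarrow> ('a \<Rightarrow> real) \<Rightarrow> 'a \<Rightarrow> real" where
  "vf_apply A X h = (\<lambda>p. tangent_deriv A p (X p) h)"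

definition critical_point ::
    "('a, 'e::euclidean_space) chart set \<Rightarrow> ('a \<Rightarrow> real) \<Rightarrow> 'a \<Rightarrow> bool" where
  "critical_point A f p \<longleftrightarrow> (\<forall>v\<in>tangent_space A p. tangent_deriv A p v f = 0)"

section \<open>Affine connections and Hessians\<close>

text \<open>Only the values on smooth vector fields are meaningful.\<close>

type_synonym ('a, 'e) conn = "('a, 'e) vfield \<Rightarrow> ('a, 'e) vfield \<Rightarrow> ('a, 'e) vfield"

definition affine_connection ::
    "('a, 'e::euclidean_space) chart set \<Rightarrow> ('a, 'e) conn \<Rightarrow> bool" where
  "affine_connection A D \<longleftrightarrow>
     (\<forall>X\<in>vector_fields A. \<forall>Y\<in>vector_fields A. D X Y \<in> vector_fields A) \<and>
     (\<forall>X\<in>vector_fields A. \<forall>X'\<in>vector_fields A. \<forall>Y\<in>vector_fields A.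
        D (vf_add X X') Y = vf_add (D X Y) (D X' Y)) \<and>
     (\<forall>X\<in>vector_fields A. \<forall>Y\<in>vector_fields A. \<forall>h. smooth_fun A h \<longrightarrow>
        D (vf_scale h X) Y = vf_scale h (D X Y)) \<and>
     (\<forall>X\<in>vector_fields A. \<forall>Y\<in>vector_fields A. \<forall>Y'\<in>vector_fields A.
        D X (vf_add Y Y') = vf_add (D X Y) (D X Y')) \<and>
     (\<forall>X\<in>vector_fields A. \<forall>Y\<in>vector_fields A. \<forall>h. smooth_fun A h \<longrightarrow>
        D X (vf_scale h Y) = vf_add (vf_scale (vf_apply A X h) Y) (vf_scale h (D X Y)))"

text \<open>\<open>D X Y - D Y X = [X, Y]\<close>, where the Lie bracket is the vector field acting on smooth
  functions as the commutator of \<open>X\<close> and \<open>Y\<close>.\<close>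

definition torsion_free ::
    "('a, 'e::euclidean_space) chart set \<Rightarrow> ('a, 'e) conn \<Rightarrow> bool" where
  "torsion_free A D \<longleftrightarrow>
     (\<forall>X\<in>vector_fields A. \<forall>Y\<in>vector_fields A. \<forall>h. smooth_fun A h \<longrightarrow>
        (\<forall>p. vf_apply A (D X Y) h p - vf_apply A (D Y X) h p =
             vf_apply A X (vf_apply A Y h) p - vf_apply A Y (vf_apply A X h) p))"

definition hess :: "('a, 'e::euclidean_space) chart set \<Rightarrow> ('a, 'e) conn \<Rightarrow> ('a \<Rightarrow> real) \<Rightarrow>
    ('a, 'e) vfield \<Rightarrow> ('a, 'e) vfield \<Rightarrow> 'a \<Rightarrow> real" where
  "hess A D f X Y p = vf_apply A X (vf_apply A Y f) p - vf_apply A (D X Y) f p"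

text \<open>The Hessian is tensorial and every tangent vector at \<open>p\<close> extends to a smooth vector field,
  so that this is positive semidefiniteness of the form induced on \<open>tangent_space A p\<close>.\<close>

definition hess_psd :: "('a, 'e::euclidean_space) chart set \<Rightarrow> ('a, 'e) conn \<Rightarrow>
    ('a \<Rightarrow> real) \<Rightarrow> 'a \<Rightarrow> bool" where
  "hess_psd A D f p \<longleftrightarrow> (\<forall>X\<in>vector_fields A. 0 \<le> hess A D f X X p)"

section \<open>Riemannian metrics and the Levi-Civita connection\<close>

type_synonym ('a, 'e) metric = "'a \<Rightarrow> ('a, 'e) tangent \<Rightarrow> ('a, 'e) tangent \<Rightarrow> real"

definition riemannian_metric ::
    "('a, 'e::euclidean_space) chart set \<Rightarrow> ('a, 'e) metric \<Rightarrow> bool" where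
  "riemannian_metric A g \<longleftrightarrow>
     (\<forall>p. \<forall>u\<in>tangent_space A p. \<forall>v\<in>tangent_space A p. g p u v = g p v u) \<and>
     (\<forall>p. \<forall>u\<in>tangent_space A p. \<forall>v\<in>tangent_space A p. \<forall>w\<in>tangent_space A p.
        g p (\<lambda>c. u c + v c) w = g p u w + g p v w) \<and>
     (\<forall>p. \<forall>r. \<forall>u\<in>tangent_space A p. \<forall>v\<in>tangent_space A p.
        g p (\<lambda>c. r *\<^sub>R u c) v = r * g p u v) \<and>
     (\<forall>p. \<forall>v\<in>tangent_space A p. v \<noteq> (\<lambda>c. 0) \<longrightarrow> 0 < g p v v) \<and>
     (\<forall>X\<in>vector_fields A. \<forall>Y\<in>vector_fields A. smooth_fun A (\<lambda>p. g p (X p) (Y p)))"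

definition metric_compatible ::
    "('a, 'e::euclidean_space) chart set \<Rightarrow> ('a, 'e) metric \<Rightarrow> ('a, 'e) conn \<Rightarrow> bool" where
  "metric_compatible A g D \<longleftrightarrow>
     (\<forall>X\<in>vector_fields A. \<forall>Y\<in>vector_fields A. \<forall>Z\<in>vector_fields A. \<forall>p.
        vf_apply A X (\<lambda>q. g q (Y q) (Z q)) p = g p (D X Y p) (Z p) + g p (Y p) (D X Z p))"

text \<open>By the fundamental theorem of Riemannian geometry such an operator exists, and it is unique
  on smooth vector fields. \<open>SOME\<close> rather than \<open>THE\<close>, because its values on other arguments are
  unconstrained.\<close>

definition levi_civita ::
    "('a, 'e::euclidean_space) chart set \<Rightarrow> ('a, 'e) metric \<Rightarrow> ('a, 'e) conn" where
  "levi_civita A g =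
     (SOME D. affine_connection A D \<and> torsion_free A D \<and> metric_compatible A g D)"

section \<open>Geodesics and geodesic convexity\<close>

text \<open>
  The Christoffel symbols of \<open>D\<close> in the chart \<open>c\<close> at \<open>p\<close>, as a bilinear map: the \<open>c\<close>-components
  of \<open>D U V\<close> at \<open>p\<close>, where \<open>U\<close> and \<open>V\<close> have constant \<open>c\<close>-components \<open>u\<close> and \<open>v\<close> near \<open>p\<close>.
  Since \<open>D\<close> acts on globally defined fields, \<open>U\<close> and \<open>V\<close> are global extensions of such local
  fields; they exist, and the value does not depend on them, as \<open>D\<close> is a local operator.
\<close>

definition extends_const :: "('a::topological_space, 'e::euclidean_space) chart set \<Rightarrow>
    ('a, 'e) chart \<Rightarrow> 'a \<Rightarrow> 'e \<Rightarrow> ('a, 'e) vfield \<Rightarrow> bool" where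
  "extends_const A c p u U \<longleftrightarrow> U \<in> vector_fields A \<and> (\<forall>\<^sub>F q in nhds p. U q c = u)"

definition christoffel :: "('a::topological_space, 'e::euclidean_space) chart set \<Rightarrow>
    ('a, 'e) conn \<Rightarrow> ('a, 'e) chart \<Rightarrow> 'a \<Rightarrow> 'e \<Rightarrow> 'e \<Rightarrow> 'e" where
  "christoffel A D c p u v =
     D (SOME U. extends_const A c p u U) (SOME V. extends_const A c p v V) p c"

text \<open>
  Geodesics \<open>[0,1] \<rightarrow> M\<close>: the equation \<open>x'' + \<Gamma>(x', x') = 0\<close> in every chart, with one-sided
  derivatives at the end points. Twice differentiable solutions are automatically smooth.
\<close>

definition geodesic :: "('a::topological_space, 'e::euclidean_space) chart set \<Rightarrow>
    ('a, 'e) conn \<Rightarrow> (real \<Rightarrow> 'a) \<Rightarrow> bool" where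
  "geodesic A D \<gamma> \<longleftrightarrow> continuous_on {0..1} \<gamma> \<and>
     (\<forall>c\<in>A. \<exists>x' x''. \<forall>t\<in>{0..1}. \<gamma> t \<in> dom_of c \<longrightarrow>
        ((\<lambda>s. coord c (\<gamma> s)) has_vector_derivative x' t) (at t within {0..1}) \<and>
        (x' has_vector_derivative x'' t) (at t within {0..1}) \<and>
        x'' t + christoffel A D c (\<gamma> t) (x' t) (x' t) = 0)"

definition g_convex :: "('a::topological_space, 'e::euclidean_space) chart set \<Rightarrow>
    ('a, 'e) conn \<Rightarrow> ('a \<Rightarrow> real) \<Rightarrow> bool" where
  "g_convex A D f \<longleftrightarrow> (\<forall>\<gamma>. geodesic A D \<gamma> \<longrightarrow> convex_on {0..1} (f \<circ> \<gamma>))"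

end

theory Submission
  imports Defs
begin

text \<open>
  Perturb the Levi-Civita connection to \<open>D X Y - l g(X, Y) grad f\<close>. As \<open>g\<close> is symmetric this is again
  torsion-free, and its Hessian of \<open>f\<close> is the Riemannian one plus \<open>l g(X, Y) |grad f|^2\<close>. Near
  a critical point \<open>l = 0\<close> makes it positive semidefinite, near any other point a large constant
  \<open>l\<close> does, by compactness of the unit sphere. Semidefiniteness is a convex condition on \<open>l\<close>, so these local
  choices are glued by a partition of unity. Along a geodesic \<open>c\<close> the second derivative of
  \<open>f o c\<close> is the Hessian at \<open>(c', c')\<close>.
\<close>

section \<open>Calculus of smooth maps\<close>

text \<open>At a critical point the correction l g |grad f|^2 vanishes, so no l repairs an
  indefinite Hessian there, and the constant required nearby could grow without bound.
  Semidefiniteness on a whole neighbourhood permits l = 0 on it and leaves only points of positive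
  gradient norm to treat. Two encodings shape the rest. \<open>levi_civita\<close> is a choice among
  metric torsion-free connections, so its Hessian has no usable formula until Koszul's formula in
  charts yields one such connection and uniqueness identifies the choice with it. Connections act on
  global vector fields only, so coordinate fields and coordinate functions enter through cutoffs,
  and tensoriality has to be read off in charts: the Hessian becomes a quadratic form in the value
  of the field at a point once the derivatives of the field cancel. Compactness of the sphere acts
  on that form, whereas the gluing works with one scalar inequality per field.\<close>

lemma differentiable_has_frechet:
  "f differentiable (at x) \<Longrightarrow> (f has_derivative frechet_derivative f (at x)) (at x)"
  by (simp add: frechet_derivative_works)

text \<open>\<open>Ck_on\<close> only sees derivatives in fixed directions; when a linear map is
  applied to a varying vector, this expansion reduces it to fixed ones.\<close>

lemma linear_euclidean_expand:
  fixes L :: "'d::euclidean_space \<Rightarrow> 'f::real_vector"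
  assumes "linear L"
  shows "L u = (\<Sum>b\<in>Basis. (u \<bullet> b) *\<^sub>R L b)"
proof -
  have "L (\<Sum>b\<in>Basis. (u \<bullet> b) *\<^sub>R b) = (\<Sum>b\<in>Basis. (u \<bullet> b) *\<^sub>R L b)"
    by (simp add: linear_sum[OF assms] linear_scale[OF assms])
  then show ?thesis by (simp add: euclidean_representation)
qed

lemma Ck_on_Suc_imp: "Ck_on (Suc k) S f \<Longrightarrow> Ck_on k S f"
proof (induction k arbitrary: f)
  case 0
  then show ?case
    by (auto intro!: continuous_at_imp_continuous_on differentiable_imp_continuous_within)
next
  case (Suc k)
  show ?case
    unfolding Ck_on.simps(2)
  proof (intro conjI allI)
    show "\<forall>x\<in>S. f differentiable at x" using Suc.prems by simp
    fix v
    have "Ck_on (Suc k) S (\<lambda>x. frechet_derivative f (at x) v)"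
      using Suc.prems unfolding Ck_on.simps(2)[of "Suc k"] by blast
    then show "Ck_on k S (\<lambda>x. frechet_derivative f (at x) v)" by (rule Suc.IH)
  qed
qed

lemma Ck_on_subset: "Ck_on k S f \<Longrightarrow> T \<subseteq> S \<Longrightarrow> Ck_on k T f"
  by (induction k arbitrary: f) (auto intro: continuous_on_subset)

lemma Ck_on_cong:
  assumes "open S" "\<And>x. x \<in> S \<Longrightarrow> f x = g x" "Ck_on k S f"
  shows "Ck_on k S g"
  using assms(2,3)
proof (induction k arbitrary: f g)
  case 0
  then show ?case by (simp cong: continuous_on_cong)
next
  case (Suc k)
  have d: "f differentiable at x" if "x \<in> S" for x using Suc.prems that by simp
  have "g differentiable at x" if "x \<in> S" for x
    using d[OF that] Suc.prems(1) assms(1) that has_derivative_transform_within_open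
    unfolding differentiable_def by blast
  moreover have "Ck_on k S (\<lambda>x. frechet_derivative g (at x) v)" for v
  proof (rule Suc.IH)
    show "Ck_on k S (\<lambda>x. frechet_derivative f (at x) v)" using Suc.prems by simp
    show "frechet_derivative f (at x) v = frechet_derivative g (at x) v" if "x \<in> S" for x
      using frechet_derivative_transform_within_open[OF d[OF that] assms(1) that] Suc.prems(1)
      by simp
  qed
  ultimately show ?case by simp
qed

lemma Ck_on_local:
  assumes "\<And>x. x \<in> S \<Longrightarrow> \<exists>T. open T \<and> x \<in> T \<and> Ck_on k T f"
  shows "Ck_on k S f"
  using assms
proof (induction k arbitrary: f)
  case 0
  show ?case
    unfolding Ck_on.simps
    by (rule continuous_at_imp_continuous_on)
       (metis 0 Ck_on.simps(1) continuous_on_eq_continuous_at)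
next
  case (Suc k)
  then show ?case by (fastforce simp del: split_paired_All)
qed

text \<open>Lets the inductions below use derivatives given by a formula; since these agree with
  \<open>frechet_derivative\<close> on an open set, so do all higher derivatives.\<close>

lemma Ck_on_SucI:
  assumes "open S" "\<And>x. x \<in> S \<Longrightarrow> (f has_derivative f' x) (at x)"
    and "\<And>v. Ck_on k S (\<lambda>x. f' x v)"
  shows "Ck_on (Suc k) S f"
  unfolding Ck_on.simps
proof (intro conjI ballI allI)
  show "f differentiable at x" if "x \<in> S" for x
    using assms(2)[OF that] by (auto simp: differentiable_def)
  show "Ck_on k S (\<lambda>x. frechet_derivative f (at x) v)" for v
    by (rule Ck_on_cong[OF assms(1) _ assms(3)[of v]])
       (use assms(2) frechet_derivative_at in fastforce)
qed

lemma Ck_on_SucD: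
  assumes "Ck_on (Suc k) S f"
  shows "x \<in> S \<Longrightarrow> (f has_derivative frechet_derivative f (at x)) (at x)"
    and "Ck_on k S (\<lambda>x. frechet_derivative f (at x) v)"
  using assms by (auto intro: differentiable_has_frechet)

lemma Ck_on_const: "open S \<Longrightarrow> Ck_on k S (\<lambda>x. c)"
proof (induction k arbitrary: c)
  case (Suc k)
  then show ?case by (intro Ck_on_SucI[where f' = "\<lambda>x v. 0"]) (auto)
qed simp

lemma Ck_on_ident: "open S \<Longrightarrow> Ck_on k S (\<lambda>x. x)"
proof (cases k)
  case (Suc j)
  assume "open S" then show ?thesis
    unfolding Suc by (intro Ck_on_SucI[where f' = "\<lambda>x v. v"]) (auto intro: Ck_on_const)
qed (simp add: continuous_on_id)

lemma Ck_on_bounded_linear: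
  assumes "open S" "bounded_linear F" "Ck_on k S f"
  shows "Ck_on k S (\<lambda>x. F (f x))"
  using assms(3)
proof (induction k arbitrary: f)
  case 0
  then show ?case using assms(2) by (simp add: bounded_linear.continuous_on)
next
  case (Suc k)
  show ?case
    by (rule Ck_on_SucI[OF assms(1), where f' = "\<lambda>x v. F (frechet_derivative f (at x) v)"])
       (use Suc.prems in \<open>auto intro!: Suc.IH bounded_linear.has_derivative[OF assms(2)]
          intro: Ck_on_SucD\<close>)
qed

lemma Ck_on_add:
  assumes "open S" "Ck_on k S f" "Ck_on k S g"
  shows "Ck_on k S (\<lambda>x. f x + g x)"
  using assms(2,3)
proof (induction k arbitrary: f g)
  case 0
  then show ?case by (simp add: continuous_on_add)
next
  case (Suc k)
  show ?case
    by (rule Ck_on_SucI[OF assms(1), where f' =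
          "\<lambda>x v. frechet_derivative f (at x) v + frechet_derivative g (at x) v"])
       (use Suc.prems in \<open>auto intro!: Suc.IH has_derivative_add intro: Ck_on_SucD\<close>)
qed

lemma Ck_on_sum:
  assumes "open S" "\<And>i. i \<in> I \<Longrightarrow> Ck_on k S (f i)"
  shows "Ck_on k S (\<lambda>x. \<Sum>i\<in>I. f i x)"
  using assms(2)
  by (induction I rule: infinite_finite_induct) (auto intro: Ck_on_add Ck_on_const assms(1))

text \<open>In the product rule one factor stays undifferentiated; \<open>Ck_on_Suc_imp\<close>
  lowers its order so that the induction hypothesis applies to both terms.\<close>

lemma Ck_on_bilinear:
  assumes "open S" "bounded_bilinear B" "Ck_on k S f" "Ck_on k S g"
  shows "Ck_on k S (\<lambda>x. B (f x) (g x))"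
  using assms(3,4)
proof (induction k arbitrary: f g)
  case 0
  then show ?case using assms(2) by (simp add: bounded_bilinear.continuous_on)
next
  case (Suc k)
  show ?case
  proof (rule Ck_on_SucI[OF assms(1), where f' =
        "\<lambda>x v. B (f x) (frechet_derivative g (at x) v) + B (frechet_derivative f (at x) v) (g x)"])
    show "((\<lambda>x. B (f x) (g x)) has_derivative
        (\<lambda>v. B (f x) (frechet_derivative g (at x) v) + B (frechet_derivative f (at x) v) (g x))) (at x)"
      if "x \<in> S" for x
      using Suc.prems that
      by (intro bounded_bilinear.FDERIV[OF assms(2)]) (auto intro: Ck_on_SucD)
    fix v
    show "Ck_on k S (\<lambda>x. B (f x) (frechet_derivative g (at x) v)
        + B (frechet_derivative f (at x) v) (g x))"
      by (rule Ck_on_add[OF assms(1) Suc.IH[OF Ck_on_Suc_imp[OF Suc.prems(1)] Ck_on_SucD(2)[OF Suc.prems(2)]]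
            Suc.IH[OF Ck_on_SucD(2)[OF Suc.prems(1)] Ck_on_Suc_imp[OF Suc.prems(2)]]])
  qed
qed

lemmas Ck_on_scaleR = Ck_on_bilinear[OF _ bounded_bilinear_scaleR]
lemmas Ck_on_mult = Ck_on_bilinear[OF _ bounded_bilinear_mult]

lemma Ck_on_compose:
  fixes f :: "'d::euclidean_space \<Rightarrow> 'f::real_normed_vector" and h :: "'e::euclidean_space \<Rightarrow> 'd"
  assumes "open S" "open T" "h ` S \<subseteq> T" "Ck_on k T f" "Ck_on k S h"
  shows "Ck_on k S (\<lambda>x. f (h x))"
  using assms(4,5)
proof (induction k arbitrary: f)
  case 0
  then show ?case
    unfolding Ck_on.simps by (rule continuous_on_compose2[OF _ _ assms(3)])
next
  case (Suc k)
  have hS: "h x \<in> T" if "x \<in> S" for x using that assms(3) by auto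
  show ?case
  proof (rule Ck_on_SucI[OF assms(1), where f' =
        "\<lambda>x v. frechet_derivative f (at (h x)) (frechet_derivative h (at x) v)"])
    show "((\<lambda>x. f (h x)) has_derivative
        (\<lambda>v. frechet_derivative f (at (h x)) (frechet_derivative h (at x) v))) (at x)"
      if "x \<in> S" for x
      by (rule has_derivative_compose[OF Ck_on_SucD(1)[OF Suc.prems(2) that]
            Ck_on_SucD(1)[OF Suc.prems(1) hS[OF that]]])
    fix v
    have lin: "linear (frechet_derivative f (at (h x)))" if "x \<in> S" for x
      using Suc.prems(1) hS[OF that] by (simp add: linear_frechet_derivative)
    \<comment> \<open>The chain rule applies the derivative of f at h x to a vector that itself
      depends on x. After expansion only the fixed directions b remain, and the induction hypothesis
      covers these.\<close>
    have "Ck_on k S (\<lambda>x. \<Sum>b\<in>Basis. (frechet_derivative h (at x) v \<bullet> b) *\<^sub>R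
        frechet_derivative f (at (h x)) b)"
    proof (intro Ck_on_sum Ck_on_scaleR assms(1))
      fix b :: 'd
      show "Ck_on k S (\<lambda>x. frechet_derivative h (at x) v \<bullet> b)"
        by (rule Ck_on_bounded_linear[OF assms(1) bounded_linear_inner_left
              Ck_on_SucD(2)[OF Suc.prems(2)]])
      show "Ck_on k S (\<lambda>x. frechet_derivative f (at (h x)) b)"
        by (rule Suc.IH[OF Ck_on_SucD(2)[OF Suc.prems(1)] Ck_on_Suc_imp[OF Suc.prems(2)]])
    qed
    then show "Ck_on k S (\<lambda>x. frechet_derivative f (at (h x)) (frechet_derivative h (at x) v))"
      by (rule Ck_on_cong[OF assms(1), rotated])
         (simp add: linear_euclidean_expand[OF lin, symmetric])
  qed
qed

text \<open>The derivative of 1/f is built from 1/f and the derivative of f, so order k of 1/f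
  bootstraps to order k + 1.\<close>

lemma Ck_on_inverse:
  fixes f :: "'e::euclidean_space \<Rightarrow> real"
  assumes "open S" "\<And>x. x \<in> S \<Longrightarrow> f x \<noteq> 0" "Ck_on k S f"
  shows "Ck_on k S (\<lambda>x. inverse (f x))"
  using assms(3)
proof (induction k)
  case 0
  then show ?case using assms(2) by (simp add: continuous_on_inverse)
next
  case (Suc k)
  have IH: "Ck_on k S (\<lambda>x. inverse (f x))" by (rule Suc.IH[OF Ck_on_Suc_imp[OF Suc.prems]])
  show ?case
  proof (rule Ck_on_SucI[OF assms(1), where f' =
        "\<lambda>x v. (- 1) * (inverse (f x) * frechet_derivative f (at x) v * inverse (f x))"])
    show "((\<lambda>x. inverse (f x)) has_derivative
        (\<lambda>v. (- 1) * (inverse (f x) * frechet_derivative f (at x) v * inverse (f x)))) (at x)"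
      if "x \<in> S" for x
      using Deriv.has_derivative_inverse[OF assms(2)[OF that] Ck_on_SucD(1)[OF Suc.prems that]] by simp
    show "Ck_on k S (\<lambda>x. (- 1) * (inverse (f x) * frechet_derivative f (at x) v * inverse (f x)))" for v
      by (intro Ck_on_mult Ck_on_const assms(1) IH Ck_on_SucD(2)[OF Suc.prems])
  qed
qed

lemma smooth_onD:
  assumes "smooth_on S f"
  shows "x \<in> S \<Longrightarrow> f differentiable at x"
    and "x \<in> S \<Longrightarrow> (f has_derivative frechet_derivative f (at x)) (at x)"
    and "x \<in> S \<Longrightarrow> linear (frechet_derivative f (at x))"
    and "smooth_on S (\<lambda>x. frechet_derivative f (at x) v)"
    and "continuous_on S f"
proof -
  have c: "Ck_on k S f" for k using assms by (simp add: smooth_on_def)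
  show d: "x \<in> S \<Longrightarrow> f differentiable at x" using c[of "Suc 0"] by simp
  show "x \<in> S \<Longrightarrow> (f has_derivative frechet_derivative f (at x)) (at x)"
    using d by (rule differentiable_has_frechet)
  show "x \<in> S \<Longrightarrow> linear (frechet_derivative f (at x))" using d by (rule linear_frechet_derivative)
  show "smooth_on S (\<lambda>x. frechet_derivative f (at x) v)"
    unfolding smooth_on_def using c Ck_on_SucD(2) by blast
  show "continuous_on S f" using c[of 0] by simp
qed

lemma smooth_on_subset: "smooth_on S f \<Longrightarrow> T \<subseteq> S \<Longrightarrow> smooth_on T f"
  unfolding smooth_on_def by (blast intro: Ck_on_subset)

lemma smooth_on_cong:
  "smooth_on S f \<Longrightarrow> open S \<Longrightarrow> (\<And>x. x \<in> S \<Longrightarrow> f x = g x) \<Longrightarrow> smooth_on S g"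
  using Ck_on_cong unfolding smooth_on_def by blast

lemma smooth_on_local:
  "(\<And>x. x \<in> S \<Longrightarrow> \<exists>T. open T \<and> x \<in> T \<and> smooth_on T f) \<Longrightarrow> smooth_on S f"
  unfolding smooth_on_def by (intro allI Ck_on_local) blast

lemma smooth_on_const: "open S \<Longrightarrow> smooth_on S (\<lambda>x. c)"
  by (simp add: smooth_on_def Ck_on_const)

lemma smooth_on_ident: "open S \<Longrightarrow> smooth_on S (\<lambda>x. x)"
  by (simp add: smooth_on_def Ck_on_ident)

lemma smooth_on_bounded_linear:
  "bounded_linear F \<Longrightarrow> open S \<Longrightarrow> smooth_on S f \<Longrightarrow> smooth_on S (\<lambda>x. F (f x))"
  by (simp add: smooth_on_def Ck_on_bounded_linear)

lemma smooth_on_add: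
  "open S \<Longrightarrow> smooth_on S f \<Longrightarrow> smooth_on S g \<Longrightarrow> smooth_on S (\<lambda>x. f x + g x)"
  by (simp add: smooth_on_def Ck_on_add)

lemma smooth_on_sum:
  "open S \<Longrightarrow> (\<And>i. i \<in> I \<Longrightarrow> smooth_on S (f i)) \<Longrightarrow> smooth_on S (\<lambda>x. \<Sum>i\<in>I. f i x)"
  by (simp add: smooth_on_def Ck_on_sum)

lemma smooth_on_bilinear:
  "bounded_bilinear B \<Longrightarrow> open S \<Longrightarrow> smooth_on S f \<Longrightarrow> smooth_on S g
    \<Longrightarrow> smooth_on S (\<lambda>x. B (f x) (g x))"
  by (simp add: smooth_on_def Ck_on_bilinear)

lemmas smooth_on_scaleR = smooth_on_bilinear[OF bounded_bilinear_scaleR]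
lemmas smooth_on_mult = smooth_on_bilinear[OF bounded_bilinear_mult]
lemmas smooth_on_inner = smooth_on_bilinear[OF bounded_bilinear_inner]

lemma smooth_on_uminus: "open S \<Longrightarrow> smooth_on S f \<Longrightarrow> smooth_on S (\<lambda>x. - f x)"
  using smooth_on_bounded_linear[OF bounded_linear_minus[OF bounded_linear_ident]] by blast

lemma smooth_on_diff:
  "open S \<Longrightarrow> smooth_on S f \<Longrightarrow> smooth_on S g \<Longrightarrow> smooth_on S (\<lambda>x. f x - g x)"
  using smooth_on_add[of S f "\<lambda>x. - g x"] smooth_on_uminus[of S g] by simp

lemma smooth_on_compose:
  fixes f :: "'d::euclidean_space \<Rightarrow> 'f::real_normed_vector" and h :: "'e::euclidean_space \<Rightarrow> 'd"
  shows "open S \<Longrightarrow> open T \<Longrightarrow> h ` S \<subseteq> T \<Longrightarrow> smooth_on T f \<Longrightarrow> smooth_on S h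
    \<Longrightarrow> smooth_on S (\<lambda>x. f (h x))"
  by (simp add: smooth_on_def Ck_on_compose[of S T])

lemma smooth_on_inverse:
  fixes f :: "'e::euclidean_space \<Rightarrow> real"
  shows "open S \<Longrightarrow> smooth_on S f \<Longrightarrow> (\<And>x. x \<in> S \<Longrightarrow> f x \<noteq> 0)
    \<Longrightarrow> smooth_on S (\<lambda>x. inverse (f x))"
  by (simp add: smooth_on_def Ck_on_inverse)

text \<open>Used for every tensor evaluated on fields: smoothness for constant arguments suffices,
  because the value is a finite sum of these with smooth coefficients.\<close>

lemma smooth_on_linear_family:
  fixes B :: "'e::euclidean_space \<Rightarrow> 'd::euclidean_space \<Rightarrow> 'f::real_normed_vector"
  assumes "open S" "\<And>x. x \<in> S \<Longrightarrow> linear (B x)" "\<And>u. smooth_on S (\<lambda>x. B x u)" "smooth_on S Y"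
  shows "smooth_on S (\<lambda>x. B x (Y x))"
proof (rule smooth_on_cong[OF _ assms(1)])
  show "smooth_on S (\<lambda>x. \<Sum>b\<in>Basis. (Y x \<bullet> b) *\<^sub>R B x b)"
    by (intro smooth_on_sum smooth_on_scaleR smooth_on_inner smooth_on_const assms)
qed (simp add: linear_euclidean_expand[OF assms(2), symmetric])

text \<open>The product rule for evaluation, obtained from the basis expansion so that B never has
  to be differentiated as an operator-valued map.\<close>

lemma has_derivative_linear_family:
  fixes B :: "'e::euclidean_space \<Rightarrow> 'd::euclidean_space \<Rightarrow> 'f::real_normed_vector"
  assumes S: "open S" "x0 \<in> S" and lin: "\<And>x. x \<in> S \<Longrightarrow> linear (B x)"
    and B: "\<And>u. (\<lambda>x. B x u) differentiable (at x0)" and Y: "(Y has_derivative Y') (at x0)"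
  shows "((\<lambda>x. B x (Y x)) has_derivative
    (\<lambda>w. frechet_derivative (\<lambda>x. B x (Y x0)) (at x0) w + B x0 (Y' w))) (at x0)"
proof -
  let ?D = "\<lambda>u. frechet_derivative (\<lambda>x. B x u) (at x0)"
  have D: "((\<lambda>x. B x u) has_derivative ?D u) (at x0)" for u
    by (rule differentiable_has_frechet[OF B])
  \<comment> \<open>The derivative in x inherits linearity in u from B; this recombines the basis
    terms at the end.\<close>
  have *: "((\<lambda>x. B x u) has_derivative (\<lambda>w. \<Sum>b\<in>Basis. (u \<bullet> b) *\<^sub>R ?D b w)) (at x0)" for u
    by (rule has_derivative_transform_within_open[where f = "\<lambda>x. \<Sum>b\<in>Basis. (u \<bullet> b) *\<^sub>R B x b", OF _ S])
       (auto intro!: derivative_eq_intros D simp: linear_euclidean_expand[OF lin, symmetric])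
  have exp: "?D u = (\<lambda>w. \<Sum>b\<in>Basis. (u \<bullet> b) *\<^sub>R ?D b w)" for u
    using frechet_derivative_at[OF *] by simp
  have "((\<lambda>x. \<Sum>b\<in>Basis. (Y x \<bullet> b) *\<^sub>R B x b) has_derivative
      (\<lambda>w. \<Sum>b\<in>Basis. (Y x0 \<bullet> b) *\<^sub>R ?D b w + (Y' w \<bullet> b) *\<^sub>R B x0 b)) (at x0)"
    by (intro has_derivative_sum has_derivative_scaleR has_derivative_inner_left D Y)
  moreover have "(\<lambda>w. \<Sum>b\<in>Basis. (Y x0 \<bullet> b) *\<^sub>R ?D b w + (Y' w \<bullet> b) *\<^sub>R B x0 b)
      = (\<lambda>w. ?D (Y x0) w + B x0 (Y' w))"
    by (subst (2) exp, rule ext, subst (2) linear_euclidean_expand[OF lin[OF S(2)]])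
       (simp add: sum.distrib)
  ultimately have "((\<lambda>x. \<Sum>b\<in>Basis. (Y x \<bullet> b) *\<^sub>R B x b) has_derivative
      (\<lambda>w. ?D (Y x0) w + B x0 (Y' w))) (at x0)"
    by simp
  then show ?thesis
    by (rule has_derivative_transform_within_open[OF _ S])
       (simp add: linear_euclidean_expand[OF lin, symmetric])
qed

subsection \<open>Symmetry of second derivatives\<close>

text \<open>Two applications of the mean value theorem: in direction u to the difference of H
  between x + t v and x, then in direction v to the derivative of H along u.\<close>

lemma second_difference_mean_value:
  fixes H :: "'e::euclidean_space \<Rightarrow> real"
  assumes "open S" "smooth_on S H" "0 < t"
    and sub: "\<And>a b. \<lbrakk>a \<in> {0..t}; b \<in> {0..t}\<rbrakk> \<Longrightarrow> x + a *\<^sub>R u + b *\<^sub>R v \<in> S"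
  shows "\<exists>a\<in>{0..t}. \<exists>b\<in>{0..t}.
    H (x + t *\<^sub>R u + t *\<^sub>R v) - H (x + t *\<^sub>R u) - H (x + t *\<^sub>R v) + H x =
    t * (t * frechet_derivative (\<lambda>y. frechet_derivative H (at y) u) (at (x + a *\<^sub>R u + b *\<^sub>R v)) v)"
proof -
  let ?D = "\<lambda>y. frechet_derivative H (at y)"
  have H: "((\<lambda>s. H (c + s *\<^sub>R u)) has_derivative (\<lambda>h. h * ?D (c + s *\<^sub>R u) u)) (at s)"
    if "c + s *\<^sub>R u \<in> S" for s c
  proof -
    have "((\<lambda>s. c + s *\<^sub>R u) has_derivative (\<lambda>h. h *\<^sub>R u)) (at s)"
      by (auto intro!: derivative_eq_intros)
    from has_derivative_compose[OF this smooth_onD(2)[OF assms(2) that]]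
    show ?thesis using linear_scale[OF smooth_onD(3)[OF assms(2) that]] by simp
  qed
  let ?\<phi> = "\<lambda>s. H ((x + t *\<^sub>R v) + s *\<^sub>R u) - H (x + s *\<^sub>R u)"
  have "\<exists>a\<in>{0<..<t}. ?\<phi> t - ?\<phi> 0 = (t - 0) * ?D ((x + t *\<^sub>R v) + a *\<^sub>R u) u - (t - 0) * ?D (x + a *\<^sub>R u) u"
  proof (rule mvt_simple[OF assms(3)])
    fix a assume "0 \<le> a" "a \<le> t"
    then have *: "(x + t *\<^sub>R v) + a *\<^sub>R u \<in> S" "x + a *\<^sub>R u \<in> S"
      using sub[of a t] sub[of a 0] assms(3) by (auto simp: algebra_simps)
    show "(?\<phi> has_derivative (\<lambda>h. h * ?D ((x + t *\<^sub>R v) + a *\<^sub>R u) u - h * ?D (x + a *\<^sub>R u) u))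
        (at a within {0..t})"
      by (rule has_derivative_at_withinI[OF has_derivative_diff[OF H[OF *(1)] H[OF *(2)]]])
  qed
  then obtain a where a: "a \<in> {0<..<t}"
    "?\<phi> t - ?\<phi> 0 = t * (?D (x + a *\<^sub>R u + t *\<^sub>R v) u - ?D (x + a *\<^sub>R u) u)"
    by (auto simp: algebra_simps)
  let ?\<psi> = "\<lambda>s. ?D (x + a *\<^sub>R u + s *\<^sub>R v) u"
  let ?E = "\<lambda>y. frechet_derivative (\<lambda>y. ?D y u) (at y) v"
  have "\<exists>b\<in>{0<..<t}. ?\<psi> t - ?\<psi> 0 = (t - 0) * ?E (x + a *\<^sub>R u + b *\<^sub>R v)"
  proof (rule mvt_simple[OF assms(3)])
    fix b assume "0 \<le> b" "b \<le> t"
    then have S: "x + a *\<^sub>R u + b *\<^sub>R v \<in> S" using sub[of a b] a(1) by auto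
    have "((\<lambda>s. x + a *\<^sub>R u + s *\<^sub>R v) has_derivative (\<lambda>h. h *\<^sub>R v)) (at b)"
      by (auto intro!: derivative_eq_intros)
    from has_derivative_compose[OF this smooth_onD(2)[OF smooth_onD(4)[OF assms(2), of u] S]]
    show "(?\<psi> has_derivative (\<lambda>h. h * ?E (x + a *\<^sub>R u + b *\<^sub>R v))) (at b within {0..t})"
      using linear_scale[OF smooth_onD(3)[OF smooth_onD(4)[OF assms(2), of u] S]]
      by (auto intro: has_derivative_at_withinI)
  qed
  then obtain b where b: "b \<in> {0<..<t}" "?\<psi> t - ?\<psi> 0 = t * ?E (x + a *\<^sub>R u + b *\<^sub>R v)" by auto
  have "H (x + t *\<^sub>R u + t *\<^sub>R v) - H (x + t *\<^sub>R u) - H (x + t *\<^sub>R v) + H x = ?\<phi> t - ?\<phi> 0"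
    by (simp add: algebra_simps)
  also have "\<dots> = t * (t * ?E (x + a *\<^sub>R u + b *\<^sub>R v))" using a(2) b(2) by simp
  finally show ?thesis using a(1) b(1)
    by (intro bexI[where x = a] bexI[where x = b]) auto
qed

text \<open>The second difference is symmetric in u and v. It therefore equates the two mixed
  derivatives at two points near x, and continuity moves both points to x.\<close>

lemma second_derivative_symmetric_real:
  fixes H :: "'e::euclidean_space \<Rightarrow> real"
  assumes "open S" "smooth_on S H" "x \<in> S"
  shows "frechet_derivative (\<lambda>y. frechet_derivative H (at y) u) (at x) v =
    frechet_derivative (\<lambda>y. frechet_derivative H (at y) v) (at x) u"
proof -
  let ?E = "\<lambda>u v y. frechet_derivative (\<lambda>y. frechet_derivative H (at y) u) (at y) v"
  have cont: "isCont (?E u v) x" for u v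
    using smooth_onD(5)[OF smooth_onD(4)[OF smooth_onD(4)[OF assms(2)]]] assms(1,3)
    by (simp add: continuous_on_eq_continuous_at)
  have "\<bar>?E u v x - ?E v u x\<bar> \<le> 0 + e" if "e > 0" for e
  proof -
    have eps: "\<exists>d>0. \<forall>y. dist y x < d \<longrightarrow> dist (?E u v y) (?E u v x) < e/2" for u v
      using cont[of u v] \<open>e > 0\<close> unfolding continuous_at_eps_delta by (meson half_gt_zero)
    obtain d1 where d1: "d1 > 0" "\<And>y. dist y x < d1 \<Longrightarrow> dist (?E u v y) (?E u v x) < e/2"
      using eps[of u v] by blast
    obtain d2 where d2: "d2 > 0" "\<And>y. dist y x < d2 \<Longrightarrow> dist (?E v u y) (?E v u x) < e/2"
      using eps[of v u] by blast
    obtain d3 where d3: "d3 > 0" "ball x d3 \<subseteq> S" using assms(1,3) openE by blast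
    define d where "d = min d1 (min d2 d3)"
    \<comment> \<open>Keeps all points of both parallelograms within d of x; the summand 1 keeps the
      denominator positive when u = v = 0.\<close>
    define t where "t = d / (2 * (norm u + norm v + 1))"
    have "d > 0" using d1 d2 d3 by (simp add: d_def)
    have N: "norm u + norm v + 1 > 0" using norm_ge_zero[of u] norm_ge_zero[of v] by linarith
    have t: "t > 0" unfolding t_def using \<open>d > 0\<close> N by (intro divide_pos_pos mult_pos_pos) auto
    have "t * (norm u + norm v + 1) = d / 2"
      using N unfolding t_def by (metis less_irrefl mult.commute nonzero_divide_eq_eq divide_divide_eq_left)
    then have "t * norm u + t * norm v + t = d / 2" by (simp add: distrib_left)
    then have tn: "t * norm u + t * norm v < d" using t \<open>d > 0\<close> by linarith
    have close: "dist (x + a *\<^sub>R u + b *\<^sub>R v) x < d" "dist (x + a *\<^sub>R v + b *\<^sub>R u) x < d"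
      if "a \<in> {0..t}" "b \<in> {0..t}" for a b
    proof -
      have *: "norm (a *\<^sub>R u + b *\<^sub>R v) < d" if "a \<in> {0..t}" "b \<in> {0..t}" for a b
      proof -
        have "norm (a *\<^sub>R u + b *\<^sub>R v) \<le> a * norm u + b * norm v"
          using norm_triangle_ineq[of "a *\<^sub>R u" "b *\<^sub>R v"] that by simp
        also have "\<dots> \<le> t * norm u + t * norm v"
          using that by (intro add_mono mult_right_mono) auto
        finally show ?thesis using tn by simp
      qed
      show "dist (x + a *\<^sub>R u + b *\<^sub>R v) x < d" using *[OF that] by (simp add: dist_norm add.assoc)
      show "dist (x + a *\<^sub>R v + b *\<^sub>R u) x < d"
        using *[OF that(2,1)] by (simp add: dist_norm add.assoc add.commute)
    qed
    have S: "x + a *\<^sub>R u + b *\<^sub>R v \<in> S" "x + a *\<^sub>R v + b *\<^sub>R u \<in> S"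
      if "a \<in> {0..t}" "b \<in> {0..t}" for a b
      using close[OF that] d3(2) by (auto simp: d_def dist_commute subset_iff)
    obtain a b where ab: "a \<in> {0..t}" "b \<in> {0..t}"
      "H (x + t *\<^sub>R u + t *\<^sub>R v) - H (x + t *\<^sub>R u) - H (x + t *\<^sub>R v) + H x =
        t * (t * ?E u v (x + a *\<^sub>R u + b *\<^sub>R v))"
      using second_difference_mean_value[OF assms(1,2) t S(1)] by blast
    obtain a' b' where ab': "a' \<in> {0..t}" "b' \<in> {0..t}"
      "H (x + t *\<^sub>R v + t *\<^sub>R u) - H (x + t *\<^sub>R v) - H (x + t *\<^sub>R u) + H x =
        t * (t * ?E v u (x + a' *\<^sub>R v + b' *\<^sub>R u))"
      using second_difference_mean_value[OF assms(1,2) t S(2)] by blast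
    have "t * (t * ?E u v (x + a *\<^sub>R u + b *\<^sub>R v)) = t * (t * ?E v u (x + a' *\<^sub>R v + b' *\<^sub>R u))"
      unfolding ab(3)[symmetric] ab'(3)[symmetric] by (simp add: algebra_simps)
    then have "?E u v (x + a *\<^sub>R u + b *\<^sub>R v) = ?E v u (x + a' *\<^sub>R v + b' *\<^sub>R u)" using t by simp
    moreover have "dist (?E u v (x + a *\<^sub>R u + b *\<^sub>R v)) (?E u v x) < e/2"
      using d1(2) close(1)[OF ab(1,2)] by (simp add: d_def)
    moreover have "dist (?E v u (x + a' *\<^sub>R v + b' *\<^sub>R u)) (?E v u x) < e/2"
      using d2(2) close(2)[OF ab'(1,2)] by (simp add: d_def)
    ultimately show ?thesis unfolding dist_real_def by linarith
  qed
  then have "\<bar>?E u v x - ?E v u x\<bar> \<le> 0" by (rule field_le_epsilon)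
  then show ?thesis by simp
qed

lemma frechet_derivative_inner_left:
  assumes "f differentiable at x"
  shows "frechet_derivative (\<lambda>y. f y \<bullet> b) (at x) v = frechet_derivative f (at x) v \<bullet> b"
  using frechet_derivative_at[OF has_derivative_inner_left[OF differentiable_has_frechet[OF assms]]]
  by metis

lemma second_derivative_symmetric:
  fixes H :: "'e::euclidean_space \<Rightarrow> 'd::euclidean_space"
  assumes "open S" "smooth_on S H" "x \<in> S"
  shows "frechet_derivative (\<lambda>y. frechet_derivative H (at y) u) (at x) v =
    frechet_derivative (\<lambda>y. frechet_derivative H (at y) v) (at x) u"
proof (rule euclidean_eqI)
  fix b :: 'd
  have sm: "smooth_on S (\<lambda>y. H y \<bullet> b)"
    by (intro smooth_on_inner smooth_on_const assms)
  have "frechet_derivative (\<lambda>y. frechet_derivative (\<lambda>y. H y \<bullet> b) (at y) u) (at x) v =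
      frechet_derivative (\<lambda>y. frechet_derivative H (at y) u) (at x) v \<bullet> b" for u v
  proof -
    have "frechet_derivative (\<lambda>y. frechet_derivative (\<lambda>y. H y \<bullet> b) (at y) u) (at x) =
        frechet_derivative (\<lambda>y. frechet_derivative H (at y) u \<bullet> b) (at x)"
      by (rule frechet_derivative_transform_within_open[OF _ assms(1,3)])
         (use assms sm in \<open>auto intro: smooth_onD frechet_derivative_inner_left\<close>)
    then show ?thesis
      using frechet_derivative_inner_left smooth_onD(1)[OF smooth_onD(4)[OF assms(2)] assms(3)]
      by metis
  qed
  then show "frechet_derivative (\<lambda>y. frechet_derivative H (at y) u) (at x) v \<bullet> b =
      frechet_derivative (\<lambda>y. frechet_derivative H (at y) v) (at x) u \<bullet> b"
    using second_derivative_symmetric_real[OF assms(1) sm assms(3), of u v] by metis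
qed

subsection \<open>Smooth bump functions on Euclidean space\<close>

text \<open>The classical function exp(-1/t), with powers of 1/t as factors so that the family is
  closed under differentiation up to linear combinations.\<close>

definition flat :: "nat \<Rightarrow> real \<Rightarrow> real" where
  "flat n t = (if 0 < t then (1 / t) ^ n * exp (- (1 / t)) else 0)"

lemma flat_tendsto_0: "(flat n \<longlongrightarrow> 0) (at 0)"
proof (rule filterlim_split_at)
  show "(flat n \<longlongrightarrow> 0) (at_left 0)"
    by (rule tendsto_eventually) (auto simp: flat_def eventually_at_filter)
  have "((\<lambda>t. inverse t ^ n / exp (inverse t)) \<longlongrightarrow> (0::real)) (at_right 0)"
    by (rule filterlim_compose[OF tendsto_power_div_exp_0 filterlim_inverse_at_top_right])
  moreover have "\<forall>\<^sub>F t in at_right 0. inverse t ^ n / exp (inverse t) = flat n t"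
    by (auto simp: flat_def eventually_at_filter exp_minus divide_simps)
  ultimately show "(flat n \<longlongrightarrow> 0) (at_right 0)" by (rule Lim_transform_eventually)
qed

lemma flat_has_derivative:
  "(flat n has_real_derivative (flat (n + 2) t - real n * flat (n + 1) t)) (at t)"
proof -
  consider "t < 0" | "t = 0" | "t > 0" by linarith
  then show ?thesis
  proof cases
    case 1
    have "(flat n has_real_derivative 0) (at t)"
      by (rule has_field_derivative_transform_within_open[where f = "\<lambda>_. 0" and S = "{..<0}"])
         (use 1 in \<open>auto simp: flat_def\<close>)
    then show ?thesis using 1 by (simp add: flat_def)
  next
    case 2
    \<comment> \<open>At 0 the difference quotient is itself a member of the family, so the limit in
      \<open>flat_tendsto_0\<close> is the derivative.\<close>
    have "(\<lambda>h. (flat n h - flat n 0) / (h - 0)) = flat (n + 1)"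
      by (auto simp: flat_def fun_eq_iff)
    then have "(flat n has_real_derivative 0) (at 0)"
      unfolding has_field_derivative_iff using flat_tendsto_0[of "n + 1"] by simp
    then show ?thesis using 2 by (simp add: flat_def)
  next
    case 3
    have inv: "((\<lambda>t. 1 / t) has_real_derivative - ((1 / t) ^ 2)) (at t)"
      using 3 by (auto intro!: derivative_eq_intros simp: power2_eq_square)
    have "((\<lambda>t. (1 / t) ^ n * exp (- (1 / t))) has_real_derivative
        (1 / t) ^ n * (exp (- (1 / t)) * - (- ((1 / t) ^ 2)))
          + real n * (- ((1 / t) ^ 2) * (1 / t) ^ (n - Suc 0)) * exp (- (1 / t))) (at t)"
      by (rule DERIV_mult'[OF DERIV_power[OF inv] DERIV_fun_exp[OF DERIV_minus[OF inv]]])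
    \<comment> \<open>For n = 0 the truncated exponent n - Suc 0 does no harm: its coefficient
      \<open>real n\<close> is 0.\<close>
    moreover have "s ^ n * (e * - (- (s ^ 2))) + real n * (- (s ^ 2) * s ^ (n - Suc 0)) * e =
        s ^ (n + 2) * e - real n * (s ^ (n + 1) * e)" for s e :: real
      by (cases n) (auto simp: algebra_simps power2_eq_square)
    ultimately have "((\<lambda>t. (1 / t) ^ n * exp (- (1 / t))) has_real_derivative
        (flat (n + 2) t - real n * flat (n + 1) t)) (at t)"
      using 3 by (simp only: flat_def if_True)
    then show ?thesis
      by (rule has_field_derivative_transform_within_open[where S = "{0<..}"])
         (use 3 in \<open>auto simp: flat_def\<close>)
  qed
qed

lemma smooth_on_flat: "smooth_on UNIV (flat n)"
proof -
  have "Ck_on k UNIV (flat n)" for k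
  proof (induction k arbitrary: n)
    case 0
    show ?case
      unfolding Ck_on.simps
      by (rule continuous_at_imp_continuous_on) (blast intro: DERIV_isCont flat_has_derivative)
  next
    case (Suc k)
    show ?case
    proof (rule Ck_on_SucI[where f' = "\<lambda>t v. (flat (n + 2) t + (- real n) * flat (n + 1) t) * v"])
      show "(flat n has_derivative (*) (flat (n + 2) t + (- real n) * flat (n + 1) t)) (at t)" for t
        using flat_has_derivative[of n t] by (simp add: has_field_derivative_def)
      show "Ck_on k UNIV (\<lambda>t. (flat (n + 2) t + (- real n) * flat (n + 1) t) * v)" for v
        by (intro Ck_on_mult Ck_on_add Ck_on_const Suc.IH open_UNIV)
    qed simp
  qed
  then show ?thesis by (simp add: smooth_on_def)
qed

text \<open>The quotient u / (u + v), with u positive exactly inside radius r and v exactly outside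
  radius r/2. These regions cover the space, so the denominator never vanishes; v = 0 gives 1 and u
  = 0 gives 0.\<close>

lemma euclidean_bump_exists:
  fixes x0 :: "'e::euclidean_space"
  assumes "0 < r"
  obtains b :: "'e \<Rightarrow> real" where "smooth_on UNIV b" "\<And>x. 0 \<le> b x" "\<And>x. b x \<le> 1"
    "\<And>x. dist x0 x \<le> r / 2 \<Longrightarrow> b x = 1" "\<And>x. r \<le> dist x0 x \<Longrightarrow> b x = 0"
proof
  let ?q = "\<lambda>x. (x - x0) \<bullet> (x - x0)"
  let ?u = "\<lambda>x. flat 0 (r ^ 2 - ?q x)" and ?v = "\<lambda>x. flat 0 (?q x - (r / 2) ^ 2)"
  let ?b = "\<lambda>x. ?u x * inverse (?u x + ?v x)"
  have q: "?q x = (dist x0 x) ^ 2" for x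
    by (simp add: dist_norm norm_minus_commute dot_square_norm)
  have nonneg: "0 \<le> flat 0 t" and pos: "0 < flat 0 t \<longleftrightarrow> 0 < t" for t
    by (auto simp: flat_def)
  have lt: "(r / 2) ^ 2 < r ^ 2" using assms by (simp add: power_divide)
  have "0 < ?u x \<or> 0 < ?v x" for x unfolding pos using lt by linarith
  then have sum: "0 < ?u x + ?v x" for x using nonneg by (metis add_pos_nonneg add_nonneg_pos)
  have sq: "smooth_on UNIV ?q"
    by (intro smooth_on_inner smooth_on_diff smooth_on_ident smooth_on_const open_UNIV)
  have su: "smooth_on UNIV ?u"
    by (rule smooth_on_compose[OF open_UNIV open_UNIV subset_UNIV smooth_on_flat])
       (intro smooth_on_diff smooth_on_const sq open_UNIV)
  have sv: "smooth_on UNIV ?v"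
    by (rule smooth_on_compose[OF open_UNIV open_UNIV subset_UNIV smooth_on_flat])
       (intro smooth_on_diff smooth_on_const sq open_UNIV)
  show "smooth_on UNIV ?b"
    by (intro smooth_on_mult smooth_on_inverse smooth_on_add su sv open_UNIV)
       (use sum in \<open>simp add: less_imp_neq[symmetric]\<close>)
  show "0 \<le> ?b x" for x using nonneg sum[of x] by simp
  show "?b x \<le> 1" for x
    using nonneg[of "?q x - (r / 2) ^ 2"] sum[of x] by (simp add: divide_inverse[symmetric])
  show "?b x = 1" if "dist x0 x \<le> r / 2" for x
  proof -
    have "?q x \<le> (r / 2) ^ 2" unfolding q using that by (simp add: power_mono)
    then have "?v x = 0" by (simp add: flat_def)
    then show ?thesis using sum[of x] by simp
  qed
  show "?b x = 0" if "r \<le> dist x0 x" for x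
  proof -
    have "r ^ 2 \<le> ?q x" unfolding q using that assms by (simp add: power_mono)
    then show ?thesis by (simp add: flat_def)
  qed
qed

subsection \<open>Smooth families of inner products\<close>

text \<open>Gram-Schmidt with a parameter. Solving one basis vector at a time takes only sums,
  products and division by positive functions, so smoothness is visible at each stage and no matrix
  is inverted.\<close>

lemma smooth_riesz:
  fixes G :: "'e::euclidean_space \<Rightarrow> 'e \<Rightarrow> 'e \<Rightarrow> real"
  assumes S: "open S"
    and lin: "\<And>x v. x \<in> S \<Longrightarrow> linear (\<lambda>u. G x u v)"
    and sym: "\<And>x u v. x \<in> S \<Longrightarrow> G x u v = G x v u"
    and pos: "\<And>x u. x \<in> S \<Longrightarrow> u \<noteq> 0 \<Longrightarrow> 0 < G x u u"
    and smooth: "\<And>u v. smooth_on S (\<lambda>x. G x u v)"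
    and "\<And>x. x \<in> S \<Longrightarrow> linear (\<alpha> x)" "\<And>w. smooth_on S (\<lambda>x. \<alpha> x w)"
  obtains v where "smooth_on S v" "\<And>x w. x \<in> S \<Longrightarrow> G x (v x) w = \<alpha> x w"
proof -
  have lin2: "linear (G x u)" if "x \<in> S" for x u
    using lin[OF that, of u] by (simp add: sym[OF that, of _ u])
  have smoothG: "smooth_on S (\<lambda>x. G x (Y x) (Z x))" if "smooth_on S Y" "smooth_on S Z" for Y Z
  proof (rule smooth_on_linear_family[OF S _ _ that(1), where B = "\<lambda>x u. G x u (Z x)"])
    show "smooth_on S (\<lambda>x. G x u (Z x))" for u
      by (rule smooth_on_linear_family[OF S lin2 smooth that(2)])
  qed (rule lin)
  \<comment> \<open>\<alpha> is quantified inside since the induction step uses the hypothesis for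
    two forms: the given one and G x b, whose solution projects the new vector b onto span
    B.\<close>
  let ?P = "\<lambda>B. \<forall>\<alpha>. (\<forall>x\<in>S. linear (\<alpha> x)) \<longrightarrow> (\<forall>w. smooth_on S (\<lambda>x. \<alpha> x w)) \<longrightarrow>
    (\<exists>v. smooth_on S v \<and> (\<forall>x\<in>S. v x \<in> span B \<and> (\<forall>w\<in>span B. G x (v x) w = \<alpha> x w)))"
  have "finite B \<Longrightarrow> independent B \<Longrightarrow> ?P B" for B :: "'e set"
  proof (induction B rule: finite_induct)
    case empty
    show ?case
    proof (intro allI impI exI[where x = "\<lambda>x. 0"] conjI ballI)
      fix \<alpha> :: "'e \<Rightarrow> 'e \<Rightarrow> real" and x and w :: 'e assume "\<forall>x\<in>S. linear (\<alpha> x)" "x \<in> S" "w \<in> span {}"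
      then show "G x 0 w = \<alpha> x w" using linear_0[OF lin[of x w]] linear_0[of "\<alpha> x"] by auto
    qed (auto intro: smooth_on_const S)
  next
    case (insert b B)
    then have ind: "independent B" "b \<notin> span B" by (auto simp: independent_insert)
    note IH = insert.IH[OF ind(1)]
    have "\<exists>p. smooth_on S p \<and> (\<forall>x\<in>S. p x \<in> span B \<and> (\<forall>w\<in>span B. G x (p x) w = G x b w))"
      using IH[rule_format, of "\<lambda>x w. G x b w", OF lin2 smooth] .
    then obtain p where p: "smooth_on S p" "\<And>x. x \<in> S \<Longrightarrow> p x \<in> span B"
      "\<And>x w. x \<in> S \<Longrightarrow> w \<in> span B \<Longrightarrow> G x (p x) w = G x b w"
      by blast
    \<comment> \<open>The component of b orthogonal to span B. It vanishes nowhere because b lies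
      outside the span, so its squared length can be divided by.\<close>
    define n where "n x = b - p x" for x
    have n: "smooth_on S n" unfolding n_def by (intro smooth_on_diff smooth_on_const S p)
    have orth: "G x (n x) w = 0" "G x w (n x) = 0" if "x \<in> S" "w \<in> span B" for x w
      using p(3)[OF that] linear_diff[OF lin[OF that(1), of w], of b "p x"] sym[OF that(1)]
      by (simp_all add: n_def)
    have "n x \<noteq> 0" if "x \<in> S" for x using p(2)[OF that] ind(2) by (auto simp: n_def)
    then have N: "0 < G x (n x) (n x)" if "x \<in> S" for x using pos that by blast
    have mono: "y \<in> span (insert b B)" if "y \<in> span B" for y
      using that span_mono[of B "insert b B"] by auto
    have nspan: "n x \<in> span (insert b B)" if "x \<in> S" for x
      unfolding n_def by (intro span_diff mono p(2)[OF that] span_base) simp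
    show ?case
    proof (intro allI impI)
      fix \<alpha> assume \<alpha>: "\<forall>x\<in>S. linear (\<alpha> x :: 'e \<Rightarrow> real)" "\<forall>w. smooth_on S (\<lambda>x. \<alpha> x w)"
      have \<alpha>1: "linear (\<alpha> x)" if "x \<in> S" for x using \<alpha>(1) that by blast
      have \<alpha>2: "smooth_on S (\<lambda>x. \<alpha> x w)" for w using \<alpha>(2) by blast
      have "\<exists>v. smooth_on S v \<and> (\<forall>x\<in>S. v x \<in> span B \<and> (\<forall>w\<in>span B. G x (v x) w = \<alpha> x w))"
        by (rule IH[rule_format, OF \<alpha>1 \<alpha>2])
      then obtain v0 where v0: "smooth_on S v0" "\<And>x. x \<in> S \<Longrightarrow> v0 x \<in> span B"
        "\<And>x w. x \<in> S \<Longrightarrow> w \<in> span B \<Longrightarrow> G x (v0 x) w = \<alpha> x w" by blast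
      \<comment> \<open>v0 is orthogonal to n, and n to span B; adding this multiple of n therefore
        corrects the value on n and disturbs none on span B.\<close>
      define c where "c x = \<alpha> x (n x) * inverse (G x (n x) (n x))" for x
      define v where "v x = v0 x + c x *\<^sub>R n x" for x
      have "smooth_on S c" unfolding c_def
        by (rule smooth_on_mult[OF S smooth_on_linear_family[OF S \<alpha>1 \<alpha>2 n]
              smooth_on_inverse[OF S smoothG[OF n n]]])
           (use N in \<open>auto simp: less_imp_neq[symmetric]\<close>)
      then have "smooth_on S v" unfolding v_def
        by (intro smooth_on_add smooth_on_scaleR v0 n S)
      moreover have "v x \<in> span (insert b B)" if "x \<in> S" for x
        unfolding v_def by (intro span_add span_scale mono v0(2)[OF that] nspan[OF that])
      moreover have "G x (v x) w = \<alpha> x w" if x: "x \<in> S" and w: "w \<in> span (insert b B)" for x w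
      proof -
        note l = linear_add[OF lin[OF x]] linear_scale[OF lin[OF x]]
          linear_add[OF lin2[OF x]] linear_scale[OF lin2[OF x]]
        obtain k where k: "w - k *\<^sub>R b \<in> span B" using w unfolding span_insert by auto
        \<comment> \<open>This is w - k n: writing b as p x + n x moves the multiple of p x into
          span B.\<close>
        define w' where "w' = w - k *\<^sub>R b + k *\<^sub>R p x"
        have w': "w' \<in> span B" unfolding w'_def by (intro span_add span_scale k p(2)[OF x])
        have ww: "w = w' + k *\<^sub>R n x" by (simp add: w'_def n_def algebra_simps)
        have "c x * G x (n x) (n x) = \<alpha> x (n x)" using N[OF x] by (simp add: c_def)
        moreover have "G x (v0 x) (n x) = 0" using orth(2)[OF x v0(2)[OF x]] .
        ultimately show ?thesis
          unfolding ww v_def using v0(3)[OF x w'] orth(1)[OF x w']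
          by (simp add: l linear_add[OF \<alpha>1[OF x]] linear_scale[OF \<alpha>1[OF x]])
      qed
      ultimately show "\<exists>v. smooth_on S v \<and>
          (\<forall>x\<in>S. v x \<in> span (insert b B) \<and> (\<forall>w\<in>span (insert b B). G x (v x) w = \<alpha> x w))"
        by blast
    qed
  qed
  from this[OF finite_Basis independent_Basis, rule_format, of \<alpha>, OF assms(6,7)]
  obtain v where "smooth_on S v" "\<forall>x\<in>S. \<forall>w. G x (v x) w = \<alpha> x w" by (auto simp: span_Basis)
  then show ?thesis using that by blast
qed

section \<open>Calculus in charts\<close>

locale smooth_manifold =
  fixes A :: "('a::{t2_space, second_countable_topology}, 'e::euclidean_space) chart set"
  assumes atlas: "smooth_atlas A"
begin

text \<open>The intersection with \<open>img_of c\<close> matters because \<open>param c\<close> is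
  an \<open>inv_into\<close> and has unspecified values off the image.\<close>

definition chart_preimage :: "('a, 'e) chart \<Rightarrow> 'a set \<Rightarrow> 'e set" where
  "chart_preimage c W = img_of c \<inter> param c -` W"

definition jac :: "('a, 'e) chart \<Rightarrow> ('a, 'e) chart \<Rightarrow> 'e \<Rightarrow> 'e \<Rightarrow> 'e" where
  "jac c d x = frechet_derivative (coord d \<circ> param c) (at x)"

text \<open>Inverse to taking the c-component, so it identifies the model space with the tangent
  space at p. The default 0 follows the convention of \<open>tangent_space\<close>.\<close>

definition tvec :: "('a, 'e) chart \<Rightarrow> 'a \<Rightarrow> 'e \<Rightarrow> ('a, 'e) tangent" where
  "tvec c p u = (\<lambda>d. if d \<in> A \<and> p \<in> dom_of d then jac c d (coord c p) u else 0)"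

section \<open>Charts and transition maps\<close>

lemma
  assumes "c \<in> A"
  shows open_dom: "open (dom_of c)" and open_img: "open (img_of c)"
    and continuous_coord: "continuous_on (dom_of c) (coord c)"
    and continuous_param: "continuous_on (img_of c) (param c)"
    and coord_in_img: "p \<in> dom_of c \<Longrightarrow> coord c p \<in> img_of c"
    and param_coord [simp]: "p \<in> dom_of c \<Longrightarrow> param c (coord c p) = p"
    and param_in_dom: "x \<in> img_of c \<Longrightarrow> param c x \<in> dom_of c"
    and coord_param [simp]: "x \<in> img_of c \<Longrightarrow> coord c (param c x) = x"
proof -
  have "is_chart c" using atlas assms by (auto simp: smooth_atlas_def)
  then have "open (dom_of c)" "open (img_of c)"
    and h: "homeomorphism (dom_of c) (img_of c) (coord c) (param c)"
    by (auto simp: is_chart_def)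
  then show "open (dom_of c)" "open (img_of c)" by blast+
  from h show "continuous_on (dom_of c) (coord c)" "continuous_on (img_of c) (param c)"
    "p \<in> dom_of c \<Longrightarrow> coord c p \<in> img_of c" "p \<in> dom_of c \<Longrightarrow> param c (coord c p) = p"
    "x \<in> img_of c \<Longrightarrow> param c x \<in> dom_of c" "x \<in> img_of c \<Longrightarrow> coord c (param c x) = x"
    unfolding homeomorphism_def by auto
qed

lemma open_chart_preimage: "c \<in> A \<Longrightarrow> open W \<Longrightarrow> open (chart_preimage c W)"
  unfolding chart_preimage_def
  by (rule continuous_open_preimage[OF continuous_param open_img])

lemma coord_in_preimage: "c \<in> A \<Longrightarrow> p \<in> dom_of c \<Longrightarrow> p \<in> W \<Longrightarrow> coord c p \<in> chart_preimage c W"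
  by (simp add: chart_preimage_def coord_in_img)

lemma chart_exists: obtains c where "c \<in> A" "p \<in> dom_of c"
proof -
  have "p \<in> (\<Union>c\<in>A. dom_of c)" using atlas by (simp add: smooth_atlas_def)
  then show ?thesis using that by auto
qed

lemma chart_at: "chart_at A p \<in> A" "p \<in> dom_of (chart_at A p)"
proof -
  obtain c where "c \<in> A \<and> p \<in> dom_of c" using chart_exists by blast
  then have "chart_at A p \<in> A \<and> p \<in> dom_of (chart_at A p)"
    unfolding chart_at_def by (rule someI)
  then show "chart_at A p \<in> A" "p \<in> dom_of (chart_at A p)" by blast+
qed

lemma smooth_transition:
  assumes "c \<in> A" "d \<in> A"
  shows "smooth_on (chart_preimage c (dom_of d)) (\<lambda>x. coord d (param c x))"
proof -
  have "coord c ` (dom_of c \<inter> dom_of d) = chart_preimage c (dom_of d)"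
    using assms by (force simp: chart_preimage_def img_of_def)
  moreover have "smooth_on (coord c ` (dom_of c \<inter> dom_of d)) (coord d \<circ> param c)"
    using atlas assms unfolding smooth_atlas_def by blast
  ultimately show ?thesis by (simp add: comp_def)
qed

lemma transition_has_derivative:
  assumes "c \<in> A" "d \<in> A" "x \<in> chart_preimage c (dom_of d)"
  shows "((\<lambda>x. coord d (param c x)) has_derivative jac c d x) (at x)"
  using smooth_onD(2)[OF smooth_transition[OF assms(1,2)] assms(3)] by (simp add: jac_def comp_def)

lemma linear_jac:
  "c \<in> A \<Longrightarrow> d \<in> A \<Longrightarrow> x \<in> chart_preimage c (dom_of d) \<Longrightarrow> linear (jac c d x)"
  using transition_has_derivative has_derivative_linear by blast

lemma smooth_jac:
  "c \<in> A \<Longrightarrow> d \<in> A \<Longrightarrow> smooth_on (chart_preimage c (dom_of d)) (\<lambda>x. jac c d x u)"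
  using smooth_onD(4)[OF smooth_transition] by (simp add: jac_def comp_def)

text \<open>The transitions compose only where all three charts overlap; that set is open, so the
  chain rule and uniqueness of derivatives apply.\<close>

lemma jac_chain:
  assumes "c \<in> A" "d \<in> A" "e \<in> A" "p \<in> dom_of c" "p \<in> dom_of d" "p \<in> dom_of e"
  shows "jac d e (coord d p) (jac c d (coord c p) u) = jac c e (coord c p) u"
proof -
  let ?S = "chart_preimage c (dom_of d \<inter> dom_of e)"
  have S: "open ?S" "coord c p \<in> ?S"
    using assms by (auto intro!: open_chart_preimage open_dom coord_in_preimage)
  have 1: "((\<lambda>x. coord d (param c x)) has_derivative jac c d (coord c p)) (at (coord c p))"
    using assms by (intro transition_has_derivative coord_in_preimage) auto
  have 2: "((\<lambda>x. coord e (param d x)) has_derivative jac d e (coord d p))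
      (at (coord d (param c (coord c p))))"
    using assms by (simp add: transition_has_derivative coord_in_preimage)
  have "((\<lambda>x. coord e (param d (coord d (param c x)))) has_derivative
      (\<lambda>u. jac d e (coord d p) (jac c d (coord c p) u))) (at (coord c p))"
    by (rule has_derivative_compose[OF 1 2])
  then have 3: "((\<lambda>x. coord e (param c x)) has_derivative
      (\<lambda>u. jac d e (coord d p) (jac c d (coord c p) u))) (at (coord c p))"
    by (rule has_derivative_transform_within_open[OF _ S]) (use assms in \<open>simp add: chart_preimage_def\<close>)
  have 4: "((\<lambda>x. coord e (param c x)) has_derivative jac c e (coord c p)) (at (coord c p))"
    using assms by (intro transition_has_derivative coord_in_preimage) auto
  show ?thesis by (rule fun_cong[OF has_derivative_unique[OF 3 4]])
qed

lemma jac_self: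
  assumes "c \<in> A" "p \<in> dom_of c"
  shows "jac c c (coord c p) u = u"
proof -
  have "((\<lambda>x. x) has_derivative (\<lambda>x. x)) (at (coord c p))" by (rule has_derivative_ident)
  then have 1: "((\<lambda>x. coord c (param c x)) has_derivative (\<lambda>x. x)) (at (coord c p))"
    by (rule has_derivative_transform_within_open[OF _ open_img[OF assms(1)]])
       (use assms in \<open>auto intro: coord_in_img\<close>)
  have 2: "((\<lambda>x. coord c (param c x)) has_derivative jac c c (coord c p)) (at (coord c p))"
    using assms by (intro transition_has_derivative coord_in_preimage) auto
  show ?thesis by (rule fun_cong[OF has_derivative_unique[OF 2 1]])
qed

section \<open>Tangent spaces\<close>

lemma tangent_spaceD:
  assumes "v \<in> tangent_space A p" "c \<in> A" "d \<in> A" "p \<in> dom_of c" "p \<in> dom_of d"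
  shows "v d = jac c d (coord c p) (v c)"
  using assms unfolding tangent_space_def jac_def by blast

lemma tangent_spaceI:
  assumes "\<And>c d. \<lbrakk>c \<in> A; d \<in> A; p \<in> dom_of c; p \<in> dom_of d\<rbrakk> \<Longrightarrow> v d = jac c d (coord c p) (v c)"
    and "\<And>c. \<not> (c \<in> A \<and> p \<in> dom_of c) \<Longrightarrow> v c = 0"
  shows "v \<in> tangent_space A p"
  using assms unfolding tangent_space_def jac_def by blast

lemma tangent_space_outside:
  "v \<in> tangent_space A p \<Longrightarrow> \<not> (c \<in> A \<and> p \<in> dom_of c) \<Longrightarrow> v c = 0"
  unfolding tangent_space_def by blast

lemma tvec_apply [simp]: "c \<in> A \<Longrightarrow> p \<in> dom_of c \<Longrightarrow> tvec c p u c = u"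
  by (simp add: tvec_def jac_self)

lemma tvec_in_tangent_space: "c \<in> A \<Longrightarrow> p \<in> dom_of c \<Longrightarrow> tvec c p u \<in> tangent_space A p"
  by (rule tangent_spaceI) (auto simp: tvec_def jac_chain)

lemma tangent_space_eqI:
  assumes "v \<in> tangent_space A p" "w \<in> tangent_space A p" "c \<in> A" "p \<in> dom_of c" "v c = w c"
  shows "v = w"
proof
  fix d show "v d = w d"
    using tangent_spaceD[OF assms(1,3) _ assms(4), of d] tangent_spaceD[OF assms(2,3) _ assms(4), of d]
      tangent_space_outside[OF assms(1), of d] tangent_space_outside[OF assms(2), of d] assms(5)
    by (cases "d \<in> A \<and> p \<in> dom_of d") auto
qed

lemma tvec_component:
  "v \<in> tangent_space A p \<Longrightarrow> c \<in> A \<Longrightarrow> p \<in> dom_of c \<Longrightarrow> tvec c p (v c) = v"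
  by (rule tangent_space_eqI[OF tvec_in_tangent_space]) auto

lemma linear_jac_coord:
  "c \<in> A \<Longrightarrow> d \<in> A \<Longrightarrow> p \<in> dom_of c \<Longrightarrow> p \<in> dom_of d \<Longrightarrow> linear (jac c d (coord c p))"
  by (simp add: linear_jac coord_in_preimage)

lemma tangent_space_add:
  assumes "v \<in> tangent_space A p" "w \<in> tangent_space A p"
  shows "(\<lambda>c. v c + w c) \<in> tangent_space A p"
proof (rule tangent_spaceI)
  fix c d assume *: "c \<in> A" "d \<in> A" "p \<in> dom_of c" "p \<in> dom_of d"
  show "v d + w d = jac c d (coord c p) (v c + w c)"
    unfolding tangent_spaceD[OF assms(1) *] tangent_spaceD[OF assms(2) *]
    by (simp add: linear_add[OF linear_jac_coord[OF *]])
qed (simp add: tangent_space_outside[OF assms(1)] tangent_space_outside[OF assms(2)])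

lemma tangent_space_scale:
  assumes "v \<in> tangent_space A p"
  shows "(\<lambda>c. r *\<^sub>R v c) \<in> tangent_space A p"
proof (rule tangent_spaceI)
  fix c d assume *: "c \<in> A" "d \<in> A" "p \<in> dom_of c" "p \<in> dom_of d"
  show "r *\<^sub>R v d = jac c d (coord c p) (r *\<^sub>R v c)"
    unfolding tangent_spaceD[OF assms *] by (simp add: linear_scale[OF linear_jac_coord[OF *]])
qed (simp add: tangent_space_outside[OF assms])

lemma tangent_space_zero: "(\<lambda>c. 0) \<in> tangent_space A p"
  by (rule tangent_spaceI) (auto simp: linear_0 linear_jac_coord)

lemma tvec_add:
  "c \<in> A \<Longrightarrow> p \<in> dom_of c \<Longrightarrow> tvec c p (u + v) = (\<lambda>d. tvec c p u d + tvec c p v d)"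
  by (auto simp: tvec_def fun_eq_iff linear_jac_coord linear_add)

lemma tvec_scale:
  "c \<in> A \<Longrightarrow> p \<in> dom_of c \<Longrightarrow> tvec c p (r *\<^sub>R u) = (\<lambda>d. r *\<^sub>R tvec c p u d)"
  by (auto simp: tvec_def fun_eq_iff linear_jac_coord linear_scale)

section \<open>Smooth functions and vector fields\<close>

lemma smooth_transfer:
  fixes h :: "'a \<Rightarrow> 'f::real_normed_vector"
  assumes "c \<in> A" "d \<in> A" "open W" "smooth_on (chart_preimage c W) (\<lambda>x. h (param c x))"
  shows "smooth_on (chart_preimage d (W \<inter> dom_of c)) (\<lambda>x. h (param d x))"
proof -
  have o: "open (chart_preimage d (W \<inter> dom_of c))" "open (chart_preimage c W)"
    using assms by (auto intro!: open_chart_preimage open_dom)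
  have s: "smooth_on (chart_preimage d (W \<inter> dom_of c)) (\<lambda>x. coord c (param d x))"
    by (rule smooth_on_subset[OF smooth_transition[OF assms(2,1)]]) (auto simp: chart_preimage_def)
  have "smooth_on (chart_preimage d (W \<inter> dom_of c)) (\<lambda>x. h (param c (coord c (param d x))))"
    by (rule smooth_on_compose[OF o _ assms(4) s])
       (use assms in \<open>auto simp: chart_preimage_def coord_in_img\<close>)
  then show ?thesis
    by (rule smooth_on_cong[OF _ o(1)]) (use assms in \<open>auto simp: chart_preimage_def\<close>)
qed

text \<open>The definition demands smoothness in every chart; transition maps carry it over from one
  convenient chart near each point.\<close>

lemma smooth_funI:
  assumes "\<And>p. \<exists>c\<in>A. \<exists>W. p \<in> dom_of c \<and> open W \<and> p \<in> W
    \<and> smooth_on (chart_preimage c W) (\<lambda>x. h (param c x))"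
  shows "smooth_fun A h"
  unfolding smooth_fun_def comp_def
proof (intro ballI smooth_on_local)
  fix d x assume d: "d \<in> A" and x: "x \<in> img_of d"
  from assms[of "param d x"] obtain c W where c: "c \<in> A" "param d x \<in> dom_of c" "open W"
    "param d x \<in> W" "smooth_on (chart_preimage c W) (\<lambda>x. h (param c x))" by blast
  show "\<exists>T. open T \<and> x \<in> T \<and> smooth_on T (\<lambda>x. h (param d x))"
    by (intro exI[where x = "chart_preimage d (W \<inter> dom_of c)"] conjI
        smooth_transfer[OF c(1) d c(3,5)] open_chart_preimage d)
       (use c x in \<open>auto simp: chart_preimage_def open_dom\<close>)
qed

lemma smooth_funD: "smooth_fun A h \<Longrightarrow> c \<in> A \<Longrightarrow> smooth_on (img_of c) (\<lambda>x. h (param c x))"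
  by (simp add: smooth_fun_def comp_def)

lemma smooth_fun_const: "smooth_fun A (\<lambda>p. r)"
  by (simp add: smooth_fun_def comp_def smooth_on_const open_img)

lemma smooth_fun_diff: "smooth_fun A h \<Longrightarrow> smooth_fun A k \<Longrightarrow> smooth_fun A (\<lambda>p. h p - k p)"
  by (simp add: smooth_fun_def comp_def smooth_on_diff open_img)

lemma smooth_fun_mult: "smooth_fun A h \<Longrightarrow> smooth_fun A k \<Longrightarrow> smooth_fun A (\<lambda>p. h p * k p)"
  by (simp add: smooth_fun_def comp_def smooth_on_mult open_img)

lemma smooth_fun_sum:
  "(\<And>i. i \<in> I \<Longrightarrow> smooth_fun A (h i)) \<Longrightarrow> smooth_fun A (\<lambda>p. \<Sum>i\<in>I. h i p)"
  by (simp add: smooth_fun_def comp_def smooth_on_sum open_img)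

lemma smooth_fun_prod:
  "finite I \<Longrightarrow> (\<And>i. i \<in> I \<Longrightarrow> smooth_fun A (h i)) \<Longrightarrow> smooth_fun A (\<lambda>p. \<Prod>i\<in>I. h i p)"
  by (induction I rule: finite_induct) (auto intro: smooth_fun_const smooth_fun_mult)

lemma smooth_fun_local:
  assumes "\<And>p. \<exists>W k. open W \<and> p \<in> W \<and> smooth_fun A k \<and> (\<forall>q\<in>W. h q = k q)"
  shows "smooth_fun A h"
proof (rule smooth_funI)
  fix p
  obtain W k where W: "open W" "p \<in> W" "smooth_fun A k" "\<And>q. q \<in> W \<Longrightarrow> h q = k q"
    using assms[of p] by blast
  obtain c where c: "c \<in> A" "p \<in> dom_of c" by (rule chart_exists)
  have "smooth_on (chart_preimage c W) (\<lambda>x. h (param c x))"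
    by (rule smooth_on_cong[OF smooth_on_subset[OF smooth_funD[OF W(3) c(1)]]
          open_chart_preimage[OF c(1) W(1)]]) (auto simp: chart_preimage_def W(4))
  then show "\<exists>c\<in>A. \<exists>W. p \<in> dom_of c \<and> open W \<and> p \<in> W
      \<and> smooth_on (chart_preimage c W) (\<lambda>x. h (param c x))"
    using c W by blast
qed

lemma vector_fieldD:
  assumes "X \<in> vector_fields A"
  shows "X p \<in> tangent_space A p" and "c \<in> A \<Longrightarrow> smooth_on (img_of c) (\<lambda>x. X (param c x) c)"
  using assms by (auto simp: vector_fields_def)

text \<open>As for functions, except that components also change by the Jacobian, which is a smooth
  linear family along the transition.\<close>

lemma vector_fieldI:
  assumes "\<And>p. X p \<in> tangent_space A p"
    and "\<And>p. \<exists>c\<in>A. \<exists>W. p \<in> dom_of c \<and> open W \<and> p \<in> W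
      \<and> smooth_on (chart_preimage c W) (\<lambda>x. X (param c x) c)"
  shows "X \<in> vector_fields A"
  unfolding vector_fields_def mem_Collect_eq
proof (intro conjI allI ballI assms(1) smooth_on_local)
  fix d x assume d: "d \<in> A" and x: "x \<in> img_of d"
  from assms(2)[of "param d x"] obtain c W where c: "c \<in> A" "param d x \<in> dom_of c" "open W"
    "param d x \<in> W" "smooth_on (chart_preimage c W) (\<lambda>x. X (param c x) c)" by blast
  let ?T = "chart_preimage d (W \<inter> dom_of c)"
  have T: "open ?T" using c d by (auto intro!: open_chart_preimage open_dom)
  have s: "smooth_on ?T (\<lambda>x. coord c (param d x))"
    by (rule smooth_on_subset[OF smooth_transition[OF d c(1)]]) (auto simp: chart_preimage_def)
  have "smooth_on ?T (\<lambda>x. jac c d (coord c (param d x)) (X (param d x) c))"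
  proof (rule smooth_on_linear_family[OF T _ _ smooth_transfer[OF c(1) d c(3,5)]])
    show "linear (jac c d (coord c (param d y)))" if "y \<in> ?T" for y
      using that c d by (intro linear_jac_coord) (auto simp: chart_preimage_def param_in_dom)
    show "smooth_on ?T (\<lambda>y. jac c d (coord c (param d y)) u)" for u
      by (rule smooth_on_compose[OF T open_chart_preimage[OF c(1) open_dom[OF d]] _
            smooth_jac[OF c(1) d] s])
         (use c d in \<open>auto simp: chart_preimage_def coord_in_img param_in_dom\<close>)
  qed
  then have "smooth_on ?T (\<lambda>x. X (param d x) d)"
    by (rule smooth_on_cong[OF _ T])
       (use c d in \<open>auto simp: chart_preimage_def param_in_dom tangent_spaceD[OF assms(1) c(1) d, symmetric]\<close>)
  then show "\<exists>T. open T \<and> x \<in> T \<and> smooth_on T (\<lambda>x. X (param d x) d)"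
    using T c x by (auto simp: chart_preimage_def)
qed

lemma vf_add_in: "X \<in> vector_fields A \<Longrightarrow> Y \<in> vector_fields A \<Longrightarrow> vf_add X Y \<in> vector_fields A"
  by (simp add: vector_fields_def vf_add_def smooth_on_add open_img tangent_space_add)

lemma vf_scale_in: "smooth_fun A h \<Longrightarrow> X \<in> vector_fields A \<Longrightarrow> vf_scale h X \<in> vector_fields A"
  by (simp add: vector_fields_def vf_scale_def smooth_on_scaleR open_img tangent_space_scale
      smooth_fun_def comp_def)

text \<open>Frees \<open>tangent_deriv\<close> from the unspecified \<open>chart_at\<close>: the
  Jacobian from the chain rule matches the one in the transformation rule of v.\<close>

lemma tangent_deriv_chart:
  assumes "c \<in> A" "p \<in> dom_of c" "v \<in> tangent_space A p"
    and "(\<lambda>x. h (param c x)) differentiable (at (coord c p))"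
  shows "tangent_deriv A p v h = frechet_derivative (\<lambda>x. h (param c x)) (at (coord c p)) (v c)"
proof -
  define d where "d = chart_at A p"
  have d: "d \<in> A" "p \<in> dom_of d" using chart_at by (auto simp: d_def)
  let ?T = "chart_preimage d (dom_of c)"
  have T: "open ?T" "coord d p \<in> ?T"
    using assms d by (auto intro!: open_chart_preimage open_dom coord_in_preimage)
  have 1: "((\<lambda>x. coord c (param d x)) has_derivative jac d c (coord d p)) (at (coord d p))"
    by (rule transition_has_derivative[OF d(1) assms(1) T(2)])
  have 2: "((\<lambda>x. h (param c x)) has_derivative frechet_derivative (\<lambda>x. h (param c x)) (at (coord c p)))
      (at (coord c (param d (coord d p))))"
    using differentiable_has_frechet[OF assms(4)] d by simp
  have "((\<lambda>x. h (param d x)) has_derivative (\<lambda>u. frechet_derivative (\<lambda>x. h (param c x)) (at (coord c p))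
      (jac d c (coord d p) u))) (at (coord d p))"
    by (rule has_derivative_transform_within_open[OF has_derivative_compose[OF 1 2] T])
       (use assms in \<open>simp add: chart_preimage_def\<close>)
  from frechet_derivative_at[OF this, symmetric] show ?thesis
    unfolding tangent_deriv_def Let_def d_def[symmetric] comp_def
    by (simp add: tangent_spaceD[OF assms(3) d(1) assms(1) d(2) assms(2)])
qed

lemma vf_apply_chart:
  assumes "c \<in> A" "x \<in> img_of c" "X \<in> vector_fields A" "smooth_fun A h"
  shows "vf_apply A X h (param c x) =
    frechet_derivative (\<lambda>x. h (param c x)) (at x) (X (param c x) c)"
  using tangent_deriv_chart[OF assms(1) param_in_dom[OF assms(1,2)] vector_fieldD(1)[OF assms(3)], of h]
    smooth_onD(1)[OF smooth_funD[OF assms(4,1)] assms(2)] assms(1,2)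
  by (simp add: vf_apply_def)

lemma smooth_fun_vf_apply:
  assumes "X \<in> vector_fields A" "smooth_fun A h"
  shows "smooth_fun A (vf_apply A X h)"
  unfolding smooth_fun_def comp_def
proof
  fix c assume c: "c \<in> A"
  have "smooth_on (img_of c) (\<lambda>x. frechet_derivative (\<lambda>x. h (param c x)) (at x) (X (param c x) c))"
    by (rule smooth_on_linear_family[OF open_img[OF c] smooth_onD(3,4) vector_fieldD(2)[OF assms(1) c]])
       (use smooth_funD[OF assms(2) c] in auto)
  then show "smooth_on (img_of c) (\<lambda>x. vf_apply A X h (param c x))"
    by (rule smooth_on_cong[OF _ open_img[OF c]]) (simp add: vf_apply_chart[OF c _ assms])
qed

section \<open>Cutoff functions and global extensions\<close>

text \<open>The closed set K is exported because its complement is an open set on which \<eta>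
  vanishes; this is how later products extended by 0 are seen to be smooth.\<close>

lemma bump_exists:
  assumes "c \<in> A" "p \<in> dom_of c" "open W" "p \<in> W"
  obtains \<eta> V K where "smooth_fun A \<eta>" "\<And>q. 0 \<le> \<eta> q" "\<And>q. \<eta> q \<le> 1"
    "open V" "p \<in> V" "\<And>q. q \<in> V \<Longrightarrow> \<eta> q = 1"
    "closed K" "K \<subseteq> W \<inter> dom_of c" "\<And>q. q \<notin> K \<Longrightarrow> \<eta> q = 0"
proof -
  let ?x = "coord c p"
  have "open (chart_preimage c W)" "?x \<in> chart_preimage c W"
    using assms by (auto intro: open_chart_preimage coord_in_preimage)
  then obtain r where r: "0 < r" "cball ?x r \<subseteq> chart_preimage c W"
    using open_contains_cball by blast
  obtain b :: "'e \<Rightarrow> real" where b: "smooth_on UNIV b" "\<And>x. 0 \<le> b x" "\<And>x. b x \<le> 1"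
    "\<And>x. dist ?x x \<le> r / 2 \<Longrightarrow> b x = 1" "\<And>x. r \<le> dist ?x x \<Longrightarrow> b x = 0"
    using euclidean_bump_exists[OF r(1)] by metis
  define \<eta> where "\<eta> q = (if q \<in> dom_of c then b (coord c q) else 0)" for q
  define K where "K = param c ` cball ?x r"
  define V where "V = param c ` ball ?x (r / 2)"
  have img: "cball ?x r \<subseteq> img_of c" using r(2) by (auto simp: chart_preimage_def)
  \<comment> \<open>Closed in the chart domain would not be enough: compactness and the Hausdorff
    property make K closed in the whole manifold.\<close>
  have "compact K" unfolding K_def
    by (rule compact_continuous_image[OF continuous_on_subset[OF continuous_param[OF assms(1)] img]])
       simp
  then have K: "closed K" by (rule compact_imp_closed)
  have half: "ball ?x (r / 2) \<subseteq> img_of c" using img r(1) by (auto simp: subset_iff)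
  have "V = dom_of c \<inter> coord c -` ball ?x (r / 2)"
    unfolding V_def using half assms(1) by (force simp: param_in_dom)
  then have V: "open V"
    using continuous_open_preimage[OF continuous_coord[OF assms(1)] open_dom[OF assms(1)]] by simp
  have off: "\<eta> q = 0" if "q \<notin> K" for q
  proof (cases "q \<in> dom_of c")
    case True
    then have "coord c q \<notin> cball ?x r"
      using that assms(1) unfolding K_def by (metis image_eqI param_coord)
    then show ?thesis using b(5) by (simp add: \<eta>_def)
  qed (simp add: \<eta>_def)
  have smooth: "smooth_fun A \<eta>"
  proof (rule smooth_funI)
    fix q
    show "\<exists>c\<in>A. \<exists>W. q \<in> dom_of c \<and> open W \<and> q \<in> W \<and> smooth_on (chart_preimage c W) (\<lambda>x. \<eta> (param c x))"
    proof (cases "q \<in> K")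
      case True
      then have q: "q \<in> dom_of c" using img assms(1) by (auto simp: K_def param_in_dom)
      have "smooth_on (chart_preimage c (dom_of c)) (\<lambda>x. \<eta> (param c x))"
        by (rule smooth_on_cong[OF smooth_on_subset[OF b(1)] open_chart_preimage])
           (use assms(1) in \<open>auto simp: \<eta>_def chart_preimage_def open_dom\<close>)
      then show ?thesis using q assms(1) open_dom by blast
    next
      case False
      obtain d where d: "d \<in> A" "q \<in> dom_of d" by (rule chart_exists)
      have o: "open (chart_preimage d (- K))" using d by (intro open_chart_preimage open_Compl K)
      have "smooth_on (chart_preimage d (- K)) (\<lambda>x. \<eta> (param d x))"
        by (rule smooth_on_cong[OF smooth_on_const[where c = 0, OF o] o])
           (auto simp: chart_preimage_def off)
      then show ?thesis using d False K by blast
    qed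
  qed
  show ?thesis
  proof (rule that[OF smooth _ _ V _ _ K _ off])
    show "0 \<le> \<eta> q" "\<eta> q \<le> 1" for q using b by (auto simp: \<eta>_def)
    show "p \<in> V" unfolding V_def using r(1) assms by (metis centre_in_ball half_gt_zero image_eqI param_coord)
    show "\<eta> q = 1" if "q \<in> V" for q
      using that half assms(1) b(4) by (auto simp: V_def \<eta>_def param_in_dom subset_iff)
    show "K \<subseteq> W \<inter> dom_of c" using r(2) assms(1) by (auto simp: K_def chart_preimage_def param_in_dom)
  qed
qed

lemma local_extension:
  assumes "c \<in> A" "p \<in> dom_of c" "open W" "p \<in> W" "smooth_on (chart_preimage c W) k"
  obtains h V where "smooth_fun A h" "open V" "p \<in> V" "V \<subseteq> W \<inter> dom_of c"
    "\<And>q. q \<in> V \<Longrightarrow> h q = k (coord c q)"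
proof -
  from bump_exists[OF assms(1-4)] obtain \<eta> V K where \<eta>: "smooth_fun A \<eta>"
    "open V" "p \<in> V" "\<And>q. q \<in> V \<Longrightarrow> \<eta> q = 1"
    "closed K" "K \<subseteq> W \<inter> dom_of c" "\<And>q. q \<notin> K \<Longrightarrow> \<eta> q = 0" by metis
  define h where "h q = \<eta> q * k (coord c q)" for q
  have "smooth_fun A h"
  proof (rule smooth_funI)
    fix q
    show "\<exists>c\<in>A. \<exists>W. q \<in> dom_of c \<and> open W \<and> q \<in> W \<and> smooth_on (chart_preimage c W) (\<lambda>x. h (param c x))"
    proof (cases "q \<in> K")
      case True
      then have q: "q \<in> dom_of c" "q \<in> W" using \<eta>(6) by auto
      have o: "open (chart_preimage c W)" using assms by (simp add: open_chart_preimage)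
      have "smooth_on (chart_preimage c W) (\<lambda>x. \<eta> (param c x) * k x)"
        by (rule smooth_on_mult[OF o smooth_on_subset[OF smooth_funD[OF \<eta>(1) assms(1)]] assms(5)])
           (auto simp: chart_preimage_def)
      then have "smooth_on (chart_preimage c W) (\<lambda>x. h (param c x))"
        by (rule smooth_on_cong[OF _ o]) (use assms(1) in \<open>auto simp: h_def chart_preimage_def\<close>)
      then show ?thesis using q assms by blast
    next
      case False
      obtain d where d: "d \<in> A" "q \<in> dom_of d" by (rule chart_exists)
      have o: "open (chart_preimage d (- K))" using d by (intro open_chart_preimage open_Compl \<eta>(5))
      have "smooth_on (chart_preimage d (- K)) (\<lambda>x. h (param d x))"
        by (rule smooth_on_cong[OF smooth_on_const[where c = 0, OF o] o])
           (auto simp: chart_preimage_def h_def \<eta>(7))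
      then show ?thesis using d False \<eta> by blast
    qed
  qed
  moreover have "V \<subseteq> K" using \<eta>(4,7) by fastforce
  ultimately show ?thesis
    using \<eta>(2-4,6) by (intro that[of h V]) (auto simp: h_def)
qed

text \<open>Supplies the global fields on which \<open>christoffel\<close> and the smoothness axiom
  of the metric can be evaluated.\<close>

lemma constant_extension:
  assumes "c \<in> A" "p \<in> dom_of c"
  obtains U V where "U \<in> vector_fields A" "open V" "p \<in> V" "V \<subseteq> dom_of c"
    "\<And>q. q \<in> V \<Longrightarrow> U q = tvec c q u"
proof -
  from bump_exists[OF assms open_dom[OF assms(1)] assms(2)]
  obtain \<eta> V K where \<eta>: "smooth_fun A \<eta>"
    "open V" "p \<in> V" "\<And>q. q \<in> V \<Longrightarrow> \<eta> q = 1"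
    "closed K" "K \<subseteq> dom_of c" "\<And>q. q \<notin> K \<Longrightarrow> \<eta> q = 0" by (metis inf.idem)
  define U where "U q = (if q \<in> dom_of c then \<lambda>d. \<eta> q *\<^sub>R tvec c q u d else (\<lambda>d. 0))" for q
  have "U \<in> vector_fields A"
  proof (rule vector_fieldI)
    show "U q \<in> tangent_space A q" for q
      using assms(1) by (auto simp: U_def intro: tangent_space_scale tangent_space_zero tvec_in_tangent_space)
    fix q
    show "\<exists>c\<in>A. \<exists>W. q \<in> dom_of c \<and> open W \<and> q \<in> W \<and> smooth_on (chart_preimage c W) (\<lambda>x. U (param c x) c)"
    proof (cases "q \<in> K")
      case True
      then have q: "q \<in> dom_of c" using \<eta>(6) by auto
      have o: "open (chart_preimage c (dom_of c))" using assms by (simp add: open_chart_preimage open_dom)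
      have "smooth_on (chart_preimage c (dom_of c)) (\<lambda>x. \<eta> (param c x) *\<^sub>R u)"
        by (rule smooth_on_scaleR[OF o smooth_on_subset[OF smooth_funD[OF \<eta>(1) assms(1)]] smooth_on_const[OF o]])
           (auto simp: chart_preimage_def)
      then have "smooth_on (chart_preimage c (dom_of c)) (\<lambda>x. U (param c x) c)"
        by (rule smooth_on_cong[OF _ o]) (use assms(1) in \<open>auto simp: U_def chart_preimage_def\<close>)
      then show ?thesis using q assms open_dom by blast
    next
      case False
      obtain d where d: "d \<in> A" "q \<in> dom_of d" by (rule chart_exists)
      have o: "open (chart_preimage d (- K))" using d by (intro open_chart_preimage open_Compl \<eta>(5))
      have "smooth_on (chart_preimage d (- K)) (\<lambda>x. U (param d x) d)"
        by (rule smooth_on_cong[OF smooth_on_const[where c = 0, OF o] o])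
           (auto simp: chart_preimage_def U_def \<eta>(7))
      then show ?thesis using d False \<eta> by blast
    qed
  qed
  moreover have "V \<subseteq> K" using \<eta>(4,7) by fastforce
  ultimately show ?thesis
    using \<eta>(2-4,6) by (intro that[of U V]) (auto simp: U_def)
qed

lemma tangent_extends:
  assumes "v \<in> tangent_space A p"
  obtains X where "X \<in> vector_fields A" "X p = v"
proof -
  obtain c where c: "c \<in> A" "p \<in> dom_of c" by (rule chart_exists)
  obtain U V where "U \<in> vector_fields A" "p \<in> V" "\<And>q. q \<in> V \<Longrightarrow> U q = tvec c q (v c)"
    using constant_extension[OF c] by metis
  then show ?thesis using that tvec_component[OF assms c] by metis
qed

lemma extends_const_exists:
  assumes "c \<in> A" "p \<in> dom_of c"
  shows "\<exists>U. extends_const A c p u U"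
proof -
  obtain U V where "U \<in> vector_fields A" "open V" "p \<in> V" "V \<subseteq> dom_of c"
    "\<And>q. q \<in> V \<Longrightarrow> U q = tvec c q u"
    using constant_extension[OF assms] by metis
  then have "extends_const A c p u U"
    unfolding extends_const_def eventually_nhds using assms(1) by (metis subsetD tvec_apply)
  then show ?thesis by (rule exI[of _ U])
qed

text \<open>Cut-off coordinate functions detect every component. Needed because
  \<open>torsion_free\<close> compares fields only through their action on functions.\<close>

lemma tangent_space_separated:
  assumes "v \<in> tangent_space A p" "w \<in> tangent_space A p"
    and "\<And>h. smooth_fun A h \<Longrightarrow> tangent_deriv A p v h = tangent_deriv A p w h"
  shows "v = w"
proof -
  obtain c where c: "c \<in> A" "p \<in> dom_of c" by (rule chart_exists)
  have "v c \<bullet> b = w c \<bullet> b" for b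
  proof -
    have s: "smooth_on (chart_preimage c (dom_of c)) (\<lambda>x. x \<bullet> b)"
      using c by (intro smooth_on_inner smooth_on_ident smooth_on_const open_chart_preimage open_dom)
    obtain h V where h: "smooth_fun A h" "open V" "p \<in> V" "V \<subseteq> dom_of c"
      "\<And>q. q \<in> V \<Longrightarrow> h q = coord c q \<bullet> b"
      using local_extension[OF c open_dom[OF c(1)] c(2) s] by (metis inf.idem)
    have "((\<lambda>x. x \<bullet> b) has_derivative (\<lambda>u. u \<bullet> b)) (at (coord c p))"
      by (auto intro!: derivative_eq_intros)
    then have "((\<lambda>x. h (param c x)) has_derivative (\<lambda>u. u \<bullet> b)) (at (coord c p))"
      by (rule has_derivative_transform_within_open[OF _ open_chart_preimage[OF c(1) h(2)]])
         (use c h in \<open>auto simp: chart_preimage_def coord_in_img\<close>)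
    note D = this
    have diff: "(\<lambda>x. h (param c x)) differentiable (at (coord c p))"
      using D unfolding differentiable_def by blast
    have "tangent_deriv A p v' h = v' c \<bullet> b" if "v' \<in> tangent_space A p" for v'
      by (simp add: tangent_deriv_chart[OF c that diff] frechet_derivative_at[OF D, symmetric])
    from this[OF assms(1)] this[OF assms(2)] assms(3)[OF h(1)] show ?thesis by argo
  qed
  then have "v c = w c" using euclidean_eqI by blast
  then show ?thesis by (rule tangent_space_eqI[OF assms(1,2) c])
qed

text \<open>The second summand comes from differentiating the components of Y. Antisymmetrised it is
  the Lie bracket acting on h; in a Hessian the connection has to cancel it.\<close>

lemma vf_apply_vf_apply_chart:
  assumes "c \<in> A" "x \<in> img_of c" "X \<in> vector_fields A" "Y \<in> vector_fields A" "smooth_fun A h"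
  shows "vf_apply A X (vf_apply A Y h) (param c x) =
    frechet_derivative (\<lambda>y. frechet_derivative (\<lambda>x. h (param c x)) (at y) (Y (param c x) c)) (at x)
      (X (param c x) c) +
    frechet_derivative (\<lambda>x. h (param c x)) (at x)
      (frechet_derivative (\<lambda>x. Y (param c x) c) (at x) (X (param c x) c))"
proof -
  note h = smooth_funD[OF assms(5,1)]
  note D = has_derivative_linear_family[OF open_img[OF assms(1)] assms(2) smooth_onD(3)[OF h]
    smooth_onD(1)[OF smooth_onD(4)[OF h] assms(2)]
    smooth_onD(2)[OF vector_fieldD(2)[OF assms(4,1)] assms(2)]]
  have "((\<lambda>x. vf_apply A Y h (param c x)) has_derivative
     (\<lambda>w. frechet_derivative (\<lambda>y. frechet_derivative (\<lambda>x. h (param c x)) (at y) (Y (param c x) c)) (at x) w +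
    frechet_derivative (\<lambda>x. h (param c x)) (at x)
      (frechet_derivative (\<lambda>x. Y (param c x) c) (at x) w))) (at x)"
    by (rule has_derivative_transform_within_open[OF D open_img[OF assms(1)] assms(2)])
       (simp_all add: vf_apply_chart[OF assms(1) _ assms(4,5)])
  from frechet_derivative_at[OF this, symmetric] show ?thesis
    by (simp add: vf_apply_chart[OF assms(1-3) smooth_fun_vf_apply[OF assms(4,5)]])
qed

end

section \<open>The Levi-Civita connection\<close>

locale riemannian_manifold = smooth_manifold A
  for A :: "('a::{t2_space, second_countable_topology}, 'e::euclidean_space) chart set" +
  fixes g :: "('a, 'e) metric"
  assumes metric: "riemannian_metric A g"
begin

section \<open>The metric in coordinates\<close>

lemma
  assumes "u \<in> tangent_space A p" "v \<in> tangent_space A p"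
  shows metric_sym: "g p u v = g p v u"
    and metric_add_left: "w \<in> tangent_space A p \<Longrightarrow> g p (\<lambda>c. u c + v c) w = g p u w + g p v w"
    and metric_scale_left: "g p (\<lambda>c. r *\<^sub>R u c) v = r * g p u v"
  using metric assms unfolding riemannian_metric_def by blast+

lemma metric_pos: "v \<in> tangent_space A p \<Longrightarrow> v \<noteq> (\<lambda>c. 0) \<Longrightarrow> 0 < g p v v"
  using metric unfolding riemannian_metric_def by blast

lemma smooth_metric:
  "X \<in> vector_fields A \<Longrightarrow> Y \<in> vector_fields A \<Longrightarrow> smooth_fun A (\<lambda>p. g p (X p) (Y p))"
  using metric unfolding riemannian_metric_def by blast

definition gram :: "('a, 'e) chart \<Rightarrow> 'e \<Rightarrow> 'e \<Rightarrow> 'e \<Rightarrow> real" where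
  "gram c x u v = g (param c x) (tvec c (param c x) u) (tvec c (param c x) v)"

definition dgram :: "('a, 'e) chart \<Rightarrow> 'e \<Rightarrow> 'e \<Rightarrow> 'e \<Rightarrow> 'e \<Rightarrow> real" where
  "dgram c x w u v = frechet_derivative (\<lambda>x. gram c x u v) (at x) w"

lemma metric_eq_gram:
  assumes "c \<in> A" "p \<in> dom_of c" "v \<in> tangent_space A p" "w \<in> tangent_space A p"
  shows "g p v w = gram c (coord c p) (v c) (w c)"
  using assms by (simp add: gram_def tvec_component)

lemma gram_sym: "c \<in> A \<Longrightarrow> x \<in> img_of c \<Longrightarrow> gram c x u v = gram c x v u"
  unfolding gram_def by (intro metric_sym tvec_in_tangent_space param_in_dom)

lemma linear_gram_left:
  assumes "c \<in> A" "x \<in> img_of c"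
  shows "linear (\<lambda>u. gram c x u v)"
proof
  note p = assms(1) param_in_dom[OF assms]
  note t = tvec_in_tangent_space[OF p]
  show "gram c x (u1 + u2) v = gram c x u1 v + gram c x u2 v" for u1 u2
    unfolding gram_def tvec_add[OF p] by (rule metric_add_left[OF t t t])
  show "gram c x (r *\<^sub>R u) v = r *\<^sub>R gram c x u v" for r u
    unfolding gram_def tvec_scale[OF p] real_scaleR_def by (rule metric_scale_left[OF t t])
qed

lemma linear_gram_right:
  assumes "c \<in> A" "x \<in> img_of c"
  shows "linear (gram c x u)"
  using linear_gram_left[OF assms, of u] by (simp add: gram_sym[OF assms, of _ u])

lemma gram_pos:
  assumes "c \<in> A" "x \<in> img_of c" "u \<noteq> 0"
  shows "0 < gram c x u u"
proof -
  have "tvec c (param c x) u \<noteq> (\<lambda>c. 0)"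
    using assms tvec_apply[OF assms(1) param_in_dom[OF assms(1,2)], of u] by metis
  then show ?thesis
    unfolding gram_def by (rule metric_pos[OF tvec_in_tangent_space[OF assms(1) param_in_dom[OF assms(1,2)]]])
qed

lemma gram_nondegenerate:
  assumes "c \<in> A" "x \<in> img_of c" "\<And>w. gram c x u w = gram c x v w"
  shows "u = v"
proof (rule ccontr)
  assume "u \<noteq> v"
  then have "0 < gram c x (u - v) (u - v)" using gram_pos[OF assms(1,2)] by simp
  also have "gram c x (u - v) (u - v) = 0"
    using linear_diff[OF linear_gram_left[OF assms(1,2)], of u v] assms(3) by simp
  finally show False by simp
qed

lemma metric_nondegenerate:
  assumes "u \<in> tangent_space A p" "v \<in> tangent_space A p"
    and "\<And>w. w \<in> tangent_space A p \<Longrightarrow> g p u w = g p v w"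
  shows "u = v"
proof -
  obtain c where c: "c \<in> A" "p \<in> dom_of c" by (rule chart_exists)
  have "gram c (coord c p) (u c) w = gram c (coord c p) (v c) w" for w
    using assms(3)[OF tvec_in_tangent_space[OF c, of w]]
    by (simp add: metric_eq_gram[OF c] assms(1,2) tvec_in_tangent_space[OF c] c)
  then have "u c = v c" by (rule gram_nondegenerate[OF c(1) coord_in_img[OF c]])
  then show ?thesis by (rule tangent_space_eqI[OF assms(1,2) c])
qed

text \<open>Smoothness of the metric is assumed on global fields only, so near each point the
  constant vectors are replaced by global extensions.\<close>

lemma smooth_gram:
  assumes "c \<in> A"
  shows "smooth_on (img_of c) (\<lambda>x. gram c x u v)"
proof (rule smooth_on_local)
  fix x assume x: "x \<in> img_of c"
  note p = assms param_in_dom[OF assms x]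
  obtain U S where U: "U \<in> vector_fields A" "open S" "param c x \<in> S" "\<And>q. q \<in> S \<Longrightarrow> U q = tvec c q u"
    using constant_extension[OF p] by metis
  obtain V T where V: "V \<in> vector_fields A" "open T" "param c x \<in> T" "\<And>q. q \<in> T \<Longrightarrow> V q = tvec c q v"
    using constant_extension[OF p] by metis
  have o: "open (chart_preimage c (S \<inter> T))" using assms U V by (intro open_chart_preimage open_Int)
  have "smooth_on (chart_preimage c (S \<inter> T)) (\<lambda>x. gram c x u v)"
    by (rule smooth_on_cong[OF smooth_on_subset[OF smooth_funD[OF smooth_metric[OF U(1) V(1)] assms]] o])
       (auto simp: chart_preimage_def gram_def U V)
  then show "\<exists>T. open T \<and> x \<in> T \<and> smooth_on T (\<lambda>x. gram c x u v)"
    using o U V x by (auto simp: chart_preimage_def)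
qed

lemma smooth_gram_compose:
  assumes "c \<in> A" "smooth_on (img_of c) Y" "smooth_on (img_of c) Z"
  shows "smooth_on (img_of c) (\<lambda>x. gram c x (Y x) (Z x))"
  by (rule smooth_on_linear_family[OF open_img[OF assms(1)] linear_gram_left[OF assms(1)]
        smooth_on_linear_family[OF open_img[OF assms(1)] linear_gram_right[OF assms(1)]
          smooth_gram[OF assms(1)] assms(3)] assms(2)])

lemma linear_dgram1: "c \<in> A \<Longrightarrow> x \<in> img_of c \<Longrightarrow> linear (\<lambda>w. dgram c x w u v)"
  unfolding dgram_def by (rule smooth_onD(3)[OF smooth_gram])

lemma dgram_sym:
  assumes "c \<in> A" "x \<in> img_of c"
  shows "dgram c x w u v = dgram c x w v u"
  unfolding dgram_def
  using frechet_derivative_transform_within_open[OF smooth_onD(1)[OF smooth_gram[OF assms(1)] assms(2), of u v]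
      open_img[OF assms(1)] assms(2) gram_sym[OF assms(1)]]
  by (rule fun_cong)

lemma linear_dgram2:
  assumes c: "c \<in> A" and x: "x \<in> img_of c"
  shows "linear (\<lambda>u. dgram c x w u v)"
proof
  note D = smooth_onD(2)[OF smooth_gram[OF c] x]
  show "dgram c x w (u1 + u2) v = dgram c x w u1 v + dgram c x w u2 v" for u1 u2
  proof -
    have "((\<lambda>x. gram c x (u1 + u2) v) has_derivative
        (\<lambda>w. dgram c x w u1 v + dgram c x w u2 v)) (at x)"
      by (rule has_derivative_transform_within_open[OF has_derivative_add[OF D[of u1 v] D[of u2 v],
            folded dgram_def] open_img[OF c] x])
         (simp add: linear_add[OF linear_gram_left[OF c]])
    from frechet_derivative_at[OF this, symmetric] show ?thesis by (simp add: dgram_def)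
  qed
  show "dgram c x w (r *\<^sub>R u) v = r *\<^sub>R dgram c x w u v" for r u
  proof -
    have "((\<lambda>x. gram c x (r *\<^sub>R u) v) has_derivative (\<lambda>w. r *\<^sub>R dgram c x w u v)) (at x)"
      by (rule has_derivative_transform_within_open[OF has_derivative_scaleR_right[OF D[of u v],
            folded dgram_def] open_img[OF c] x])
         (simp add: linear_scale[OF linear_gram_left[OF c]])
    from frechet_derivative_at[OF this, symmetric] show ?thesis by (simp add: dgram_def)
  qed
qed

lemma linear_dgram3:
  assumes "c \<in> A" "x \<in> img_of c"
  shows "linear (dgram c x w u)"
  using linear_dgram2[OF assms, of w u] by (simp add: dgram_sym[OF assms, of w _ u])

lemma smooth_dgram:
  assumes c: "c \<in> A" and "smooth_on (img_of c) X" "smooth_on (img_of c) Y" "smooth_on (img_of c) Z"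
  shows "smooth_on (img_of c) (\<lambda>x. dgram c x (X x) (Y x) (Z x))"
proof -
  note S = open_img[OF c]
  have 1: "smooth_on (img_of c) (\<lambda>x. dgram c x w u v)" for w u v
    unfolding dgram_def by (rule smooth_onD(4)[OF smooth_gram[OF c]])
  have 2: "smooth_on (img_of c) (\<lambda>x. dgram c x w u (Z x))" for w u
    by (rule smooth_on_linear_family[OF S linear_dgram3[OF c] 1 assms(4)])
  have 3: "smooth_on (img_of c) (\<lambda>x. dgram c x w (Y x) (Z x))" for w
    by (rule smooth_on_linear_family[OF S linear_dgram2[OF c] 2 assms(3)])
  show ?thesis
    by (rule smooth_on_linear_family[OF S linear_dgram1[OF c] 3 assms(2)])
qed

text \<open>The base point moves along a map \<phi>, because the rule is used both for the identity
  and for a chart transition.\<close>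

lemma gram_has_derivative:
  fixes \<phi> :: "'d::euclidean_space \<Rightarrow> 'e"
  assumes c: "c \<in> A" and S: "open S" "x \<in> S" "\<phi> ` S \<subseteq> img_of c"
    and \<phi>: "(\<phi> has_derivative \<phi>') (at x)"
    and Y: "(Y has_derivative Y') (at x)" and Z: "(Z has_derivative Z') (at x)"
  shows "((\<lambda>x. gram c (\<phi> x) (Y x) (Z x)) has_derivative
    (\<lambda>w. dgram c (\<phi> x) (\<phi>' w) (Y x) (Z x) + gram c (\<phi> x) (Y x) (Z' w) + gram c (\<phi> x) (Y' w) (Z x)))
    (at x)"
proof -
  have img: "\<phi> y \<in> img_of c" if "y \<in> S" for y using that S by auto
  have 1: "((\<lambda>x. gram c (\<phi> x) u v) has_derivative (\<lambda>w. dgram c (\<phi> x) (\<phi>' w) u v)) (at x)" for u v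
    unfolding dgram_def
    by (rule has_derivative_compose[OF \<phi> smooth_onD(2)[OF smooth_gram[OF c] img[OF S(2)]]])
  have 2: "((\<lambda>x. gram c (\<phi> x) u (Z x)) has_derivative
      (\<lambda>w. dgram c (\<phi> x) (\<phi>' w) u (Z x) + gram c (\<phi> x) u (Z' w))) (at x)" for u
    using has_derivative_linear_family[OF S(1,2), of "\<lambda>x. gram c (\<phi> x) u", OF linear_gram_right[OF c img] _ Z]
      1[of u] frechet_derivative_at[OF 1[of u "Z x"], symmetric]
    by (auto simp: differentiable_def)
  show ?thesis
    using has_derivative_linear_family[OF S(1,2), of "\<lambda>x u. gram c (\<phi> x) u (Z x)", OF linear_gram_left[OF c img] _ Y]
      2 frechet_derivative_at[OF 2[of "Y x"], symmetric]
    by (auto simp: differentiable_def)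
qed

lemma gram_transition:
  assumes "c \<in> A" "d \<in> A" "x \<in> chart_preimage c (dom_of d)"
  shows "gram d (coord d (param c x)) (jac c d x u) (jac c d x v) = gram c x u v"
proof -
  have p: "param c x \<in> dom_of c" "param c x \<in> dom_of d" "x \<in> img_of c"
    using assms by (auto simp: chart_preimage_def param_in_dom)
  have "tvec d (param c x) (jac c d x u) = tvec c (param c x) u" for u
    by (rule tangent_space_eqI[OF tvec_in_tangent_space[OF assms(2) p(2)]
          tvec_in_tangent_space[OF assms(1) p(1)] assms(2) p(2)])
       (use assms p in \<open>simp add: tvec_def jac_self\<close>)
  then show ?thesis using assms p by (simp add: gram_def)
qed

text \<open>Nondegeneracy makes the representing vector at each point unique, so the smooth
  solutions found in the charts agree with the pointwise choice. Serves both the Levi-Civita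
  connection and the gradient.\<close>

lemma vector_field_riesz:
  assumes lin: "\<And>c x. c \<in> A \<Longrightarrow> x \<in> img_of c \<Longrightarrow> linear (\<lambda>u. \<alpha> (param c x) (tvec c (param c x) u))"
    and smooth: "\<And>c u. c \<in> A \<Longrightarrow> smooth_on (img_of c) (\<lambda>x. \<alpha> (param c x) (tvec c (param c x) u))"
  obtains Z where "Z \<in> vector_fields A"
    "\<And>p w. w \<in> tangent_space A p \<Longrightarrow> g p (Z p) w = \<alpha> p w"
proof -
  have local: "\<exists>v. smooth_on (img_of c) v \<and>
      (\<forall>x\<in>img_of c. \<forall>w. gram c x (v x) w = \<alpha> (param c x) (tvec c (param c x) w))" if "c \<in> A" for c
    using smooth_riesz[OF open_img[OF that] linear_gram_left[OF that] gram_sym[OF that]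
        gram_pos[OF that] smooth_gram[OF that] lin[OF that] smooth[OF that]] by metis
  have "\<exists>z. z \<in> tangent_space A p \<and> (\<forall>w\<in>tangent_space A p. g p z w = \<alpha> p w)" for p
  proof -
    obtain c where c: "c \<in> A" "p \<in> dom_of c" by (rule chart_exists)
    obtain v where v: "\<And>x w. x \<in> img_of c \<Longrightarrow> gram c x (v x) w = \<alpha> (param c x) (tvec c (param c x) w)"
      using local[OF c(1)] by blast
    show ?thesis
    proof (intro exI[where x = "tvec c p (v (coord c p))"] conjI ballI)
      fix w assume w: "w \<in> tangent_space A p"
      then show "g p (tvec c p (v (coord c p))) w = \<alpha> p w"
        using v[OF coord_in_img[OF c], of "w c"]
        by (simp add: metric_eq_gram[OF c] tvec_in_tangent_space[OF c] c tvec_component[OF w c])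
    qed (rule tvec_in_tangent_space[OF c])
  qed
  then obtain Z where Z: "\<And>p. Z p \<in> tangent_space A p"
    "\<And>p w. w \<in> tangent_space A p \<Longrightarrow> g p (Z p) w = \<alpha> p w" by metis
  have "Z \<in> vector_fields A"
    unfolding vector_fields_def mem_Collect_eq
  proof (intro conjI allI ballI Z(1))
    fix c assume c: "c \<in> A"
    obtain v where v: "smooth_on (img_of c) v"
      "\<And>x w. x \<in> img_of c \<Longrightarrow> gram c x (v x) w = \<alpha> (param c x) (tvec c (param c x) w)"
      using local[OF c] by blast
    show "smooth_on (img_of c) (\<lambda>x. Z (param c x) c)"
    proof (rule smooth_on_cong[OF v(1) open_img[OF c]])
      fix x assume x: "x \<in> img_of c"
      note p = c param_in_dom[OF c x]
      show "v x = Z (param c x) c"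
      proof (rule gram_nondegenerate[OF c x])
        fix w
        have "gram c x (Z (param c x) c) w = g (param c x) (Z (param c x)) (tvec c (param c x) w)"
          using c x by (simp add: metric_eq_gram[OF p Z(1) tvec_in_tangent_space[OF p]] p)
        also have "\<dots> = gram c x (v x) w" by (simp add: Z(2) tvec_in_tangent_space[OF p] v(2)[OF x])
        finally show "gram c x (v x) w = gram c x (Z (param c x) c) w" by simp
      qed
    qed
  qed
  then show ?thesis using Z(2) that by blast
qed

section \<open>Existence of the Levi-Civita connection\<close>

text \<open>The value that g(D X Y, w) must have in the chart c: the derivative of the components of
  Y plus the Christoffel symbols of the first kind.\<close>

definition koszul :: "('a, 'e) vfield \<Rightarrow> ('a, 'e) vfield \<Rightarrow> ('a, 'e) chart \<Rightarrow> 'e \<Rightarrow> 'e \<Rightarrow> real" where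
  "koszul X Y c x w =
     gram c x (frechet_derivative (\<lambda>x. Y (param c x) c) (at x) (X (param c x) c)) w +
     (dgram c x (X (param c x) c) (Y (param c x) c) w +
      dgram c x (Y (param c x) c) (X (param c x) c) w -
      dgram c x w (X (param c x) c) (Y (param c x) c)) / 2"

text \<open>Differentiates \<open>gram_transition\<close>. The two terms with second derivatives of
  the transition are the failure of the metric derivatives to be tensorial.\<close>

lemma dgram_transition:
  assumes c: "c \<in> A" and d: "d \<in> A" and x: "x \<in> chart_preimage c (dom_of d)"
  shows "dgram c x w u v =
    dgram d (coord d (param c x)) (jac c d x w) (jac c d x u) (jac c d x v) +
    gram d (coord d (param c x)) (jac c d x u) (frechet_derivative (\<lambda>x. jac c d x v) (at x) w) +
    gram d (coord d (param c x)) (frechet_derivative (\<lambda>x. jac c d x u) (at x) w) (jac c d x v)"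
proof -
  let ?S = "chart_preimage c (dom_of d)"
  have S: "open ?S" using c d by (intro open_chart_preimage open_dom)
  have sub: "(\<lambda>x. coord d (param c x)) ` ?S \<subseteq> img_of d"
    using d by (auto simp: chart_preimage_def coord_in_img)
  note J = smooth_onD(2)[OF smooth_jac[OF c d] x]
  have "((\<lambda>x. gram c x u v) has_derivative
    (\<lambda>w. dgram d (coord d (param c x)) (jac c d x w) (jac c d x u) (jac c d x v) +
    gram d (coord d (param c x)) (jac c d x u) (frechet_derivative (\<lambda>x. jac c d x v) (at x) w) +
    gram d (coord d (param c x)) (frechet_derivative (\<lambda>x. jac c d x u) (at x) w) (jac c d x v))) (at x)"
    by (rule has_derivative_transform_within_open[OF gram_has_derivative[OF d S x sub
          transition_has_derivative[OF c d x] J J] S x]) (rule gram_transition[OF c d])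
  from frechet_derivative_at[OF this, symmetric] show ?thesis by (simp add: dgram_def[of c])
qed

lemma jac_derivative_symmetric:
  assumes c: "c \<in> A" and d: "d \<in> A" and x: "x \<in> chart_preimage c (dom_of d)"
  shows "frechet_derivative (\<lambda>x. jac c d x u) (at x) v = frechet_derivative (\<lambda>x. jac c d x v) (at x) u"
  using second_derivative_symmetric[OF open_chart_preimage[OF c open_dom[OF d]] smooth_transition[OF c d] x, of u v]
  by (simp add: jac_def comp_def)

text \<open>The rule that the d-components are the Jacobian times the c-components, differentiated
  twice over: by the chain rule for the left side and by the product rule for the right.\<close>

lemma vector_field_derivative_transition:
  assumes c: "c \<in> A" and d: "d \<in> A" and x: "x \<in> chart_preimage c (dom_of d)" and Y: "Y \<in> vector_fields A"
  shows "frechet_derivative (\<lambda>x. Y (param d x) d) (at (coord d (param c x))) (jac c d x w) =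
    frechet_derivative (\<lambda>x. jac c d x (Y (param c x) c)) (at x) w" (is ?th1)
    and "frechet_derivative (\<lambda>y. jac c d y (Y (param c y) c)) (at x) w =
    frechet_derivative (\<lambda>y. jac c d y (Y (param c x) c)) (at x) w +
    jac c d x (frechet_derivative (\<lambda>x. Y (param c x) c) (at x) w)" (is ?th2)
proof -
  let ?S = "chart_preimage c (dom_of d)"
  have S: "open ?S" using c d by (intro open_chart_preimage open_dom)
  have p: "param c x \<in> dom_of c" "param c x \<in> dom_of d" "x \<in> img_of c"
    using c x by (auto simp: chart_preimage_def param_in_dom)
  have 1: "((\<lambda>y. jac c d y (Y (param c y) c)) has_derivative
      (\<lambda>w. frechet_derivative (\<lambda>y. jac c d y (Y (param c x) c)) (at x) w +
      jac c d x (frechet_derivative (\<lambda>x. Y (param c x) c) (at x) w))) (at x)"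
    by (rule has_derivative_linear_family[OF S x linear_jac[OF c d] smooth_onD(1)[OF smooth_jac[OF c d] x]
          smooth_onD(2)[OF vector_fieldD(2)[OF Y c] p(3)]])
  show ?th2 using frechet_derivative_at[OF 1, symmetric] by simp
  have 2: "((\<lambda>x. Y (param d (coord d (param c x))) d) has_derivative
      (\<lambda>w. frechet_derivative (\<lambda>x. Y (param d x) d) (at (coord d (param c x))) (jac c d x w))) (at x)"
    by (rule has_derivative_compose[OF transition_has_derivative[OF c d x]
          smooth_onD(2)[OF vector_fieldD(2)[OF Y d] coord_in_img[OF d p(2)]]])
  have 3: "((\<lambda>y. jac c d y (Y (param c y) c)) has_derivative
      (\<lambda>w. frechet_derivative (\<lambda>x. Y (param d x) d) (at (coord d (param c x))) (jac c d x w))) (at x)"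
  proof (rule has_derivative_transform_within_open[OF 2 S x])
    fix y assume "y \<in> ?S"
    then have "param c y \<in> dom_of c" "param c y \<in> dom_of d" "y \<in> img_of c"
      using c by (auto simp: chart_preimage_def param_in_dom)
    then show "Y (param d (coord d (param c y))) d = jac c d y (Y (param c y) c)"
      using tangent_spaceD[OF vector_fieldD(1)[OF Y] c d] c d by simp
  qed
  show ?th1 using frechet_derivative_at[OF 3] by (rule fun_cong)
qed

text \<open>Let H be the second derivative of the transition. The three metric derivatives yield six
  terms in H; by symmetry of H four cancel and two add up, and half of their sum is the g-product of
  H u v with J z. This is exactly the non-tensorial term in the derivative of Y.\<close>

lemma koszul_chart_independent:
  assumes c: "c \<in> A" "p \<in> dom_of c" and d: "d \<in> A" "p \<in> dom_of d"
    and X: "X \<in> vector_fields A" and Y: "Y \<in> vector_fields A" and w: "w \<in> tangent_space A p"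
  shows "koszul X Y c (coord c p) (w c) = koszul X Y d (coord d p) (w d)"
proof -
  let ?x = "coord c p" and ?y = "coord d p"
  have x: "?x \<in> chart_preimage c (dom_of d)" using c d by (simp add: coord_in_preimage)
  have y: "?y \<in> img_of d" using d by (simp add: coord_in_img)
  define J where "J = jac c d ?x"
  define H where "H a b = frechet_derivative (\<lambda>x. jac c d x b) (at ?x) a" for a b
  define u where "u = X p c"
  define v where "v = Y p c"
  define z where "z = w c"
  define E where "E = frechet_derivative (\<lambda>x. Y (param c x) c) (at ?x) u"
  have comp: "X p d = J u" "Y p d = J v" "w d = J z"
    using tangent_spaceD[OF vector_fieldD(1)[OF X] c(1) d(1) c(2) d(2)]
      tangent_spaceD[OF vector_fieldD(1)[OF Y] c(1) d(1) c(2) d(2)]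
      tangent_spaceD[OF w c(1) d(1) c(2) d(2)]
    by (simp_all add: J_def u_def v_def z_def)
  have dY: "frechet_derivative (\<lambda>x. Y (param d x) d) (at ?y) (J u) = H u v + J E"
    using vector_field_derivative_transition[OF c(1) d(1) x Y, of u] c
    by (simp add: J_def H_def E_def v_def)
  have dg: "dgram c ?x a b e = dgram d ?y (J a) (J b) (J e) + gram d ?y (J b) (H a e) + gram d ?y (H a b) (J e)"
    for a b e
    using dgram_transition[OF c(1) d(1) x] c(2) c(1) by (simp add: J_def H_def)
  have gr: "gram c ?x a b = gram d ?y (J a) (J b)" for a b
    using gram_transition[OF c(1) d(1) x] c by (simp add: J_def)
  have H: "H a b = H b a" for a b
    using jac_derivative_symmetric[OF c(1) d(1) x] by (simp add: H_def)
  have "koszul X Y c ?x z = gram d ?y (J E) (J z) +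
    (dgram c ?x u v z + dgram c ?x v u z - dgram c ?x z u v) / 2"
    using c by (simp add: koszul_def gr E_def u_def v_def)
  also have "\<dots> = gram d ?y (J E) (J z) + gram d ?y (H u v) (J z) +
    (dgram d ?y (J u) (J v) (J z) + dgram d ?y (J v) (J u) (J z) - dgram d ?y (J z) (J u) (J v)) / 2"
    unfolding dg H[of v u] H[of z u] H[of z v] gram_sym[OF d(1) y, of "J v" "H u z"]
      gram_sym[OF d(1) y, of "J u" "H v z"]
    by argo
  also have "\<dots> = koszul X Y d ?y (w d)"
    using d by (simp add: koszul_def comp dY linear_add[OF linear_gram_left[OF d(1) y]])
  finally show ?thesis by (simp add: z_def)
qed

lemma linear_koszul:
  assumes "c \<in> A" "x \<in> img_of c"
  shows "linear (koszul X Y c x)"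
  by (rule linearI; simp add: koszul_def linear_add[OF linear_gram_right[OF assms]]
      linear_scale[OF linear_gram_right[OF assms]] linear_add[OF linear_dgram3[OF assms]]
      linear_scale[OF linear_dgram3[OF assms]] linear_add[OF linear_dgram1[OF assms]]
      linear_scale[OF linear_dgram1[OF assms]] field_simps)

lemma smooth_koszul:
  assumes c: "c \<in> A" and X: "X \<in> vector_fields A" and Y: "Y \<in> vector_fields A"
  shows "smooth_on (img_of c) (\<lambda>x. koszul X Y c x w)"
proof -
  note S = open_img[OF c]
  note s = vector_fieldD(2)[OF X c] vector_fieldD(2)[OF Y c] smooth_on_const[OF S]
  have "smooth_on (img_of c) (\<lambda>x. frechet_derivative (\<lambda>x. Y (param c x) c) (at x) (X (param c x) c))"
    by (rule smooth_on_linear_family[OF S smooth_onD(3)[OF s(2)] smooth_onD(4)[OF s(2)] s(1)])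
  then show ?thesis
    unfolding koszul_def divide_inverse
    by (intro smooth_on_add smooth_on_diff smooth_on_mult smooth_gram_compose smooth_dgram c S s)
qed

lemma koszul_represented:
  assumes X: "X \<in> vector_fields A" and Y: "Y \<in> vector_fields A"
  shows "\<exists>Z\<in>vector_fields A. \<forall>c\<in>A. \<forall>p\<in>dom_of c. \<forall>w\<in>tangent_space A p.
    g p (Z p) w = koszul X Y c (coord c p) (w c)"
proof -
  define \<alpha> where "\<alpha> p w = koszul X Y (chart_at A p) (coord (chart_at A p) p) (w (chart_at A p))" for p w
  have \<alpha>: "\<alpha> p w = koszul X Y c (coord c p) (w c)" if "c \<in> A" "p \<in> dom_of c" "w \<in> tangent_space A p" for c p w
    unfolding \<alpha>_def by (rule koszul_chart_independent[OF chart_at that(1,2) X Y that(3)])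
  have \<alpha>': "\<alpha> (param c x) (tvec c (param c x) u) = koszul X Y c x u" if "c \<in> A" "x \<in> img_of c" for c x u
    using \<alpha>[OF that(1) param_in_dom[OF that] tvec_in_tangent_space[OF that(1) param_in_dom[OF that]]] that
    by (simp add: param_in_dom)
  have lin: "linear (\<lambda>u. \<alpha> (param c x) (tvec c (param c x) u))" if "c \<in> A" "x \<in> img_of c" for c x
    using linear_koszul[OF that] by (simp add: \<alpha>'[OF that])
  have smooth: "smooth_on (img_of c) (\<lambda>x. \<alpha> (param c x) (tvec c (param c x) u))" if "c \<in> A" for c u
    by (rule smooth_on_cong[OF smooth_koszul[OF that X Y] open_img[OF that]]) (simp add: \<alpha>'[OF that])
  from vector_field_riesz[OF lin smooth] obtain Z where "Z \<in> vector_fields A"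
    "\<And>p w. w \<in> tangent_space A p \<Longrightarrow> g p (Z p) w = \<alpha> p w" by blast
  then show ?thesis using \<alpha> by (metis (no_types, lifting))
qed

text \<open>The representing field is unique by \<open>metric_nondegenerate\<close>;
  \<open>lc_eqI\<close> turns this into the means of verifying every law of a connection.\<close>

definition lc :: "('a, 'e) conn" where
  "lc X Y = (SOME Z. Z \<in> vector_fields A \<and> (\<forall>c\<in>A. \<forall>p\<in>dom_of c. \<forall>w\<in>tangent_space A p.
    g p (Z p) w = koszul X Y c (coord c p) (w c)))"

lemma
  assumes X: "X \<in> vector_fields A" and Y: "Y \<in> vector_fields A"
  shows lc_in: "lc X Y \<in> vector_fields A"
    and metric_lc: "\<lbrakk>c \<in> A; p \<in> dom_of c; w \<in> tangent_space A p\<rbrakk> \<Longrightarrow>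
      g p (lc X Y p) w = koszul X Y c (coord c p) (w c)"
proof -
  have "lc X Y \<in> vector_fields A \<and> (\<forall>c\<in>A. \<forall>p\<in>dom_of c. \<forall>w\<in>tangent_space A p.
    g p (lc X Y p) w = koszul X Y c (coord c p) (w c))"
    unfolding lc_def using koszul_represented[OF X Y] by (intro someI_ex[of "\<lambda>Z. Z \<in> _ \<and> _ Z"]) blast
  then show "lc X Y \<in> vector_fields A"
    "\<lbrakk>c \<in> A; p \<in> dom_of c; w \<in> tangent_space A p\<rbrakk> \<Longrightarrow> g p (lc X Y p) w = koszul X Y c (coord c p) (w c)"
    by blast+
qed

end

section \<open>Linearity and Leibniz rules for derivatives along fields\<close>

context smooth_manifold
begin

lemma tangent_deriv_smooth_chart:
  assumes "c \<in> A" "p \<in> dom_of c" "v \<in> tangent_space A p" "smooth_fun A h"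
  shows "tangent_deriv A p v h = frechet_derivative (\<lambda>x. h (param c x)) (at (coord c p)) (v c)"
  by (rule tangent_deriv_chart[OF assms(1-3) smooth_onD(1)[OF smooth_funD[OF assms(4,1)]
        coord_in_img[OF assms(1,2)]]])

lemma
  assumes "v \<in> tangent_space A p" "smooth_fun A h"
  shows tangent_deriv_add: "w \<in> tangent_space A p \<Longrightarrow>
      tangent_deriv A p (\<lambda>c. v c + w c) h = tangent_deriv A p v h + tangent_deriv A p w h"
    and tangent_deriv_scale: "tangent_deriv A p (\<lambda>c. r *\<^sub>R v c) h = r * tangent_deriv A p v h"
proof -
  obtain c where c: "c \<in> A" "p \<in> dom_of c" by (rule chart_exists)
  note lin = smooth_onD(3)[OF smooth_funD[OF assms(2) c(1)] coord_in_img[OF c]]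
  note chart = tangent_deriv_smooth_chart[OF c _ assms(2)]
  show "tangent_deriv A p (\<lambda>c. v c + w c) h = tangent_deriv A p v h + tangent_deriv A p w h"
    if "w \<in> tangent_space A p"
    by (simp add: chart assms(1) that tangent_space_add linear_add[OF lin])
  show "tangent_deriv A p (\<lambda>c. r *\<^sub>R v c) h = r * tangent_deriv A p v h"
    by (simp add: chart assms(1) tangent_space_scale linear_scale[OF lin])
qed

lemma frechet_vf_add:
  assumes "Y \<in> vector_fields A" "Y' \<in> vector_fields A" "c \<in> A" "x \<in> img_of c"
  shows "frechet_derivative (\<lambda>x. vf_add Y Y' (param c x) c) (at x) w =
    frechet_derivative (\<lambda>x. Y (param c x) c) (at x) w + frechet_derivative (\<lambda>x. Y' (param c x) c) (at x) w"
  unfolding vf_add_def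
  using frechet_derivative_at[OF has_derivative_add[OF smooth_onD(2)[OF vector_fieldD(2)[OF assms(1,3)] assms(4)]
        smooth_onD(2)[OF vector_fieldD(2)[OF assms(2,3)] assms(4)]], symmetric]
  by (rule fun_cong)

lemma frechet_vf_scale:
  assumes "Y \<in> vector_fields A" "smooth_fun A h" "c \<in> A" "x \<in> img_of c"
  shows "frechet_derivative (\<lambda>x. vf_scale h Y (param c x) c) (at x) w =
    h (param c x) *\<^sub>R frechet_derivative (\<lambda>x. Y (param c x) c) (at x) w +
    frechet_derivative (\<lambda>x. h (param c x)) (at x) w *\<^sub>R Y (param c x) c"
  unfolding vf_scale_def
  using frechet_derivative_at[OF has_derivative_scaleR[OF smooth_onD(2)[OF smooth_funD[OF assms(2,3)] assms(4)]
        smooth_onD(2)[OF vector_fieldD(2)[OF assms(1,3)] assms(4)]], symmetric]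
  by (rule fun_cong)

end

context riemannian_manifold
begin

lemma metric_vf_add:
  assumes "X \<in> vector_fields A" "Y \<in> vector_fields A" "w \<in> tangent_space A p"
  shows "g p (vf_add X Y p) w = g p (X p) w + g p (Y p) w"
  unfolding vf_add_def using metric_add_left assms vector_fieldD(1) by blast

lemma metric_vf_scale:
  assumes "X \<in> vector_fields A" "w \<in> tangent_space A p"
  shows "g p (vf_scale h X p) w = h p * g p (X p) w"
  unfolding vf_scale_def using metric_scale_left assms vector_fieldD(1) by blast

lemma lc_eqI:
  assumes "X \<in> vector_fields A" "Y \<in> vector_fields A" "Z \<in> vector_fields A"
    and "\<And>c p w. \<lbrakk>c \<in> A; p \<in> dom_of c; w \<in> tangent_space A p\<rbrakk> \<Longrightarrow>
      g p (Z p) w = koszul X Y c (coord c p) (w c)"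
  shows "lc X Y = Z"
proof
  fix p
  obtain c where c: "c \<in> A" "p \<in> dom_of c" by (rule chart_exists)
  show "lc X Y p = Z p"
    by (rule metric_nondegenerate[OF vector_fieldD(1)[OF lc_in[OF assms(1,2)]] vector_fieldD(1)[OF assms(3)]])
       (simp add: metric_lc[OF assms(1,2) c] assms(4)[OF c])
qed

text \<open>Paired with a vector w, each law becomes an identity between values of
  \<open>koszul\<close>. In the Leibniz law the extra term arises from the derivative of h in the
  components of h Y.\<close>

lemma affine_lc: "affine_connection A lc"
  unfolding affine_connection_def
proof (intro conjI ballI allI impI)
  fix X Y assume X: "X \<in> vector_fields A" and Y: "Y \<in> vector_fields A"
  show "lc X Y \<in> vector_fields A" by (rule lc_in[OF X Y])
  show "lc (vf_add X X') Y = vf_add (lc X Y) (lc X' Y)" if X': "X' \<in> vector_fields A" for X'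
  proof (rule lc_eqI[OF vf_add_in[OF X X'] Y vf_add_in[OF lc_in[OF X Y] lc_in[OF X' Y]]])
    fix c p w assume c: "c \<in> A" "p \<in> dom_of c" and w: "w \<in> tangent_space A p"
    note x = c(1) coord_in_img[OF c]
    show "g p (vf_add (lc X Y) (lc X' Y) p) w = koszul (vf_add X X') Y c (coord c p) (w c)"
      unfolding metric_vf_add[OF lc_in[OF X Y] lc_in[OF X' Y] w] metric_lc[OF X Y c w] metric_lc[OF X' Y c w]
      by (simp add: koszul_def vf_add_def linear_add[OF smooth_onD(3)[OF vector_fieldD(2)[OF Y c(1)] x(2)]]
          linear_add[OF linear_gram_left[OF x]] linear_add[OF linear_dgram1[OF x]]
          linear_add[OF linear_dgram2[OF x]] linear_add[OF linear_dgram3[OF x]] field_simps)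
  qed
  show "lc (vf_scale h X) Y = vf_scale h (lc X Y)" if h: "smooth_fun A h" for h
  proof (rule lc_eqI[OF vf_scale_in[OF h X] Y vf_scale_in[OF h lc_in[OF X Y]]])
    fix c p w assume c: "c \<in> A" "p \<in> dom_of c" and w: "w \<in> tangent_space A p"
    note x = c(1) coord_in_img[OF c]
    show "g p (vf_scale h (lc X Y) p) w = koszul (vf_scale h X) Y c (coord c p) (w c)"
      unfolding metric_vf_scale[OF lc_in[OF X Y] w] metric_lc[OF X Y c w]
      using c
      by (simp add: koszul_def vf_scale_def linear_scale[OF smooth_onD(3)[OF vector_fieldD(2)[OF Y c(1)] x(2)]]
          linear_scale[OF linear_gram_left[OF x]] linear_scale[OF linear_dgram1[OF x]]
          linear_scale[OF linear_dgram2[OF x]] linear_scale[OF linear_dgram3[OF x]] field_simps)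
  qed
  show "lc X (vf_add Y Y') = vf_add (lc X Y) (lc X Y')" if Y': "Y' \<in> vector_fields A" for Y'
  proof (rule lc_eqI[OF X vf_add_in[OF Y Y'] vf_add_in[OF lc_in[OF X Y] lc_in[OF X Y']]])
    fix c p w assume c: "c \<in> A" "p \<in> dom_of c" and w: "w \<in> tangent_space A p"
    note x = c(1) coord_in_img[OF c]
    show "g p (vf_add (lc X Y) (lc X Y') p) w = koszul X (vf_add Y Y') c (coord c p) (w c)"
      unfolding metric_vf_add[OF lc_in[OF X Y] lc_in[OF X Y'] w] metric_lc[OF X Y c w] metric_lc[OF X Y' c w]
        koszul_def frechet_vf_add[OF Y Y' x]
      by (simp add: vf_add_def linear_add[OF linear_gram_left[OF x]] linear_add[OF linear_dgram1[OF x]]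
          linear_add[OF linear_dgram2[OF x]] linear_add[OF linear_dgram3[OF x]] field_simps)
  qed
  show "lc X (vf_scale h Y) = vf_add (vf_scale (vf_apply A X h) Y) (vf_scale h (lc X Y))"
    if h: "smooth_fun A h" for h
  proof -
    have Xh: "smooth_fun A (vf_apply A X h)" by (rule smooth_fun_vf_apply[OF X h])
    note in1 = vf_scale_in[OF Xh Y] and in2 = vf_scale_in[OF h lc_in[OF X Y]]
    show ?thesis
    proof (rule lc_eqI[OF X vf_scale_in[OF h Y] vf_add_in[OF in1 in2]])
      fix c p w assume c: "c \<in> A" "p \<in> dom_of c" and w: "w \<in> tangent_space A p"
      note x = c(1) coord_in_img[OF c]
      have Xhp: "vf_apply A X h p = frechet_derivative (\<lambda>x. h (param c x)) (at (coord c p)) (X p c)"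
        using vf_apply_chart[OF x X h] c by simp
      show "g p (vf_add (vf_scale (vf_apply A X h) Y) (vf_scale h (lc X Y)) p) w =
          koszul X (vf_scale h Y) c (coord c p) (w c)"
        unfolding metric_vf_add[OF in1 in2 w] metric_vf_scale[OF Y w] metric_vf_scale[OF lc_in[OF X Y] w]
          metric_lc[OF X Y c w] metric_eq_gram[OF c vector_fieldD(1)[OF Y] w]
          koszul_def frechet_vf_scale[OF Y h x] Xhp
        using c
        by (simp add: vf_scale_def linear_add[OF linear_gram_left[OF x]]
            linear_scale[OF linear_gram_left[OF x]] linear_scale[OF linear_dgram1[OF x]]
            linear_scale[OF linear_dgram2[OF x]] linear_scale[OF linear_dgram3[OF x]] field_simps)
    qed
  qed
qed

text \<open>The Christoffel part of \<open>koszul\<close> is symmetric in X and Y, so only the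
  derivatives of the components survive.\<close>

lemma lc_antisymmetrized:
  assumes X: "X \<in> vector_fields A" and Y: "Y \<in> vector_fields A" and c: "c \<in> A" "p \<in> dom_of c"
  shows "lc X Y p c - lc Y X p c =
    frechet_derivative (\<lambda>x. Y (param c x) c) (at (coord c p)) (X p c) -
    frechet_derivative (\<lambda>x. X (param c x) c) (at (coord c p)) (Y p c)"
proof (rule gram_nondegenerate[OF c(1) coord_in_img[OF c]])
  fix w
  note x = c(1) coord_in_img[OF c]
  note diff = linear_diff[OF linear_gram_left[OF x]]
  have "gram c (coord c p) (lc X Y p c) w = koszul X Y c (coord c p) w"
    if "X \<in> vector_fields A" "Y \<in> vector_fields A" for X Y
    using metric_lc[OF that c tvec_in_tangent_space[OF c], of w] c
    by (simp add: metric_eq_gram[OF c] vector_fieldD(1)[OF lc_in[OF that]] tvec_in_tangent_space[OF c])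
  then show "gram c (coord c p) (lc X Y p c - lc Y X p c) w =
    gram c (coord c p) (frechet_derivative (\<lambda>x. Y (param c x) c) (at (coord c p)) (X p c) -
    frechet_derivative (\<lambda>x. X (param c x) c) (at (coord c p)) (Y p c)) w"
    unfolding diff using X Y c dgram_sym[OF x, of w "X p c" "Y p c"] by (simp add: koszul_def)
qed

lemma torsion_free_lc: "torsion_free A lc"
  unfolding torsion_free_def
proof (intro ballI allI impI)
  fix X Y h p assume X: "X \<in> vector_fields A" and Y: "Y \<in> vector_fields A" and h: "smooth_fun A h"
  obtain c where c: "c \<in> A" "p \<in> dom_of c" by (rule chart_exists)
  note x = c(1) coord_in_img[OF c]
  let ?D = "frechet_derivative (\<lambda>x. h (param c x)) (at (coord c p))"
  have lin: "linear ?D" by (rule smooth_onD(3)[OF smooth_funD[OF h c(1)] x(2)])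
  have "vf_apply A (lc X Y) h p - vf_apply A (lc Y X) h p = ?D (lc X Y p c - lc Y X p c)"
    using vf_apply_chart[OF x lc_in[OF X Y] h] vf_apply_chart[OF x lc_in[OF Y X] h] c
    by (simp add: linear_diff[OF lin])
  also have "\<dots> = ?D (frechet_derivative (\<lambda>x. Y (param c x) c) (at (coord c p)) (X p c)) -
    ?D (frechet_derivative (\<lambda>x. X (param c x) c) (at (coord c p)) (Y p c))"
    unfolding lc_antisymmetrized[OF X Y c] by (rule linear_diff[OF lin])
  \<comment> \<open>The second derivatives of h in the two iterated derivatives are equal by
    symmetry and drop out.\<close>
  also have "\<dots> = vf_apply A X (vf_apply A Y h) p - vf_apply A Y (vf_apply A X h) p"
    using vf_apply_vf_apply_chart[OF x X Y h] vf_apply_vf_apply_chart[OF x Y X h] c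
      second_derivative_symmetric[OF open_img[OF c(1)] smooth_funD[OF h c(1)] x(2), of "X p c" "Y p c"]
    by simp
  finally show "vf_apply A (lc X Y) h p - vf_apply A (lc Y X) h p =
    vf_apply A X (vf_apply A Y h) p - vf_apply A Y (vf_apply A X h) p" .
qed

lemma metric_compatible_lc: "metric_compatible A g lc"
  unfolding metric_compatible_def
proof (intro ballI allI)
  fix X Y Z p
  assume X: "X \<in> vector_fields A" and Y: "Y \<in> vector_fields A" and Z: "Z \<in> vector_fields A"
  obtain c where c: "c \<in> A" "p \<in> dom_of c" by (rule chart_exists)
  note x = c(1) coord_in_img[OF c]
  let ?x = "coord c p"
  let ?dY = "frechet_derivative (\<lambda>x. Y (param c x) c) (at ?x) (X p c)"
  let ?dZ = "frechet_derivative (\<lambda>x. Z (param c x) c) (at ?x) (X p c)"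
  have D: "((\<lambda>x. gram c x (Y (param c x) c) (Z (param c x) c)) has_derivative
    (\<lambda>w. dgram c ?x w (Y (param c ?x) c) (Z (param c ?x) c) +
      gram c ?x (Y (param c ?x) c) (frechet_derivative (\<lambda>x. Z (param c x) c) (at ?x) w) +
      gram c ?x (frechet_derivative (\<lambda>x. Y (param c x) c) (at ?x) w) (Z (param c ?x) c))) (at ?x)"
    by (rule gram_has_derivative[OF c(1) open_img[OF c(1)] x(2) _ has_derivative_ident
          smooth_onD(2)[OF vector_fieldD(2)[OF Y c(1)] x(2)] smooth_onD(2)[OF vector_fieldD(2)[OF Z c(1)] x(2)]])
       simp
  have E: "((\<lambda>x. g (param c x) (Y (param c x)) (Z (param c x))) has_derivative
    (\<lambda>w. dgram c ?x w (Y (param c ?x) c) (Z (param c ?x) c) +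
      gram c ?x (Y (param c ?x) c) (frechet_derivative (\<lambda>x. Z (param c x) c) (at ?x) w) +
      gram c ?x (frechet_derivative (\<lambda>x. Y (param c x) c) (at ?x) w) (Z (param c ?x) c))) (at ?x)"
    by (rule has_derivative_transform_within_open[OF D open_img[OF c(1)] x(2)])
       (use c in \<open>simp add: metric_eq_gram[OF c(1) param_in_dom vector_fieldD(1)[OF Y] vector_fieldD(1)[OF Z]]\<close>)
  have "vf_apply A X (\<lambda>q. g q (Y q) (Z q)) p =
      dgram c ?x (X p c) (Y p c) (Z p c) + gram c ?x (Y p c) ?dZ + gram c ?x ?dY (Z p c)"
    using vf_apply_chart[OF x X smooth_metric[OF Y Z]] c by (simp add: frechet_derivative_at[OF E, symmetric])
  \<comment> \<open>Exchanging Y and Z reverses the sign of the last two halved terms, so they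
    cancel, while the two halves of the derivative along X add up.\<close>
  also have "\<dots> = koszul X Y c ?x (Z p c) + koszul X Z c ?x (Y p c)"
    using c dgram_sym[OF x, of "X p c" "Y p c" "Z p c"] dgram_sym[OF x, of "Y p c" "X p c" "Z p c"]
      dgram_sym[OF x, of "Z p c" "X p c" "Y p c"] gram_sym[OF x, of "Y p c" ?dZ]
    by (simp add: koszul_def field_simps)
  also have "\<dots> = g p (lc X Y p) (Z p) + g p (Y p) (lc X Z p)"
    by (simp add: metric_lc[OF X Y c vector_fieldD(1)[OF Z]] metric_lc[OF X Z c vector_fieldD(1)[OF Y]]
        metric_sym[OF vector_fieldD(1)[OF Y] vector_fieldD(1)[OF lc_in[OF X Z]]])
  finally show "vf_apply A X (\<lambda>q. g q (Y q) (Z q)) p = g p (lc X Y p) (Z p) + g p (Y p) (lc X Z p)" .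
qed

section \<open>Uniqueness of the Levi-Civita connection\<close>

lemma affine_in:
  "affine_connection A D \<Longrightarrow> X \<in> vector_fields A \<Longrightarrow> Y \<in> vector_fields A \<Longrightarrow> D X Y \<in> vector_fields A"
  unfolding affine_connection_def by blast

text \<open>The difference of two metric torsion-free connections is a trilinear form that is symmetric
  in its first two and antisymmetric in its last two arguments, hence zero.\<close>

lemma levi_civita_unique:
  assumes D: "affine_connection A D" "torsion_free A D" "metric_compatible A g D"
    and E: "affine_connection A E" "torsion_free A E" "metric_compatible A g E"
    and X: "X \<in> vector_fields A" and Y: "Y \<in> vector_fields A"
  shows "D X Y = E X Y"
proof
  fix p
  define T where "T X Y Z = g p (D X Y p) (Z p) - g p (E X Y p) (Z p)" for X Y Z
  note V = vector_fieldD(1)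
  have sym: "T X Y Z = T Y X Z"
    if X: "X \<in> vector_fields A" and Y: "Y \<in> vector_fields A" and Z: "Z \<in> vector_fields A" for X Y Z
  proof -
    note i = V[OF affine_in[OF D(1) X Y], of p] V[OF affine_in[OF D(1) Y X], of p]
      V[OF affine_in[OF E(1) X Y], of p] V[OF affine_in[OF E(1) Y X], of p]
    \<comment> \<open>Equality of the two torsions, arranged as an equation between sums so that
      both sides lie in the tangent space.\<close>
    have "(\<lambda>c. D X Y p c + E Y X p c) = (\<lambda>c. D Y X p c + E X Y p c)"
    proof (rule tangent_space_separated[OF tangent_space_add[OF i(1,4)] tangent_space_add[OF i(2,3)]])
      fix h assume h: "smooth_fun A h"
      have "vf_apply A (D X Y) h p - vf_apply A (D Y X) h p = vf_apply A (E X Y) h p - vf_apply A (E Y X) h p"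
        using D(2)[unfolded torsion_free_def, rule_format, OF X Y h, of p]
          E(2)[unfolded torsion_free_def, rule_format, OF X Y h, of p] by argo
      then show "tangent_deriv A p (\<lambda>c. D X Y p c + E Y X p c) h = tangent_deriv A p (\<lambda>c. D Y X p c + E X Y p c) h"
        unfolding tangent_deriv_add[OF i(1) h i(4)] tangent_deriv_add[OF i(2) h i(3)] vf_apply_def by argo
    qed
    then have "g p (\<lambda>c. D X Y p c + E Y X p c) (Z p) = g p (\<lambda>c. D Y X p c + E X Y p c) (Z p)" by simp
    then show ?thesis
      unfolding T_def metric_add_left[OF i(1,4) V[OF Z]] metric_add_left[OF i(2,3) V[OF Z]] by argo
  qed
  have anti: "T X Y Z = - T X Z Y"
    if X: "X \<in> vector_fields A" and Y: "Y \<in> vector_fields A" and Z: "Z \<in> vector_fields A" for X Y Z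
  proof -
    have "g p (D X Y p) (Z p) + g p (Y p) (D X Z p) = g p (E X Y p) (Z p) + g p (Y p) (E X Z p)"
      using D(3)[unfolded metric_compatible_def, rule_format, OF X Y Z, of p]
        E(3)[unfolded metric_compatible_def, rule_format, OF X Y Z, of p] by argo
    then show ?thesis
      unfolding T_def metric_sym[OF V[OF Y] V[OF affine_in[OF D(1) X Z]]]
        metric_sym[OF V[OF Y] V[OF affine_in[OF E(1) X Z]]] by argo
  qed
  \<comment> \<open>Alternating the two rules six times returns to T X Y Z with three sign changes,
    so it equals its own negative.\<close>
  have zero: "T X Y Z = 0" if "Z \<in> vector_fields A" for Z
    using anti[OF X Y that] sym[OF X that Y] anti[OF that X Y] sym[OF that Y X] anti[OF Y that X]
      sym[OF Y X that] by argo
  show "D X Y p = E X Y p"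
  proof (rule metric_nondegenerate[OF V[OF affine_in[OF D(1) X Y]] V[OF affine_in[OF E(1) X Y]]])
    fix w assume "w \<in> tangent_space A p"
    then obtain Z where "Z \<in> vector_fields A" "Z p = w" by (rule tangent_extends)
    then show "g p (D X Y p) w = g p (E X Y p) w" using zero[of Z] by (simp add: T_def)
  qed
qed

lemma levi_civita:
  "affine_connection A (levi_civita A g)" "torsion_free A (levi_civita A g)"
  "metric_compatible A g (levi_civita A g)"
proof -
  have "affine_connection A (levi_civita A g) \<and> torsion_free A (levi_civita A g)
      \<and> metric_compatible A g (levi_civita A g)"
    unfolding levi_civita_def
    using affine_lc torsion_free_lc metric_compatible_lc
    by (intro someI[of "\<lambda>D. affine_connection A D \<and> torsion_free A D \<and> metric_compatible A g D" lc]) blast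
  then show "affine_connection A (levi_civita A g)" "torsion_free A (levi_civita A g)"
    "metric_compatible A g (levi_civita A g)" by blast+
qed

text \<open>Transfers the Koszul formula to the unspecified choice in \<open>levi_civita\<close>;
  off vector fields that choice is unconstrained.\<close>

lemma levi_civita_eq_lc:
  "X \<in> vector_fields A \<Longrightarrow> Y \<in> vector_fields A \<Longrightarrow> levi_civita A g X Y = lc X Y"
  by (rule levi_civita_unique[OF levi_civita affine_lc torsion_free_lc metric_compatible_lc])

section \<open>The gradient\<close>

lemma gradient_exists:
  assumes "smooth_fun A f"
  obtains Z where "Z \<in> vector_fields A"
    "\<And>p w. w \<in> tangent_space A p \<Longrightarrow> g p (Z p) w = tangent_deriv A p w f"
proof (rule vector_field_riesz[of "\<lambda>p w. tangent_deriv A p w f"])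
  have *: "tangent_deriv A (param c x) (tvec c (param c x) u) f =
      frechet_derivative (\<lambda>x. f (param c x)) (at x) u" if "c \<in> A" "x \<in> img_of c" for c x u
    using tangent_deriv_smooth_chart[OF that(1) param_in_dom[OF that] tvec_in_tangent_space assms] that
    by (simp add: param_in_dom)
  show "linear (\<lambda>u. tangent_deriv A (param c x) (tvec c (param c x) u) f)" if "c \<in> A" "x \<in> img_of c" for c x
    using smooth_onD(3)[OF smooth_funD[OF assms that(1)] that(2)] by (simp add: *[OF that])
  show "smooth_on (img_of c) (\<lambda>x. tangent_deriv A (param c x) (tvec c (param c x) u) f)" if "c \<in> A" for c u
    by (rule smooth_on_cong[OF smooth_onD(4)[OF smooth_funD[OF assms that]] open_img[OF that]])
       (simp add: *[OF that])
qed (use that in blast)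

section \<open>Perturbed connections\<close>

text \<open>The minus sign offsets the one in \<open>hess\<close>. The correction is tensorial in X
  and Y, so the Leibniz rules survive; Z is any field here and will be the gradient of f.\<close>

definition perturbed :: "('a, 'e) conn \<Rightarrow> ('a \<Rightarrow> real) \<Rightarrow> ('a, 'e) vfield \<Rightarrow> ('a, 'e) conn" where
  "perturbed D l Z X Y = vf_add (D X Y) (vf_scale (\<lambda>p. - l p * g p (X p) (Y p)) Z)"

lemma smooth_perturbation:
  assumes "smooth_fun A l" "X \<in> vector_fields A" "Y \<in> vector_fields A"
  shows "smooth_fun A (\<lambda>p. - l p * g p (X p) (Y p))"
  using smooth_fun_mult[OF smooth_fun_diff[OF smooth_fun_const[of 0] assms(1)] smooth_metric[OF assms(2,3)]]
  by simp

lemma affine_perturbed: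
  assumes D: "affine_connection A D" and l: "smooth_fun A l" and Z: "Z \<in> vector_fields A"
  shows "affine_connection A (perturbed D l Z)"
  unfolding affine_connection_def
proof (intro conjI ballI allI impI)
  fix X Y assume X: "X \<in> vector_fields A" and Y: "Y \<in> vector_fields A"
  have right: "g p (Y p) (W p) = g p (W p) (Y p)" if "W \<in> vector_fields A" "Y \<in> vector_fields A" for W Y p
    using metric_sym vector_fieldD(1) that by blast
  show "perturbed D l Z X Y \<in> vector_fields A"
    unfolding perturbed_def
    by (intro vf_add_in vf_scale_in affine_in[OF D] smooth_perturbation l X Y Z)
  show "perturbed D l Z (vf_add X X') Y = vf_add (perturbed D l Z X Y) (perturbed D l Z X' Y)"
    if X': "X' \<in> vector_fields A" for X'
  proof -
    have "D (vf_add X X') Y = vf_add (D X Y) (D X' Y)"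
      using D X X' Y unfolding affine_connection_def by blast
    moreover have "g p (vf_add X X' p) (Y p) = g p (X p) (Y p) + g p (X' p) (Y p)" for p
      by (rule metric_vf_add[OF X X' vector_fieldD(1)[OF Y]])
    ultimately show ?thesis
      unfolding perturbed_def vf_scale_def by (simp add: fun_eq_iff) (simp add: vf_add_def algebra_simps)
  qed
  show "perturbed D l Z (vf_scale h X) Y = vf_scale h (perturbed D l Z X Y)" if h: "smooth_fun A h" for h
  proof -
    have "D (vf_scale h X) Y = vf_scale h (D X Y)"
      using D X Y h unfolding affine_connection_def by blast
    moreover have "g p (vf_scale h X p) (Y p) = h p * g p (X p) (Y p)" for p
      by (rule metric_vf_scale[OF X vector_fieldD(1)[OF Y]])
    ultimately show ?thesis
      unfolding perturbed_def by (simp add: fun_eq_iff vf_add_def) (simp add: vf_scale_def algebra_simps)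
  qed
  show "perturbed D l Z X (vf_add Y Y') = vf_add (perturbed D l Z X Y) (perturbed D l Z X Y')"
    if Y': "Y' \<in> vector_fields A" for Y'
  proof -
    have "D X (vf_add Y Y') = vf_add (D X Y) (D X Y')"
      using D X Y' Y unfolding affine_connection_def by blast
    moreover have "g p (X p) (vf_add Y Y' p) = g p (X p) (Y p) + g p (X p) (Y' p)" for p
      using metric_vf_add[OF Y Y' vector_fieldD(1)[OF X]] right[OF vf_add_in[OF Y Y'] X] right[OF Y X] right[OF Y' X]
      by simp
    ultimately show ?thesis
      unfolding perturbed_def vf_scale_def by (simp add: fun_eq_iff) (simp add: vf_add_def algebra_simps)
  qed
  show "perturbed D l Z X (vf_scale h Y) =
      vf_add (vf_scale (vf_apply A X h) Y) (vf_scale h (perturbed D l Z X Y))" if h: "smooth_fun A h" for h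
  proof -
    have "D X (vf_scale h Y) = vf_add (vf_scale (vf_apply A X h) Y) (vf_scale h (D X Y))"
      using D X Y h unfolding affine_connection_def by blast
    moreover have "g p (X p) (vf_scale h Y p) = h p * g p (X p) (Y p)" for p
      using metric_vf_scale[OF Y vector_fieldD(1)[OF X]] right[OF vf_scale_in[OF h Y] X] right[OF Y X] by simp
    ultimately show ?thesis
      unfolding perturbed_def by (simp add: fun_eq_iff vf_add_def) (simp add: vf_scale_def algebra_simps)
  qed
qed

lemma vf_apply_perturbed:
  assumes D: "affine_connection A D" and Z: "Z \<in> vector_fields A"
    and X: "X \<in> vector_fields A" and Y: "Y \<in> vector_fields A" and h: "smooth_fun A h"
  shows "vf_apply A (perturbed D l Z X Y) h p =
    vf_apply A (D X Y) h p - l p * g p (X p) (Y p) * vf_apply A Z h p"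
proof -
  note V = vector_fieldD(1)
  have "perturbed D l Z X Y p = (\<lambda>c. D X Y p c + (- l p * g p (X p) (Y p)) *\<^sub>R Z p c)"
    by (simp add: perturbed_def vf_add_def vf_scale_def)
  then show ?thesis
    unfolding vf_apply_def
    by (simp only: tangent_deriv_add[OF V[OF affine_in[OF D X Y]] h tangent_space_scale[OF V[OF Z]]]
      tangent_deriv_scale[OF V[OF Z] h])
qed

lemma torsion_free_perturbed:
  assumes D: "affine_connection A D" and "torsion_free A D" and Z: "Z \<in> vector_fields A"
  shows "torsion_free A (perturbed D l Z)"
  unfolding torsion_free_def
proof (intro ballI allI impI)
  fix X Y h p assume X: "X \<in> vector_fields A" and Y: "Y \<in> vector_fields A" and h: "smooth_fun A h"
  have "vf_apply A (D X Y) h p - vf_apply A (D Y X) h p =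
      vf_apply A X (vf_apply A Y h) p - vf_apply A Y (vf_apply A X h) p"
    using assms(2) X Y h unfolding torsion_free_def by blast
  moreover have "g p (X p) (Y p) = g p (Y p) (X p)"
    using metric_sym vector_fieldD(1) X Y by blast
  ultimately show "vf_apply A (perturbed D l Z X Y) h p - vf_apply A (perturbed D l Z Y X) h p =
      vf_apply A X (vf_apply A Y h) p - vf_apply A Y (vf_apply A X h) p"
    unfolding vf_apply_perturbed[OF D Z X Y h] vf_apply_perturbed[OF D Z Y X h] by simp
qed

lemma hess_perturbed:
  assumes "affine_connection A D" "Z \<in> vector_fields A" "X \<in> vector_fields A" "Y \<in> vector_fields A"
    "smooth_fun A f"
  shows "hess A (perturbed D l Z) f X Y p = hess A D f X Y p + l p * g p (X p) (Y p) * vf_apply A Z f p"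
  unfolding hess_def vf_apply_perturbed[OF assms] by simp

end

section \<open>Geodesic convexity\<close>

text \<open>The second derivative test is applied in the open interval, where geodesics have
  two-sided derivatives; continuity then extends the inequality to the end points.\<close>

lemma convex_on_closed_interval:
  fixes h :: "real \<Rightarrow> real"
  assumes conv: "convex_on {0<..<1} h" and cont: "continuous_on {0..1} h"
  shows "convex_on {0..1} h"
proof (rule convex_onI)
  fix t x y :: real
  assume t: "0 < t" "t < 1" and xy: "x \<in> {0..1}" "y \<in> {0..1}"
  \<comment> \<open>Contraction towards the midpoint with a factor tending to 1. It maps [0,1] into
    the open interval and, being affine, commutes with convex combinations.\<close>
  define s where "s n x = 1 / 2 + (1 - inverse (real (Suc n))) * (x - 1 / 2)" for n x
  define z where "z = (1 - t) *\<^sub>R x + t *\<^sub>R y"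
  have z: "z \<in> {0..1}"
    unfolding z_def using xy t by (intro convexD_alt) auto
  have s: "s n x \<in> {0<..<1}" if "x \<in> {0..1}" for n x
  proof -
    have a: "0 \<le> 1 - inverse (real (Suc n))" "1 - inverse (real (Suc n)) < 1"
      by (auto simp: field_simps)
    have "\<bar>x - 1 / 2\<bar> \<le> 1 / 2" using that unfolding abs_le_iff atLeastAtMost_iff by linarith
    then have "\<bar>(1 - inverse (real (Suc n))) * (x - 1 / 2)\<bar> \<le> (1 - inverse (real (Suc n))) * (1 / 2)"
      unfolding abs_mult using a(1) by (intro mult_mono) simp_all
    also have "\<dots> < 1 / 2" using a by simp
    finally show ?thesis unfolding s_def greaterThanLessThan_iff by linarith
  qed
  have "(\<lambda>n. s n x) \<longlonglongrightarrow> 1 / 2 + (1 - 0) * (x - 1 / 2)" for x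
    unfolding s_def by (intro tendsto_intros LIMSEQ_inverse_real_of_nat)
  then have lim: "(\<lambda>n. h (s n x)) \<longlonglongrightarrow> h x" if "x \<in> {0..1}" for x
    using s[OF that] that by (intro continuous_on_tendsto_compose[OF cont]) (auto simp: less_imp_le)
  have "(\<lambda>n. (1 - t) * h (s n x) + t * h (s n y)) \<longlonglongrightarrow> (1 - t) * h x + t * h y"
    by (intro tendsto_intros lim xy)
  moreover have "h (s n z) \<le> (1 - t) * h (s n x) + t * h (s n y)" for n
  proof -
    have "1 / 2 + (1 - r) * (((1 - t) * x + t * y) - 1 / 2) =
        (1 - t) * (1 / 2 + (1 - r) * (x - 1 / 2)) + t * (1 / 2 + (1 - r) * (y - 1 / 2))" for r
      by (simp add: field_simps)
    then have "s n z = (1 - t) *\<^sub>R s n x + t *\<^sub>R s n y"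
      unfolding s_def z_def real_scaleR_def .
    then show ?thesis using convex_onD[OF conv, of t "s n x" "s n y"] s[OF xy(1)] s[OF xy(2)] t by simp
  qed
  ultimately show "h ((1 - t) *\<^sub>R x + t *\<^sub>R y) \<le> (1 - t) * h x + t * h y"
    unfolding z_def[symmetric] by (intro LIMSEQ_le[OF lim[OF z]]) auto
qed simp

context smooth_manifold
begin

lemma smooth_fun_continuous:
  assumes "smooth_fun A h"
  shows "continuous_on UNIV h"
proof (rule continuous_at_imp_continuous_on, rule ballI)
  fix p
  obtain c where c: "c \<in> A" "p \<in> dom_of c" by (rule chart_exists)
  have "continuous_on (dom_of c) (\<lambda>q. h (param c (coord c q)))"
    by (rule continuous_on_compose2[OF smooth_onD(5)[OF smooth_funD[OF assms c(1)]] continuous_coord[OF c(1)]])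
       (use c in \<open>auto simp: coord_in_img\<close>)
  then have "continuous_on (dom_of c) h"
    by (rule continuous_on_eq) (simp add: c)
  then show "isCont h p" using c open_dom continuous_on_eq_continuous_at by blast
qed

text \<open>Semidefiniteness is tested on the very field U chosen inside \<open>christoffel\<close>.
  Its chart components are constant near p, so U(U f) is the plain second derivative, and D U U has
  the Christoffel value as its component.\<close>

lemma hess_christoffel:
  assumes D: "affine_connection A D" and f: "smooth_fun A f" and psd: "hess_psd A D f p"
    and c: "c \<in> A" "p \<in> dom_of c"
  shows "0 \<le> frechet_derivative (\<lambda>y. frechet_derivative (\<lambda>x. f (param c x)) (at y) u) (at (coord c p)) u
    + frechet_derivative (\<lambda>x. f (param c x)) (at (coord c p)) (- christoffel A D c p u u)"
proof -
  define U where "U = (SOME U. extends_const A c p u U)"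
  have "extends_const A c p u U"
    unfolding U_def by (rule someI_ex[OF extends_const_exists[OF c]])
  then obtain V where U: "U \<in> vector_fields A" and V: "open V" "p \<in> V" "\<And>q. q \<in> V \<Longrightarrow> U q c = u"
    unfolding extends_const_def eventually_nhds by blast
  note x = c(1) coord_in_img[OF c]
  note F = smooth_funD[OF f c(1)]
  have DU: "D U U \<in> vector_fields A" using D U unfolding affine_connection_def by blast
  have "((\<lambda>x. U (param c x) c) has_derivative (\<lambda>w. 0)) (at (coord c p))"
    by (rule has_derivative_transform_within_open[OF has_derivative_const[where c = u]
          open_chart_preimage[OF c(1) V(1)] coord_in_preimage[OF c V(2)]])
       (simp add: chart_preimage_def V(3))
  note dU = frechet_derivative_at[OF this, symmetric]
  have "0 \<le> vf_apply A U (vf_apply A U f) p - vf_apply A (D U U) f p"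
    using psd U unfolding hess_psd_def hess_def by blast
  then show ?thesis
    using vf_apply_vf_apply_chart[OF x U U f] vf_apply_chart[OF x DU f] c V(3)[OF V(2)]
    by (simp add: christoffel_def U_def[symmetric] dU linear_0[OF smooth_onD(3)[OF F x(2)]]
        linear_neg[OF smooth_onD(3)[OF F x(2)]])
qed

lemma g_convexI:
  assumes D: "affine_connection A D" and f: "smooth_fun A f" and psd: "\<And>p. hess_psd A D f p"
  shows "g_convex A D f"
  unfolding g_convex_def
proof (intro allI impI)
  fix \<gamma> assume \<gamma>: "geodesic A D \<gamma>"
  let ?h = "\<lambda>t. f (\<gamma> t)"
  have cont: "continuous_on {0..1} \<gamma>" using \<gamma> by (simp add: geodesic_def)
  have second: "(?h has_real_derivative deriv ?h t) (at t) \<and>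
      (\<exists>h''. (deriv ?h has_real_derivative h'') (at t) \<and> 0 \<le> h'')" if t: "t \<in> {0<..<1}" for t
  proof -
    obtain c where c: "c \<in> A" "\<gamma> t \<in> dom_of c" by (rule chart_exists)
    let ?x = "\<lambda>s. coord c (\<gamma> s)"
    let ?F = "\<lambda>x. f (param c x)"
    \<comment> \<open>The chart is chosen for the single parameter t, but the first derivative must
      be known on a neighbourhood of t to be differentiated there.\<close>
    let ?O = "{0<..<1} \<inter> \<gamma> -` dom_of c"
    have O: "open ?O" "t \<in> ?O"
      using continuous_open_preimage[OF continuous_on_subset[OF cont
          greaterThanLessThan_subseteq_atLeastAtMost_iff[THEN iffD2]] open_greaterThanLessThan open_dom[OF c(1)]]
        t c by auto
    obtain x' x'' where geo: "\<And>t. t \<in> {0..1} \<Longrightarrow> \<gamma> t \<in> dom_of c \<Longrightarrow>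
        (?x has_vector_derivative x' t) (at t within {0..1}) \<and>
        (x' has_vector_derivative x'' t) (at t within {0..1}) \<and>
        x'' t + christoffel A D c (\<gamma> t) (x' t) (x' t) = 0"
      using \<gamma> c(1) unfolding geodesic_def by meson
    \<comment> \<open>Interior parameters: derivatives within {0..1} are ordinary
      derivatives.\<close>
    have vec: "(?x has_vector_derivative x' s) (at s)" "(x' has_vector_derivative x'' s) (at s)"
      if "s \<in> ?O" for s
      using geo[of s] that at_within_Icc_at[of 0 s 1] by auto
    note F = smooth_funD[OF f c(1)]
    have img: "?x s \<in> img_of c" if "s \<in> ?O" for s using that c(1) by (auto simp: coord_in_img)
    have x_deriv: "(?x has_derivative (\<lambda>h. h *\<^sub>R x' s)) (at s)" if "s \<in> ?O" for s
      using vec(1)[OF that] by (simp add: has_vector_derivative_def)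
    have h1: "(?h has_real_derivative frechet_derivative ?F (at (?x s)) (x' s)) (at s)" if s: "s \<in> ?O" for s
    proof -
      have "((\<lambda>s. ?F (?x s)) has_derivative (\<lambda>h. frechet_derivative ?F (at (?x s)) (h *\<^sub>R x' s))) (at s)"
        by (rule has_derivative_compose[OF x_deriv[OF s] smooth_onD(2)[OF F img[OF s]]])
      then have "(?h has_derivative (\<lambda>h. frechet_derivative ?F (at (?x s)) (h *\<^sub>R x' s))) (at s)"
        by (rule has_derivative_transform_within_open[OF _ O(1) s]) (use c in simp)
      then show ?thesis
        unfolding has_field_derivative_def
        by (simp add: linear_scale[OF smooth_onD(3)[OF F img[OF s]]] mult.commute[of _ "frechet_derivative _ _ _"])
    qed
    have comp: "((\<lambda>s. frechet_derivative ?F (at (?x s)) u) has_derivative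
        (\<lambda>h. frechet_derivative (\<lambda>y. frechet_derivative ?F (at y) u) (at (?x t)) (h *\<^sub>R x' t))) (at t)" for u
      by (rule has_derivative_compose[OF x_deriv[OF O(2)] smooth_onD(2)[OF smooth_onD(4)[OF F] img[OF O(2)]]])
    have x'_deriv: "(x' has_derivative (\<lambda>h. h *\<^sub>R x'' t)) (at t)"
      using vec(2)[OF O(2)] by (simp add: has_vector_derivative_def)
    have diff: "(\<lambda>s. frechet_derivative ?F (at (?x s)) u) differentiable (at t)" for u
      using comp unfolding differentiable_def by blast
    have "((\<lambda>s. frechet_derivative ?F (at (?x s)) (x' s)) has_derivative
        (\<lambda>h. frechet_derivative (\<lambda>s. frechet_derivative ?F (at (?x s)) (x' t)) (at t) h +
          frechet_derivative ?F (at (?x t)) (h *\<^sub>R x'' t))) (at t)"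
      by (rule has_derivative_linear_family[OF O smooth_onD(3)[OF F img] diff x'_deriv])
    then have "((\<lambda>s. frechet_derivative ?F (at (?x s)) (x' s)) has_derivative
        (\<lambda>h. frechet_derivative (\<lambda>y. frechet_derivative ?F (at y) (x' t)) (at (?x t)) (h *\<^sub>R x' t) +
          frechet_derivative ?F (at (?x t)) (h *\<^sub>R x'' t))) (at t)"
      unfolding frechet_derivative_at[OF comp, symmetric] .
    then have "(deriv ?h has_derivative
        (\<lambda>h. frechet_derivative (\<lambda>y. frechet_derivative ?F (at y) (x' t)) (at (?x t)) (h *\<^sub>R x' t) +
          frechet_derivative ?F (at (?x t)) (h *\<^sub>R x'' t))) (at t)"
      by (rule has_derivative_transform_within_open[OF _ O]) (rule DERIV_imp_deriv[OF h1, symmetric])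
    also have "(\<lambda>h. frechet_derivative (\<lambda>y. frechet_derivative ?F (at y) (x' t)) (at (?x t)) (h *\<^sub>R x' t) +
          frechet_derivative ?F (at (?x t)) (h *\<^sub>R x'' t)) =
        (*) (frechet_derivative (\<lambda>y. frechet_derivative ?F (at y) (x' t)) (at (?x t)) (x' t) +
          frechet_derivative ?F (at (?x t)) (x'' t))"
      by (rule ext) (simp add: linear_scale[OF smooth_onD(3)[OF F img[OF O(2)]]]
          linear_scale[OF smooth_onD(3)[OF smooth_onD(4)[OF F] img[OF O(2)]]] distrib_left mult.commute)
    finally have "(deriv ?h has_real_derivative
        (frechet_derivative (\<lambda>y. frechet_derivative ?F (at y) (x' t)) (at (?x t)) (x' t) +
          frechet_derivative ?F (at (?x t)) (x'' t))) (at t)"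
      unfolding has_field_derivative_def .
    \<comment> \<open>The geodesic equation turns the second derivative into the expression bounded
      in \<open>hess_christoffel\<close> with u = x' t.\<close>
    moreover have "x'' t = - christoffel A D c (\<gamma> t) (x' t) (x' t)"
      using geo[of t] t c(2) by (simp add: eq_neg_iff_add_eq_0)
    ultimately show ?thesis
      using hess_christoffel[OF D f psd c, of "x' t"] h1[OF O(2)] DERIV_imp_deriv by metis
  qed
  then obtain h'' where h'': "\<And>t. t \<in> {0<..<1} \<Longrightarrow> (deriv ?h has_real_derivative h'' t) (at t)"
    "\<And>t. t \<in> {0<..<1} \<Longrightarrow> 0 \<le> h'' t"
    by metis
  have "convex_on {0<..<1} ?h"
    by (rule f''_ge0_imp_convex[OF convex_real_interval(8) _ h''(1) h''(2)]) (use second in blast)+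
  moreover have "continuous_on {0..1} ?h"
    by (rule continuous_on_compose2[OF smooth_fun_continuous[OF f] cont]) simp
  ultimately show "convex_on {0..1} (f \<circ> \<gamma>)"
    unfolding comp_def by (rule convex_on_closed_interval)
qed

section \<open>Gluing by a partition of unity\<close>

text \<open>For a countable cover by bumps \<open>b\<^sub>n\<close>, the products of \<open>b\<^sub>n\<close> with all \<open>1 - b\<^sub>j\<close>, \<open>j < n\<close>, form a
  partition of unity that is locally finite without any refinement of the cover, because
  they vanish for large $n$ wherever some \<open>b\<^sub>j\<close> equals \<open>1\<close>.\<close>

lemma glue_coefficient:
  fixes a b :: "'i \<Rightarrow> 'a \<Rightarrow> real"
  assumes "\<And>p. \<exists>W k. open W \<and> p \<in> W \<and> (\<forall>q\<in>W. \<forall>i\<in>I. 0 \<le> a i q + k * b i q)"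
  obtains l where "smooth_fun A l" "\<And>q i. i \<in> I \<Longrightarrow> 0 \<le> a i q + l q * b i q"
proof -
  have "\<exists>\<eta> V k. smooth_fun A \<eta> \<and> (\<forall>q. 0 \<le> \<eta> q \<and> \<eta> q \<le> 1) \<and> open V \<and> p \<in> V \<and> (\<forall>q\<in>V. \<eta> q = 1) \<and>
      (\<forall>q. \<eta> q \<noteq> 0 \<longrightarrow> (\<forall>i\<in>I. 0 \<le> a i q + k * b i q))" for p
  proof -
    obtain W k where W: "open W" "p \<in> W" "\<And>q i. q \<in> W \<Longrightarrow> i \<in> I \<Longrightarrow> 0 \<le> a i q + k * b i q"
      using assms[of p] by blast
    obtain c where c: "c \<in> A" "p \<in> dom_of c" by (rule chart_exists)
    from bump_exists[OF c W(1,2)] obtain \<eta> V K where \<eta>: "smooth_fun A \<eta>" "\<And>q. 0 \<le> \<eta> q" "\<And>q. \<eta> q \<le> 1"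
      "open V" "p \<in> V" "\<And>q. q \<in> V \<Longrightarrow> \<eta> q = 1"
      "K \<subseteq> W \<inter> dom_of c" "\<And>q. q \<notin> K \<Longrightarrow> \<eta> q = 0" by metis
    then have "\<forall>q. \<eta> q \<noteq> 0 \<longrightarrow> (\<forall>i\<in>I. 0 \<le> a i q + k * b i q)" using W(3) by blast
    then show ?thesis using \<eta>(1-6) by blast
  qed
  then obtain \<eta> V k where \<eta>: "\<And>p. smooth_fun A (\<eta> p)" "\<And>p q. 0 \<le> \<eta> p q" "\<And>p q. \<eta> p q \<le> 1"
    and V: "\<And>p. open (V p)" "\<And>p. p \<in> V p" "\<And>p q. q \<in> V p \<Longrightarrow> \<eta> p q = 1"
    and k: "\<And>p q i. \<eta> p q \<noteq> 0 \<Longrightarrow> i \<in> I \<Longrightarrow> 0 \<le> a i q + k p * b i q"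
    by metis
  \<comment> \<open>Second countability enters here, through the Lindelof property: countably many
    of the neighbourhoods on which a bump equals 1 cover the manifold.\<close>
  obtain F where F: "F \<subseteq> range V" "countable F" "\<Union>F = \<Union>(range V)"
    using Lindelof[of "range V"] V(1) by blast
  then obtain C where C: "countable C" "F = V ` C" by (meson countable_subset_image)
  have cover: "\<exists>p\<in>C. q \<in> V p" for q using F(3) C(2) V(2) by blast
  then have "C \<noteq> {}" by blast
  \<comment> \<open>The enumeration may repeat points; the telescoping below does not require
    distinct ones.\<close>
  define pt where "pt = from_nat_into C"
  define \<beta> where "\<beta> n = \<eta> (pt n)" for n
  define \<psi> where "\<psi> n q = \<beta> n q * (\<Prod>j<n. 1 - \<beta> j q)" for n q
  \<comment> \<open>Stopping at the first neighbourhood that contains q makes the sum finite. By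
    \<open>l_eq\<close> every m with q in V (pt m) gives the same value, so on each V (pt m) this is
    one fixed finite sum.\<close>
  define l where "l q = (\<Sum>n\<le>(LEAST n. q \<in> V (pt n)). k (pt n) * \<psi> n q)" for q
  have in_V: "\<exists>n. q \<in> V (pt n)" for q
    using cover[of q] C(1) from_nat_into_surj unfolding pt_def by metis
  \<comment> \<open>The product is the part of 1 not yet distributed; \<psi> n takes the fraction
    \<beta> n of what remains.\<close>
  have total: "(\<Sum>n<m. \<psi> n q) = 1 - (\<Prod>j<m. 1 - \<beta> j q)" for m q
    by (induction m) (auto simp: \<psi>_def algebra_simps)
  have one: "(\<Sum>n\<le>m. \<psi> n q) = 1" and vanish: "\<And>n. m < n \<Longrightarrow> \<psi> n q = 0" if "q \<in> V (pt m)" for m q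
  proof -
    have b1: "1 - \<beta> m q = 0" using V(3)[OF that] by (simp add: \<beta>_def)
    then have "(\<Prod>j<Suc m. 1 - \<beta> j q) = 0" by simp
    then show "(\<Sum>n\<le>m. \<psi> n q) = 1" using total[where m = "Suc m"] by (simp add: lessThan_Suc_atMost)
    show "\<psi> n q = 0" if "m < n" for n
      using b1 that unfolding \<psi>_def by (subst prod_zero) auto
  qed
  have l_eq: "l q = (\<Sum>n\<le>m. k (pt n) * \<psi> n q)" if q: "q \<in> V (pt m)" for q m
  proof -
    let ?n = "LEAST n. q \<in> V (pt n)"
    have "?n \<le> m" "q \<in> V (pt ?n)" using q by (auto intro: Least_le LeastI)
    then show ?thesis
      unfolding l_def by (intro sum.mono_neutral_left) (auto simp: vanish)
  qed
  have "smooth_fun A (\<psi> n)" for n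
    unfolding \<psi>_def \<beta>_def
    by (intro smooth_fun_mult smooth_fun_prod smooth_fun_diff smooth_fun_const \<eta> finite_lessThan)
  then have smooth: "smooth_fun A (\<lambda>q. \<Sum>n\<le>m. k (pt n) * \<psi> n q)" for m
    by (intro smooth_fun_sum smooth_fun_mult smooth_fun_const)
  have "smooth_fun A l"
  proof (rule smooth_fun_local)
    fix q
    obtain m where "q \<in> V (pt m)" using in_V by blast
    then show "\<exists>W h. open W \<and> q \<in> W \<and> smooth_fun A h \<and> (\<forall>q\<in>W. l q = h q)"
      by (intro exI[of _ "V (pt m)"] exI[of _ "\<lambda>q. \<Sum>n\<le>m. k (pt n) * \<psi> n q"] conjI ballI V smooth l_eq)
  qed
  moreover have "0 \<le> a i q + l q * b i q" if i: "i \<in> I" for q i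
  proof -
    obtain m where m: "q \<in> V (pt m)" using in_V by blast
    have "0 \<le> \<psi> n q" for n
      unfolding \<psi>_def \<beta>_def using \<eta>(2,3) by (intro mult_nonneg_nonneg prod_nonneg) auto
    moreover have "\<eta> (pt n) q \<noteq> 0" if "\<psi> n q \<noteq> 0" for n using that by (auto simp: \<psi>_def \<beta>_def)
    ultimately have "0 \<le> \<psi> n q * (a i q + k (pt n) * b i q)" for n
      using k[OF _ i, of "pt n" q] by (cases "\<psi> n q = 0") auto
    then have "0 \<le> (\<Sum>n\<le>m. \<psi> n q * (a i q + k (pt n) * b i q))" by (intro sum_nonneg) auto
    also have "\<dots> = (\<Sum>n\<le>m. \<psi> n q) * a i q + (\<Sum>n\<le>m. k (pt n) * \<psi> n q) * b i q"
      unfolding sum_distrib_right sum.distrib[symmetric] by (intro sum.cong) (auto simp: algebra_simps)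
    also have "\<dots> = a i q + l q * b i q" by (simp add: one[OF m] l_eq[OF m])
    finally show ?thesis .
  qed
  ultimately show ?thesis using that by blast
qed

end

section \<open>Continuous families of quadratic forms\<close>

text \<open>Joint continuity in point and vector follows from bilinearity, since only finitely many
  coefficient functions occur.\<close>

lemma continuous_on_quadratic_form:
  fixes B :: "'e::euclidean_space \<Rightarrow> 'e \<Rightarrow> 'e \<Rightarrow> real"
  assumes "\<And>x v. x \<in> S \<Longrightarrow> linear (\<lambda>u. B x u v)" "\<And>x u. x \<in> S \<Longrightarrow> linear (B x u)"
    and "\<And>u v. continuous_on S (\<lambda>x. B x u v)"
  shows "continuous_on (S \<times> UNIV) (\<lambda>(x, u). B x u u)"
proof -
  have "B x u u = (\<Sum>i\<in>Basis. \<Sum>j\<in>Basis. (u \<bullet> i) * ((u \<bullet> j) * B x i j))" if "x \<in> S" for x u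
  proof -
    have "B x u u = (\<Sum>i\<in>Basis. (u \<bullet> i) * B x i u)"
      using linear_euclidean_expand[OF assms(1)[OF that], of u u] by simp
    also have "\<dots> = (\<Sum>i\<in>Basis. (u \<bullet> i) * (\<Sum>j\<in>Basis. (u \<bullet> j) * B x i j))"
      by (rule sum.cong[OF refl])
         (subst linear_euclidean_expand[OF assms(2)[OF that], of _ u], simp)
    finally show ?thesis by (simp add: sum_distrib_left)
  qed
  moreover have "continuous_on (S \<times> UNIV)
      (\<lambda>z. \<Sum>i\<in>Basis. \<Sum>j\<in>Basis. (snd z \<bullet> i) * ((snd z \<bullet> j) * B (fst z) i j))"
    by (intro continuous_intros continuous_on_compose2[OF assms(3) continuous_on_fst]) auto
  ultimately show ?thesis by (elim continuous_on_eq) auto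
qed

text \<open>On a compact set of points and unit vectors B is bounded below and C is bounded below by
  a positive number, so one k works there; homogeneity of degree two covers the other
  vectors.\<close>

lemma quadratic_form_dominated:
  fixes B C :: "'e::euclidean_space \<Rightarrow> 'e \<Rightarrow> 'e \<Rightarrow> real"
  assumes S: "open S" "x0 \<in> S"
    and B: "\<And>x v. x \<in> S \<Longrightarrow> linear (\<lambda>u. B x u v)" "\<And>x u. x \<in> S \<Longrightarrow> linear (B x u)"
      "\<And>u v. continuous_on S (\<lambda>x. B x u v)"
    and C: "\<And>x v. x \<in> S \<Longrightarrow> linear (\<lambda>u. C x u v)" "\<And>x u. x \<in> S \<Longrightarrow> linear (C x u)"
      "\<And>u v. continuous_on S (\<lambda>x. C x u v)"
    and pos: "\<And>x u. x \<in> S \<Longrightarrow> u \<noteq> 0 \<Longrightarrow> 0 < C x u u"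
  obtains T k where "open T" "x0 \<in> T" "T \<subseteq> S" "\<And>x u. x \<in> T \<Longrightarrow> 0 \<le> B x u u + k * C x u u"
proof -
  obtain r where r: "0 < r" "cball x0 r \<subseteq> S" using S open_contains_cball by blast
  let ?K = "cball x0 r \<times> sphere (0::'e) 1"
  have "compact ?K" by (intro compact_Times compact_cball compact_sphere)
  \<comment> \<open>The model space has positive dimension, so the unit sphere is nonempty and both
    minima exist.\<close>
  obtain e :: 'e where "e \<in> Basis" using nonempty_Basis by blast
  then have ne: "?K \<noteq> {}" using r(1) norm_Basis by fastforce
  have sub: "?K \<subseteq> S \<times> UNIV" using r(2) by blast
  note cB = continuous_on_subset[OF continuous_on_quadratic_form[of S B, OF B] sub]
    and cC = continuous_on_subset[OF continuous_on_quadratic_form[of S C, OF C] sub]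
  obtain y where y: "y \<in> ?K" "\<And>z. z \<in> ?K \<Longrightarrow> (case y of (x, u) \<Rightarrow> B x u u) \<le> (case z of (x, u) \<Rightarrow> B x u u)"
    using continuous_attains_inf[OF \<open>compact ?K\<close> ne cB] by blast
  obtain z where z: "z \<in> ?K" "\<And>w. w \<in> ?K \<Longrightarrow> (case z of (x, u) \<Rightarrow> C x u u) \<le> (case w of (x, u) \<Rightarrow> C x u u)"
    using continuous_attains_inf[OF \<open>compact ?K\<close> ne cC] by blast
  define M where "M = (case y of (x, u) \<Rightarrow> B x u u)"
  define m where "m = (case z of (x, u) \<Rightarrow> C x u u)"
  have m: "0 < m" using z(1) r(2) by (auto simp: m_def intro!: pos)
  \<comment> \<open>Makes k times the minimum m of C equal to the absolute value of M, which
    outweighs a negative minimum M of B.\<close>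
  define k where "k = \<bar>M\<bar> / m"
  have unit: "0 \<le> B x u u + k * C x u u" if "x \<in> cball x0 r" "norm u = 1" for x u
  proof -
    have "k * m \<le> k * C x u u"
      using z(2)[of "(x, u)"] that m by (intro mult_left_mono) (auto simp: m_def k_def)
    moreover have "k * m = \<bar>M\<bar>" using m by (simp add: k_def)
    moreover have "M \<le> B x u u" using y(2)[of "(x, u)"] that by (auto simp: M_def)
    ultimately show ?thesis by linarith
  qed
  show ?thesis
  proof (rule that[of "ball x0 r" k])
    fix x u assume x: "x \<in> ball x0 r"
    then have xS: "x \<in> S" "x \<in> cball x0 r" using r(2) by auto
    show "0 \<le> B x u u + k * C x u u"
    proof (cases "u = 0")
      case True
      then show ?thesis using linear_0[OF B(2)[OF xS(1)]] linear_0[OF C(2)[OF xS(1)]] by simp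
    next
      case False
      define v where "v = u /\<^sub>R norm u"
      have v: "norm v = 1" "u = norm u *\<^sub>R v" using False by (auto simp: v_def)
      have "B x u u = norm u * (norm u * B x v v)" "C x u u = norm u * (norm u * C x v v)"
        using linear_scale[OF B(1)[OF xS(1)], of "norm u" v] linear_scale[OF B(2)[OF xS(1)], of _ "norm u" v]
          linear_scale[OF C(1)[OF xS(1)], of "norm u" v] linear_scale[OF C(2)[OF xS(1)], of _ "norm u" v]
        by (simp_all flip: v(2))
      then have "B x u u + k * C x u u = norm u * (norm u * (B x v v + k * C x v v))"
        by (simp add: algebra_simps)
      then show ?thesis using unit[OF xS(2) v(1)] by simp
    qed
  qed (use r in auto)
qed

context riemannian_manifold
begin

section \<open>The Hessian of f and the choice of the coefficient\<close>

context
  fixes f :: "'a \<Rightarrow> real" and Z :: "('a, 'e) vfield"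
  assumes f: "smooth_fun A f" and Z: "Z \<in> vector_fields A"
    and grad: "\<And>p w. w \<in> tangent_space A p \<Longrightarrow> g p (Z p) w = tangent_deriv A p w f"
begin

text \<open>The derivative of X enters through X(X f) and through the connection, both times as the
  differential of f applied to it, since Z represents that differential. It cancels, leaving a
  quadratic form in the value of X.\<close>

lemma hess_levi_civita_chart:
  assumes c: "c \<in> A" and x: "x \<in> img_of c" and X: "X \<in> vector_fields A"
  shows "hess A (levi_civita A g) f X X (param c x) =
    frechet_derivative (\<lambda>y. frechet_derivative (\<lambda>x. f (param c x)) (at y) (X (param c x) c)) (at x)
      (X (param c x) c)
    - dgram c x (X (param c x) c) (X (param c x) c) (Z (param c x) c)
    + dgram c x (Z (param c x) c) (X (param c x) c) (X (param c x) c) / 2"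
proof -
  let ?p = "param c x"
  let ?dX = "frechet_derivative (\<lambda>x. X (param c x) c) (at x) (X ?p c)"
  note p = c param_in_dom[OF c x]
  note V = vector_fieldD(1)
  have "vf_apply A (levi_civita A g X X) f ?p = g ?p (Z ?p) (lc X X ?p)"
    unfolding levi_civita_eq_lc[OF X X] vf_apply_def by (rule grad[OF V[OF lc_in[OF X X]], symmetric])
  also have "\<dots> = koszul X X c x (Z ?p c)"
    using metric_lc[OF X X p V[OF Z]] metric_sym[OF V[OF Z] V[OF lc_in[OF X X]]] c x by simp
  also have "\<dots> = gram c x ?dX (Z ?p c) + dgram c x (X ?p c) (X ?p c) (Z ?p c)
      - dgram c x (Z ?p c) (X ?p c) (X ?p c) / 2"
    by (simp add: koszul_def field_simps)
  also have "gram c x ?dX (Z ?p c) = g ?p (Z ?p) (tvec c ?p ?dX)"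
    using metric_eq_gram[OF p V[OF Z] tvec_in_tangent_space[OF p]] p x gram_sym[OF c x] by simp
  also have "\<dots> = frechet_derivative (\<lambda>x. f (param c x)) (at x) ?dX"
    using tangent_deriv_smooth_chart[OF p tvec_in_tangent_space[OF p] f] p x
    by (simp add: grad[OF tvec_in_tangent_space[OF p]])
  finally show ?thesis
    unfolding hess_def vf_apply_vf_apply_chart[OF c x X X f] by argo
qed

lemma gradient_norm_eq: "vf_apply A Z f p = g p (Z p) (Z p)"
  unfolding vf_apply_def by (rule grad[OF vector_fieldD(1)[OF Z], symmetric])

lemma hess_dominated_near_noncritical:
  assumes "\<not> critical_point A f p"
  shows "\<exists>W k. open W \<and> p \<in> W \<and> (\<forall>q\<in>W. \<forall>X\<in>vector_fields A.
    0 \<le> hess A (levi_civita A g) f X X q + k * (g q (X q) (X q) * vf_apply A Z f q))"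
proof -
  note V = vector_fieldD(1)
  obtain v where v: "v \<in> tangent_space A p" "tangent_deriv A p v f \<noteq> 0"
    using assms by (auto simp: critical_point_def)
  \<comment> \<open>Otherwise Z p would pair to 0 with v; the zero vector is written as 0 times v to
    invoke homogeneity of g.\<close>
  have "Z p \<noteq> (\<lambda>c. 0)"
  proof
    assume "Z p = (\<lambda>c. 0)"
    moreover have "g p (\<lambda>c. 0 *\<^sub>R v c) v = 0" using metric_scale_left[OF v(1) v(1), of 0] by simp
    ultimately show False using grad[OF v(1)] v(2) by simp
  qed
  then have Np: "0 < vf_apply A Z f p" unfolding gradient_norm_eq by (rule metric_pos[OF V[OF Z]])
  obtain c where c: "c \<in> A" "p \<in> dom_of c" by (rule chart_exists)
  let ?F = "\<lambda>x. f (param c x)" and ?N = "\<lambda>x. vf_apply A Z f (param c x)"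
    and ?z = "\<lambda>x. Z (param c x) c"
  note F = smooth_funD[OF f c(1)]
  note z = vector_fieldD(2)[OF Z c(1)]
  have N: "smooth_on (img_of c) ?N" by (rule smooth_funD[OF smooth_fun_vf_apply[OF Z f] c(1)])
  \<comment> \<open>Where the gradient norm is positive, the form C below is positive
    definite.\<close>
  define S where "S = img_of c \<inter> ?N -` {0<..}"
  have S: "open S" "coord c p \<in> S"
    unfolding S_def using continuous_open_preimage[OF smooth_onD(5)[OF N] open_img[OF c(1)] open_greaterThan]
      c Np by (auto simp: coord_in_img)
  have img: "x \<in> img_of c" if "x \<in> S" for x using that by (simp add: S_def)
  \<comment> \<open>Only the diagonal of B is the Hessian. B need not be symmetric, and
    \<open>quadratic_form_dominated\<close> asks for linearity in each argument only.\<close>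
  define B where "B x u v = frechet_derivative (\<lambda>y. frechet_derivative ?F (at y) u) (at x) v
    - dgram c x u v (?z x) + dgram c x (?z x) u v / 2" for x u v
  define C where "C x u v = gram c x u v * ?N x" for x u v
  \<comment> \<open>Linearity in the inner direction is reduced to linearity in the outer one by
    symmetry of second derivatives.\<close>
  have Dlin: "linear (\<lambda>u. frechet_derivative (\<lambda>y. frechet_derivative ?F (at y) u) (at x) v)"
    "linear (frechet_derivative (\<lambda>y. frechet_derivative ?F (at y) u) (at x))" if "x \<in> S" for x u v
    using smooth_onD(3)[OF smooth_onD(4)[OF F] img[OF that]]
    by (simp_all add: second_derivative_symmetric[OF open_img[OF c(1)] F img[OF that], of _ v])
  obtain T k where T: "open T" "coord c p \<in> T" "T \<subseteq> S" "\<And>x u. x \<in> T \<Longrightarrow> 0 \<le> B x u u + k * C x u u"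
  proof (rule quadratic_form_dominated[OF S, of B C])
    fix x assume x: "x \<in> S"
    note l1 = linear_dgram1[OF c(1) img[OF x]] and l2 = linear_dgram2[OF c(1) img[OF x]]
      and l3 = linear_dgram3[OF c(1) img[OF x]] and g1 = linear_gram_left[OF c(1) img[OF x]]
      and g2 = linear_gram_right[OF c(1) img[OF x]]
    show "linear (\<lambda>u. B x u v)" for v
      unfolding B_def
      by (rule linearI) (simp_all add: linear_add[OF Dlin(1)[OF x]] linear_scale[OF Dlin(1)[OF x]]
          linear_add[OF l1] linear_scale[OF l1] linear_add[OF l2] linear_scale[OF l2] field_simps)
    show "linear (B x u)" for u
      by (rule linearI) (simp_all add: B_def linear_add[OF Dlin(2)[OF x]] linear_scale[OF Dlin(2)[OF x]]
          linear_add[OF l2] linear_scale[OF l2] linear_add[OF l3] linear_scale[OF l3] field_simps)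
    show "linear (\<lambda>u. C x u v)" for v
      unfolding C_def by (rule linearI) (simp_all add: linear_add[OF g1] linear_scale[OF g1] field_simps)
    show "linear (C x u)" for u
      by (rule linearI) (simp_all add: C_def linear_add[OF g2] linear_scale[OF g2] field_simps)
    show "0 < C x u u" if "u \<noteq> 0" for u
      unfolding C_def using x gram_pos[OF c(1) img[OF x] that] by (simp add: S_def)
  next
    fix u v
    have sub: "S \<subseteq> img_of c" by (auto simp: S_def)
    have "smooth_on (img_of c) (\<lambda>x. B x u v)"
      unfolding B_def divide_inverse
      by (intro smooth_on_add smooth_on_diff smooth_on_mult smooth_dgram smooth_on_const open_img c z
          smooth_onD(4)[OF smooth_onD(4)[OF F]])
    then show "continuous_on S (\<lambda>x. B x u v)" using smooth_onD(5) continuous_on_subset sub by blast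
    have "smooth_on (img_of c) (\<lambda>x. C x u v)"
      unfolding C_def by (intro smooth_on_mult smooth_gram open_img c N)
    then show "continuous_on S (\<lambda>x. C x u v)" using smooth_onD(5) continuous_on_subset sub by blast
  qed blast
  let ?W = "dom_of c \<inter> coord c -` T"
  have "open ?W"
    by (rule continuous_open_preimage[OF continuous_coord[OF c(1)] open_dom[OF c(1)] T(1)])
  moreover have "0 \<le> hess A (levi_civita A g) f X X q + k * (g q (X q) (X q) * vf_apply A Z f q)"
    if q: "q \<in> ?W" and X: "X \<in> vector_fields A" for q X
  proof -
    have qc: "c \<in> A" "q \<in> dom_of c" using q c by auto
    have "hess A (levi_civita A g) f X X q = B (coord c q) (X q c) (X q c)"
      using hess_levi_civita_chart[OF c(1) coord_in_img[OF qc] X] qc by (simp add: B_def)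
    moreover have "g q (X q) (X q) * vf_apply A Z f q = C (coord c q) (X q c) (X q c)"
      using metric_eq_gram[OF qc V[OF X] V[OF X]] qc by (simp add: C_def)
    ultimately show ?thesis using T(4)[of "coord c q" "X q c"] q by simp
  qed
  ultimately show ?thesis using c(2) T(2) by (intro exI[of _ ?W] exI[of _ k]) blast
qed

lemma psd_perturbation_exists:
  assumes "\<And>x. critical_point A f x \<Longrightarrow>
    \<exists>U. open U \<and> x \<in> U \<and> (\<forall>y\<in>U. hess_psd A (levi_civita A g) f y)"
  obtains l where "smooth_fun A l" "\<And>p. hess_psd A (perturbed (levi_civita A g) l Z) f p"
proof -
  have "\<exists>W k. open W \<and> p \<in> W \<and> (\<forall>q\<in>W. \<forall>X\<in>vector_fields A.
    0 \<le> hess A (levi_civita A g) f X X q + k * (g q (X q) (X q) * vf_apply A Z f q))" for p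
  proof (cases "critical_point A f p")
    case True
    then obtain U where "open U" "p \<in> U" "\<forall>y\<in>U. hess_psd A (levi_civita A g) f y" using assms by blast
    then show ?thesis by (intro exI[of _ U] exI[of _ 0]) (simp add: hess_psd_def)
  qed (rule hess_dominated_near_noncritical)
  \<comment> \<open>The index set consists of all vector fields. The local neighbourhoods and
    constants are uniform in the field, so one function l serves them all.\<close>
  from glue_coefficient[OF this] obtain l where l: "smooth_fun A l"
    "\<And>q X. X \<in> vector_fields A \<Longrightarrow>
      0 \<le> hess A (levi_civita A g) f X X q + l q * (g q (X q) (X q) * vf_apply A Z f q)"
    by blast
  then have "hess_psd A (perturbed (levi_civita A g) l Z) f p" for p
    unfolding hess_psd_def by (simp add: hess_perturbed[OF levi_civita(1) Z _ _ f] mult.assoc)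
  then show ?thesis using that l(1) by blast
qed

end

end

theorem proposition3p4:
  fixes A :: "('a::{t2_space, second_countable_topology}, 'e::euclidean_space) chart set"
    and g :: "('a, 'e) metric"
    and f :: "'a \<Rightarrow> real"
  assumes "smooth_atlas A"
    and "riemannian_metric A g"
    and "smooth_fun A f"
    and "\<And>x. critical_point A f x \<Longrightarrow>
           \<exists>U. open U \<and> x \<in> U \<and> (\<forall>y\<in>U. hess_psd A (levi_civita A g) f y)"
  shows "\<exists>D. affine_connection A D \<and> torsion_free A D \<and> g_convex A D f"
proof -
  interpret riemannian_manifold A g by unfold_locales (fact assms)+
  obtain Z where Z: "Z \<in> vector_fields A"
    "\<And>p w. w \<in> tangent_space A p \<Longrightarrow> g p (Z p) w = tangent_deriv A p w f"
    using gradient_exists[OF assms(3)] by blast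
  obtain l where l: "smooth_fun A l" "\<And>p. hess_psd A (perturbed (levi_civita A g) l Z) f p"
    using psd_perturbation_exists[OF assms(3) Z assms(4)] by blast
  let ?D = "perturbed (levi_civita A g) l Z"
  have "affine_connection A ?D" by (rule affine_perturbed[OF levi_civita(1) l(1) Z(1)])
  moreover have "torsion_free A ?D" by (rule torsion_free_perturbed[OF levi_civita(1,2) Z(1)])
  moreover have "g_convex A ?D f" by (rule g_convexI[OF calculation(1) assms(3) l(2)])
  ultimately show ?thesis by blast
qed

end
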